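(* Let $\{B_t; t\ge 0\}$ be standard $\mathbb{R}^2$-valued Brownian motion without drift started at $B_0=\rho_1(\cos\mu_1,\sin\mu_1)'$, where $0\le\rho_1<1$ and $-\pi\le\mu_1<\pi$. Let $\tau_1=\inf\{t;\|B_t\|=1\}$ and $\tau_2=\inf\{t;\|B_t\|=\rho_2^{-1}\}$, where $0<\rho_2<1$. Let $\Theta$ be the $[-\pi,\pi)$-valued random variable defined by $B_{\tau_1}=(\cos\Theta,\sin\Theta)'$. Then, for $-\pi\le\mu_2<\pi$, the conditional density of $\Theta$ given $B_{\tau_2}=\rho_2^{-1}(\cos\mu_2,\sin\mu_2)'$ is $$f(\theta)=C\left[\{1+\rho_1^2-2\rho_1\cos(\theta-\mu_1)\}\{1+\rho_2^2-2\rho_2\cos(\theta-\mu_2)\}\right]^{-1},\qquad -\pi\le\theta<\pi,$$ where $$C=\frac{(1-\rho_1^2)(1-\rho_2^2)\{1+\rho_1^2\rho_2^2-2\rho_1\rho_2\cos(\mu_1-\mu_2)\}}{2\pi(1-\rho_1^2\rho_2^2)}.$$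
   Context: The density is with respect to Lebesgue measure on $[-\pi,\pi)$. Note $\tau_2>\tau_1$ almost surely since the particle starts inside the unit disc. *)

theory Defs
  imports "HOL-Analysis.Analysis" "HOL-Probability.Probability"
begin

definition brownian_motion_C ::
  "'w measure \<Rightarrow> (real \<Rightarrow> 'w \<Rightarrow> complex) \<Rightarrow> complex \<Rightarrow> bool" where
  "brownian_motion_C M B x0 \<longleftrightarrow>
     prob_space M \<and>
     (\<forall>t. B t \<in> borel_measurable M) \<and>
     (\<forall>\<omega>\<in>space M. B 0 \<omega> = x0 \<and> continuous_on {0..} (\<lambda>t. B t \<omega>)) \<and>
     (\<forall>s t. 0 \<le> s \<and> s < t \<longrightarrow>
        distributed M lborel (\<lambda>\<omega>. B t \<omega> - B s \<omega>)
          (\<lambda>z. ennreal (normal_density 0 (sqrt (t - s)) (Re z) *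
                         normal_density 0 (sqrt (t - s)) (Im z)))) \<and>
     (\<forall>(ts :: nat \<Rightarrow> real) n. 0 \<le> ts 0 \<and> (\<forall>i<n. ts i < ts (Suc i)) \<longrightarrow>
        prob_space.indep_vars M (\<lambda>_. borel) (\<lambda>i \<omega>. B (ts (Suc i)) \<omega> - B (ts i) \<omega>) {..<n})"

definition hit_time :: "(real \<Rightarrow> 'w \<Rightarrow> complex) \<Rightarrow> real \<Rightarrow> 'w \<Rightarrow> real" where
  "hit_time B r \<omega> = Inf {t. 0 \<le> t \<and> cmod (B t \<omega>) = r}"

text \<open>Angle in [-pi, pi): for z on the unit circle, z = cis (ang z).\<close>
definition ang :: "complex \<Rightarrow> real" where
  "ang z = (if Arg z = pi then - pi else Arg z)"

definition cond_dens :: "real \<Rightarrow> real \<Rightarrow> real \<Rightarrow> real \<Rightarrow> real \<Rightarrow> real" where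
  "cond_dens \<rho>1 \<mu>1 \<rho>2 \<mu>2 \<theta> =
     (1 - \<rho>1\<^sup>2) * (1 - \<rho>2\<^sup>2) * (1 + \<rho>1\<^sup>2 * \<rho>2\<^sup>2 - 2 * \<rho>1 * \<rho>2 * cos (\<mu>1 - \<mu>2))
       / (2 * pi * (1 - \<rho>1\<^sup>2 * \<rho>2\<^sup>2))
     / ((1 + \<rho>1\<^sup>2 - 2 * \<rho>1 * cos (\<theta> - \<mu>1)) * (1 + \<rho>2\<^sup>2 - 2 * \<rho>2 * cos (\<theta> - \<mu>2)))"

end

(* Let Theta and Phi be the angles at which the path first meets the circles of radius 1 and 1/rho2.
   Since a rotation invariant Gaussian vector N satisfies E (z + N)^m = z^m, the powers B_t^m are
   complex martingales. Optional stopping at both hitting times gives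
     E (f (B_tau1) B_tau2^m) = E (f (B_tau1) B_tau1^m)   and   E B_tau1^k = B_0^k,
   hence all Fourier coefficients of (Theta, Phi):
     E exp (i (n Theta + m Phi)) = rho2^|m| rho1^|n+m| exp (i (n+m) mu1).
   These are also the Fourier coefficients of the density built from two Poisson kernels, one for each
   passage, so by uniqueness on the torus that is the joint density. The same argument identifies the
   density of Phi, and cond_dens is the quotient of the two. *)
theory Submission
  imports Defs
begin

section \<open>Moments of the planar Gaussian distribution\<close>

text \<open>Conditioning on the second position means conditioning on a null event, so the claim is
  read as a disintegration: the candidate density, integrated against the law of the second angle,
  must return the joint law. The constant in \<open>cond_dens\<close> is what remains of the
  quotient of joint and marginal density; the marginal is a Poisson kernel with parameter
  \<open>\<rho>1 * \<rho>2\<close>, the starting modulus divided by the outer radius. The obstacle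
  is that both the martingales \<open>B t ^ m\<close> and the hitting times are unbounded. Stopping
  is therefore done at a fixed integer time T on the event that the circle has been reached, and T
  tends to infinity afterwards: paths still inside the circle are bounded by its radius, and their
  probability decays like 1/T. Only powers with nonnegative exponent enter, since z^m with m < 0 is
  singular at the origin. Negative m comes from complex conjugation, which also flips n; this is
  harmless because the weight f at the first circle is an arbitrary bounded Borel function and so
  allows either sign of n.\<close>

lemma lborel_complex: "(lborel :: complex measure) = distr (lborel \<Otimes>\<^sub>M lborel) borel (\<lambda>(x, y). Complex x y)"
proof (rule lborel_eqI)
  have meas: "(\<lambda>(x, y). Complex x y) \<in> borel_measurable (lborel \<Otimes>\<^sub>M lborel)"
    by (simp add: Complex_eq split_beta')
  fix l u :: complex assume le: "\<And>b. b \<in> Basis \<Longrightarrow> l \<bullet> b \<le> u \<bullet> b"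
  have le': "Re l \<le> Re u" "Im l \<le> Im u"
    using le[of 1] le[of \<i>] by (auto simp: Basis_complex_def)
  have "(\<lambda>(x, y). Complex x y) -` box l u \<inter> space (lborel \<Otimes>\<^sub>M lborel) = {Re l<..<Re u} \<times> {Im l<..<Im u}"
    by (auto simp: in_box_complex_iff space_pair_measure)
  then have "emeasure (distr (lborel \<Otimes>\<^sub>M lborel) borel (\<lambda>(x, y). Complex x y)) (box l u)
      = ennreal (Re u - Re l) * ennreal (Im u - Im l)"
    using le' meas by (subst emeasure_distr) (auto simp: lborel.emeasure_pair_measure_Times)
  also have "\<dots> = (\<Prod>b\<in>Basis. (u - l) \<bullet> b)"
    using le' by (simp add: Basis_complex_def ennreal_mult)
  finally show "emeasure (distr (lborel \<Otimes>\<^sub>M lborel) borel (\<lambda>(x, y). Complex x y)) (box l u)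
     = (\<Prod>b\<in>Basis. (u - l) \<bullet> b)" .
qed simp

definition gaussian_density :: "real \<Rightarrow> complex \<Rightarrow> real" where
  "gaussian_density \<sigma> z = normal_density 0 \<sigma> (Re z) * normal_density 0 \<sigma> (Im z)"

lemma gaussian_density_nonneg [simp]: "0 \<le> gaussian_density \<sigma> z"
  by (simp add: gaussian_density_def)

lemma gaussian_density_measurable [measurable]: "gaussian_density \<sigma> \<in> borel_measurable borel"
  unfolding gaussian_density_def normal_density_def by measurable

lemma normal_moment_cases:
  assumes "0 < \<sigma>"
  shows "has_bochner_integral lborel (\<lambda>x. normal_density 0 \<sigma> x * x ^ k)
    (if even k then fact k / ((2 / \<sigma>\<^sup>2) ^ (k div 2) * fact (k div 2)) else 0)"
proof (cases "even k")
  case True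
  then obtain l where "k = 2 * l" by blast
  then show ?thesis using normal_moment_even[OF assms, of 0 l] by simp
next
  case False
  then obtain l where "k = 2 * l + 1" using oddE by blast
  then show ?thesis using normal_moment_odd[OF assms, of 0 l] by simp
qed

lemma gaussian_product_moment:
  assumes "0 < \<sigma>"
  shows "has_bochner_integral lborel
      (\<lambda>z. gaussian_density \<sigma> z * (Re z ^ j * Im z ^ k))
      ((\<integral>x. normal_density 0 \<sigma> x * x ^ j \<partial>lborel) * (\<integral>x. normal_density 0 \<sigma> x * x ^ k \<partial>lborel))"
proof -
  define f where "f j = (\<lambda>x. normal_density 0 \<sigma> x * x ^ j)" for j
  have f: "integrable lborel (f j)" for j
    using normal_moment_cases[OF assms, of j] by (auto simp: f_def has_bochner_integral_iff)
  have [measurable]: "f j \<in> borel_measurable borel" for j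
    using f[of j] by (auto dest: borel_measurable_integrable)
  have meas: "(\<lambda>(x, y). Complex x y) \<in> borel_measurable (lborel \<Otimes>\<^sub>M lborel)"
    by (simp add: Complex_eq split_beta')
  have int: "integrable (lborel \<Otimes>\<^sub>M lborel) (\<lambda>(x, y). f j x * f k y)"
  proof (rule lborel_pair.Fubini_integrable)
    show "integrable lborel (\<lambda>x. \<integral>y. norm (case (x, y) of (x, y) \<Rightarrow> f j x * f k y) \<partial>lborel)"
      using f by (auto simp: abs_mult intro!: integrable_norm)
    show "AE x in lborel. integrable lborel (\<lambda>y. case (x, y) of (x, y) \<Rightarrow> f j x * f k y)"
      using f by auto
  qed simp
  have "integral\<^sup>L (lborel \<Otimes>\<^sub>M lborel) (\<lambda>(x, y). f j x * f k y) = (\<integral>x. f j x \<partial>lborel) * (\<integral>y. f k y \<partial>lborel)"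
    by (subst lborel_pair.integral_fst'[OF int, symmetric]) simp
  then have *: "has_bochner_integral (lborel \<Otimes>\<^sub>M lborel) (\<lambda>(x, y). f j x * f k y)
     ((\<integral>x. f j x \<partial>lborel) * (\<integral>y. f k y \<partial>lborel))"
    using int by (simp add: has_bochner_integral_iff)
  show ?thesis
    unfolding f_def[symmetric]
    apply (subst lborel_complex, rule has_bochner_integral_distr[OF _ meas])
    subgoal by measurable
    subgoal using * by (simp add: f_def gaussian_density_def split_beta' ac_simps)
    done
qed

text \<open>Expanding (Re z + i Im z)^k leaves only products of one-dimensional moments. For odd k
  every product contains an odd moment. For k = 2l the even indices 2i survive, and the factorials
  of the two moments cancel against the binomial coefficient, so that every term is one common
  constant times (l choose i) (-1)^i; the sum is that constant times (1 - 1)^l.\<close>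

lemma gaussian_moment:
  assumes "0 < \<sigma>"
  shows gaussian_power_integrable: "integrable lborel (\<lambda>z. gaussian_density \<sigma> z *\<^sub>R z ^ k)"
    and gaussian_power_integral: "0 < k \<Longrightarrow> (\<integral>z. gaussian_density \<sigma> z *\<^sub>R z ^ k \<partial>lborel) = 0"
proof -
  define m where "m j = (\<integral>x. normal_density 0 \<sigma> x * x ^ j \<partial>lborel)" for j
  have expand: "gaussian_density \<sigma> z *\<^sub>R z ^ k =
     (\<Sum>j\<le>k. complex_of_real (gaussian_density \<sigma> z * (Re z ^ (k - j) * Im z ^ j)) * (of_nat (k choose j) * \<i> ^ j))" for z
  proof -
    have "z ^ k = (\<i> * of_real (Im z) + of_real (Re z)) ^ k"
      using complex_eq[of z] by (simp add: add.commute)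
    also have "\<dots> = (\<Sum>j\<le>k. of_nat (k choose j) * (\<i> * of_real (Im z)) ^ j * of_real (Re z) ^ (k - j))"
      by (rule binomial_ring)
    finally show ?thesis
      by (simp add: scaleR_conv_of_real sum_distrib_left power_mult_distrib ac_simps)
  qed
  have hbi: "has_bochner_integral lborel (\<lambda>z. gaussian_density \<sigma> z *\<^sub>R z ^ k)
      (\<Sum>j\<le>k. complex_of_real (m (k - j) * m j) * (of_nat (k choose j) * \<i> ^ j))"
    unfolding expand m_def
    by (intro has_bochner_integral_sum has_bochner_integral_mult_left has_bochner_integral_of_real
        gaussian_product_moment assms)
  then show "integrable lborel (\<lambda>z. gaussian_density \<sigma> z *\<^sub>R z ^ k)"
    by (simp add: has_bochner_integral_iff)
  assume k: "0 < k"
  have m: "m j = (if even j then fact j / ((2 / \<sigma>\<^sup>2) ^ (j div 2) * fact (j div 2)) else 0)" for j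
    using normal_moment_cases[OF assms, of j] by (simp add: m_def has_bochner_integral_iff)
  have "(\<Sum>j\<le>k. complex_of_real (m (k - j) * m j) * (of_nat (k choose j) * \<i> ^ j)) = 0"
  proof (cases "even k")
    case False
    then have "m (k - j) * m j = 0" if "j \<le> k" for j
      using that by (auto simp: m)
    then show ?thesis by (intro sum.neutral ballI) (simp only: atMost_iff of_real_0 mult_zero_left)
  next
    case True
    then obtain l where l: "k = 2 * l" by blast
    define c where "c = 2 / \<sigma>\<^sup>2"
    have c: "c \<noteq> 0" using assms by (simp add: c_def)
    have "(\<Sum>j\<le>k. complex_of_real (m (k - j) * m j) * (of_nat (k choose j) * \<i> ^ j))
        = (\<Sum>j\<in>(\<lambda>i. 2 * i) ` {..l}. complex_of_real (m (k - j) * m j) * (of_nat (k choose j) * \<i> ^ j))"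
    proof (rule sum.mono_neutral_right)
      show "\<forall>i\<in>{..k} - (*) 2 ` {..l}. complex_of_real (m (k - i) * m i) * (of_nat (k choose i) * \<i> ^ i) = 0"
      proof
        fix i assume i: "i \<in> {..k} - (*) 2 ` {..l}"
        have "odd i"
        proof
          assume "even i" then obtain i' where "i = 2 * i'" by blast
          with i l show False by auto
        qed
        then show "complex_of_real (m (k - i) * m i) * (of_nat (k choose i) * \<i> ^ i) = 0"
          by (simp add: m)
      qed
    qed (auto simp: l)
    also have "\<dots> = (\<Sum>i\<le>l. complex_of_real (m (2 * l - 2 * i) * m (2 * i)) * (of_nat ((2 * l) choose (2 * i)) * \<i> ^ (2 * i)))"
      by (subst sum.reindex) (auto simp: inj_on_def l)
    also have "\<dots> = (\<Sum>i\<le>l. complex_of_real (fact (2 * l) / (c ^ l * fact l)) * (of_nat (l choose i) * (-1) ^ i))"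
    proof (rule sum.cong[OF refl])
      fix i assume "i \<in> {..l}" then have i: "i \<le> l" by simp
      \<comment> \<open>With m (2j) = (2j)! / (c^j j!), the factorials (2i)! and (2l - 2i)! cancel
        and (2l)! / (c^l i! (l - i)!) remains.\<close>
      have "m (2 * l - 2 * i) * m (2 * i) * real ((2 * l) choose (2 * i)) = fact (2 * l) / (c ^ l * fact l) * real (l choose i)"
      proof -
        obtain d where d: "l = i + d" using i le_Suc_ex by blast
        show ?thesis
          using c unfolding d
          by (simp add: m c_def[symmetric] binomial_fact power_add field_simps)
      qed
      then have "complex_of_real (m (2 * l - 2 * i) * m (2 * i) * real ((2 * l) choose (2 * i)))
          = of_real (fact (2 * l) / (c ^ l * fact l) * real (l choose i))" by simp
      then show "complex_of_real (m (2 * l - 2 * i) * m (2 * i)) * (of_nat ((2 * l) choose (2 * i)) * \<i> ^ (2 * i))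
          = complex_of_real (fact (2 * l) / (c ^ l * fact l)) * (of_nat (l choose i) * (-1) ^ i)"
        unfolding power_mult[of \<i>] by (simp add: algebra_simps)
    qed
    also have "\<dots> = complex_of_real (fact (2 * l) / (c ^ l * fact l)) * (\<Sum>i\<le>l. of_nat (l choose i) * (-1) ^ i)"
      by (rule sum_distrib_left[symmetric])
    also have "(\<Sum>i\<le>l. of_nat (l choose i) * (-1) ^ i) = (0 :: complex)"
      using k l choose_alternating_sum[of l, where ?'a=complex] by (simp add: mult.commute)
    finally show ?thesis by simp
  qed
  with hbi show "(\<integral>z. gaussian_density \<sigma> z *\<^sub>R z ^ k \<partial>lborel) = 0"
    by (simp add: has_bochner_integral_iff)
qed

section \<open>Planar Brownian motion and its past\<close>

locale planar_brownian_motion = prob_space M for M :: "'w measure" +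
  fixes B :: "real \<Rightarrow> 'w \<Rightarrow> complex" and x0 :: complex
  assumes bm: "brownian_motion_C M B x0"
begin

lemma B_measurable [measurable]: "B t \<in> borel_measurable M"
  using bm by (auto simp: brownian_motion_C_def)

lemma B_0 [simp]: "\<omega> \<in> space M \<Longrightarrow> B 0 \<omega> = x0"
  and B_continuous: "\<omega> \<in> space M \<Longrightarrow> continuous_on {0..} (\<lambda>t. B t \<omega>)"
  using bm by (auto simp: brownian_motion_C_def)

lemma increment_distributed:
  "0 \<le> s \<Longrightarrow> s < t \<Longrightarrow> distributed M lborel (\<lambda>\<omega>. B t \<omega> - B s \<omega>) (\<lambda>z. ennreal (gaussian_density (sqrt (t - s)) z))"
  using bm by (auto simp: brownian_motion_C_def gaussian_density_def)

lemma increments_independent: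
  "0 \<le> ts 0 \<Longrightarrow> (\<And>i. i < n \<Longrightarrow> ts i < ts (Suc i)) \<Longrightarrow>
    indep_vars (\<lambda>_. borel) (\<lambda>i \<omega>. B (ts (Suc i)) \<omega> - B (ts i) \<omega>) {..<n}"
  for ts :: "nat \<Rightarrow> real"
  using bm unfolding brownian_motion_C_def by blast

lemma increment_has_integral:
  fixes f :: "complex \<Rightarrow> 'b :: {banach, second_countable_topology}"
  assumes "0 \<le> s" "s < t" and [measurable]: "f \<in> borel_measurable borel"
  shows increment_integrable_iff: "integrable M (\<lambda>\<omega>. f (B t \<omega> - B s \<omega>)) \<longleftrightarrow>
      integrable lborel (\<lambda>z. gaussian_density (sqrt (t - s)) z *\<^sub>R f z)"
    and increment_integral: "(\<integral>\<omega>. f (B t \<omega> - B s \<omega>) \<partial>M) =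
      (\<integral>z. gaussian_density (sqrt (t - s)) z *\<^sub>R f z \<partial>lborel)"
proof -
  have *: "distr M lborel (\<lambda>\<omega>. B t \<omega> - B s \<omega>) = density lborel (\<lambda>z. ennreal (gaussian_density (sqrt (t - s)) z))"
    using increment_distributed[OF assms(1,2)] by (simp add: distributed_def)
  have "integrable M (\<lambda>\<omega>. f (B t \<omega> - B s \<omega>)) \<longleftrightarrow> integrable (distr M lborel (\<lambda>\<omega>. B t \<omega> - B s \<omega>)) f"
    by (subst integrable_distr_eq) auto
  also have "\<dots> \<longleftrightarrow> integrable lborel (\<lambda>z. gaussian_density (sqrt (t - s)) z *\<^sub>R f z)"
    unfolding * by (subst integrable_density) auto
  finally show "integrable M (\<lambda>\<omega>. f (B t \<omega> - B s \<omega>)) \<longleftrightarrow>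
      integrable lborel (\<lambda>z. gaussian_density (sqrt (t - s)) z *\<^sub>R f z)" .
  have "(\<integral>\<omega>. f (B t \<omega> - B s \<omega>) \<partial>M) = integral\<^sup>L (distr M lborel (\<lambda>\<omega>. B t \<omega> - B s \<omega>)) f"
    by (subst integral_distr) auto
  also have "\<dots> = (\<integral>z. gaussian_density (sqrt (t - s)) z *\<^sub>R f z \<partial>lborel)"
    unfolding * by (subst integral_density) auto
  finally show "(\<integral>\<omega>. f (B t \<omega> - B s \<omega>) \<partial>M) =
      (\<integral>z. gaussian_density (sqrt (t - s)) z *\<^sub>R f z \<partial>lborel)" .
qed

lemma increment_power_integrable: "0 \<le> s \<Longrightarrow> s < t \<Longrightarrow> integrable M (\<lambda>\<omega>. (B t \<omega> - B s \<omega>) ^ k)"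
  by (subst increment_integrable_iff[where f="\<lambda>z. z ^ k"]) (auto intro!: gaussian_power_integrable)

lemma increment_power_integral: "0 \<le> s \<Longrightarrow> s < t \<Longrightarrow> 0 < k \<Longrightarrow> (\<integral>\<omega>. (B t \<omega> - B s \<omega>) ^ k \<partial>M) = 0"
  by (subst increment_integral[where f="\<lambda>z. z ^ k"]) (auto intro!: gaussian_power_integral)

lemma power_integrable:
  assumes "0 \<le> s"
  shows "integrable M (\<lambda>\<omega>. B s \<omega> ^ k)"
\<comment> \<open>At time 0 the position is the constant \<open>x0\<close> and the increment has no
  Gaussian density, so this case stands apart.\<close>
proof (cases "s = 0")
  case True
  then show ?thesis by (simp cong: Bochner_Integration.integrable_cong)
next
  case False
  have int: "integrable M (\<lambda>\<omega>. (B s \<omega> - x0) ^ j)" for j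
    using increment_power_integrable[of 0 s j] False assms
    by (simp cong: Bochner_Integration.integrable_cong)
  have "B s \<omega> ^ k = (\<Sum>j\<le>k. of_nat (k choose j) * (B s \<omega> - B 0 \<omega>) ^ j * x0 ^ (k - j))" if "\<omega> \<in> space M" for \<omega>
    using binomial_ring[of "B s \<omega> - x0" x0 k] that by simp
  then show ?thesis
    using int
    by (subst Bochner_Integration.integrable_cong[OF refl])
       (auto intro!: Bochner_Integration.integrable_sum integrable_mult_left integrable_mult_right)
qed

text \<open>The natural filtration. It is encoded as a measure space only to make adaptedness
  expressible as \<open>borel_measurable (past s)\<close>; its sets are what matters. It is neither
  completed nor made right-continuous, so events have to be placed in it exactly.\<close>

definition past :: "real \<Rightarrow> 'w measure" where
  "past s = sigma (space M) (\<Union>r\<in>{0..s}. (\<lambda>A. B r -` A \<inter> space M) ` sets borel)"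

lemma space_past [simp]: "space (past s) = space M"
  by (simp add: past_def space_measure_of_conv)

lemma sets_past: "sets (past s) = sigma_sets (space M) (\<Union>r\<in>{0..s}. (\<lambda>A. B r -` A \<inter> space M) ` sets borel)"
  unfolding past_def by (rule sets_measure_of) auto

lemma B_past_measurable: "0 \<le> r \<Longrightarrow> r \<le> s \<Longrightarrow> B r \<in> borel_measurable (past s)"
  by (rule measurableI) (auto simp: sets_past intro!: sigma_sets.Basic)

lemma past_subset: "sets (past s) \<subseteq> sets M"
  unfolding sets_past by (rule sets.sigma_sets_subset) auto

lemma past_mono: "s \<le> t \<Longrightarrow> sets (past s) \<subseteq> sets (past t)"
  unfolding sets_past by (rule sigma_sets_mono', rule UN_mono) auto

lemma past_measurable_M: "f \<in> borel_measurable (past s) \<Longrightarrow> f \<in> borel_measurable M"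
  using past_subset[of s] by (auto simp: measurable_def)

lemma past_measurable_mono: "s \<le> t \<Longrightarrow> f \<in> borel_measurable (past s) \<Longrightarrow> f \<in> borel_measurable (past t)"
  using past_mono[of s t] by (auto simp: measurable_def)

text \<open>Finite-dimensional events generate the past and are closed under intersection, unlike
  the preimages under a single \<open>B r\<close>. The family A is total, so that two cylinders can
  be merged by padding with UNIV.\<close>

definition cylinders :: "real \<Rightarrow> 'w set set" where
  "cylinders s = {{\<omega>\<in>space M. \<forall>r\<in>J. B r \<omega> \<in> A r} | J A. finite J \<and> J \<subseteq> {0..s} \<and> (\<forall>r. A r \<in> sets borel)}"

lemma cylinders_Int_stable: "Int_stable (cylinders s)"
proof (rule Int_stableI)
  fix a b assume "a \<in> cylinders s" "b \<in> cylinders s"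
  then obtain J A K C where
    *: "a = {\<omega>\<in>space M. \<forall>r\<in>J. B r \<omega> \<in> A r}" "finite J" "J \<subseteq> {0..s}" "\<And>r. A r \<in> sets borel"
       "b = {\<omega>\<in>space M. \<forall>r\<in>K. B r \<omega> \<in> C r}" "finite K" "K \<subseteq> {0..s}" "\<And>r. C r \<in> sets borel"
    unfolding cylinders_def by blast
  let ?A = "\<lambda>r. (if r \<in> J then A r else UNIV) \<inter> (if r \<in> K then C r else UNIV)"
  have "a \<inter> b = {\<omega>\<in>space M. \<forall>r\<in>J \<union> K. B r \<omega> \<in> ?A r}"
    using * by auto
  moreover have "\<forall>r. ?A r \<in> sets borel" using * by auto
  ultimately show "a \<inter> b \<in> cylinders s"
    unfolding cylinders_def using * by (intro CollectI exI[of _ "J \<union> K"] exI[of _ ?A]) auto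
qed

lemma sets_past_cylinders: "sets (past s) \<subseteq> sigma_sets (space M) (cylinders s)"
  unfolding sets_past
proof (rule sigma_sets_mono, safe)
  fix r A assume "r \<in> {0..s}" "A \<in> sets (borel :: complex measure)"
  then have "B r -` A \<inter> space M \<in> cylinders s"
    unfolding cylinders_def by (intro CollectI exI[of _ "{r}"] exI[of _ "\<lambda>_. A"]) auto
  then show "B r -` A \<inter> space M \<in> sigma_sets (space M) (cylinders s)" ..
qed

text \<open>On a grid through all times of the cylinder, the positions are \<open>x0\<close> plus
  partial sums of the increments before s. The cylinder is thus an event of the first block of
  increments, and the increment from s to t forms a second block.\<close>

lemma cylinder_increment_independent:
  assumes "0 \<le> s" "s < t" "a \<in> cylinders s" and C: "C \<in> sets borel"
  shows "a \<in> events" "prob (a \<inter> ((\<lambda>\<omega>. B t \<omega> - B s \<omega>) -` C \<inter> space M)) =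
    prob a * prob ((\<lambda>\<omega>. B t \<omega> - B s \<omega>) -` C \<inter> space M)"
proof -
  obtain J A where a: "a = {\<omega>\<in>space M. \<forall>r\<in>J. B r \<omega> \<in> A r}"
    and J: "finite J" "J \<subseteq> {0..s}" and A [measurable]: "\<And>r. A r \<in> sets borel"
    using assms(3) unfolding cylinders_def by blast
  \<comment> \<open>Time 0 is added so that the partial sums start from the known value
    \<open>x0\<close>, and s so that the last increment is exactly \<open>B t - B s\<close>.\<close>
  define xs where "xs = sorted_list_of_set (insert 0 (insert s J)) @ [t]"
  define ts where "ts i = xs ! i" for i
  \<comment> \<open>n counts the increments up to s: index n of the grid is s and index n + 1 is
    t.\<close>
  define n where "n = length (sorted_list_of_set (insert 0 (insert s J))) - 1"
  let ?S = "insert 0 (insert s J)"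
  have len: "length (sorted_list_of_set ?S) = Suc n"
    using J by (simp add: n_def card_insert_if Suc_leI card_gt_0_iff)
  have le: "r \<le> s" "0 \<le> r" if "r \<in> ?S" for r using that J assms by auto
  have setS: "set (sorted_list_of_set ?S) = ?S"
    using J by (subst set_sorted_list_of_set) auto
  have srt: "sorted_wrt (<) xs"
    unfolding xs_def sorted_wrt_append setS using le(1) assms(2) by (fastforce simp: setS)
  have inc: "ts i < ts j" if "i < j" "j \<le> Suc n" for i j
    using sorted_wrt_nth_less[OF srt that(1)] that(2) len by (simp add: ts_def xs_def)
  have rng: "ts ` {..n} = ?S"
  proof -
    have "ts ` {..n} = (\<lambda>i. sorted_list_of_set ?S ! i) ` {..<Suc n}"
      using len by (intro image_cong) (auto simp: ts_def xs_def nth_append simp del: sorted_list_of_set_insert_remove)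
    also have "\<dots> = set (sorted_list_of_set ?S)"
      unfolding set_conv_nth using len by auto
    finally show ?thesis using setS by simp
  qed
  have tsSuc: "ts (Suc n) = t" using len by (simp add: ts_def xs_def nth_append del: sorted_list_of_set_insert_remove)
  have ts0: "ts 0 = 0"
  proof -
    obtain i where i: "i \<le> n" "ts i = 0" using rng by (metis atMost_iff imageE insertI1)
    have "ts 0 \<in> ?S" using rng by blast
    then have "0 \<le> ts 0" using le by blast
    with inc[of 0 i] i show ?thesis by (cases "i = 0") auto
  qed
  have tsn: "ts n = s"
  proof -
    obtain i where i: "i \<le> n" "ts i = s" using rng by (metis atMost_iff imageE insertI1 insertI2)
    have "ts n \<in> ?S" using rng by blast
    then have "ts n \<le> s" using le by blast
    with inc[of i n] i show ?thesis by (cases "i = n") auto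
  qed
  define N where "N i \<omega> = B (ts (Suc i)) \<omega> - B (ts i) \<omega>" for i \<omega>
  have "indep_vars (\<lambda>_. borel) N {..<Suc n}"
    unfolding N_def using inc ts0 by (intro increments_independent) auto
  then have "indep_var (PiM {..<n} (\<lambda>_. borel)) (\<lambda>\<omega>. restrict (\<lambda>i. N i \<omega>) {..<n})
      (PiM {n} (\<lambda>_. borel)) (\<lambda>\<omega>. restrict (\<lambda>i. N i \<omega>) {n})"
    by (rule indep_var_restrict) auto
  note ind = this[unfolded indep_var_eq]
  have Bts: "B (ts i) \<omega> = x0 + (\<Sum>l<i. N l \<omega>)" if "\<omega> \<in> space M" for i \<omega>
  proof -
    have "(\<Sum>l<i. N l \<omega>) = B (ts i) \<omega> - B (ts 0) \<omega>"
      unfolding N_def by (rule sum_lessThan_telescope)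
    then show ?thesis using that ts0 by simp
  qed
  \<comment> \<open>The cylinder a, rewritten as a condition on the first n increments
    alone.\<close>
  define P where "P = {f\<in>space (PiM {..<n} (\<lambda>_. borel)). \<forall>i\<in>{i. i \<le> n \<and> ts i \<in> J}. x0 + (\<Sum>l<i. f l) \<in> A (ts i)}"
  have P: "P \<in> sets (PiM {..<n} (\<lambda>_. borel :: complex measure))"
    unfolding P_def by measurable
  have aP: "(\<lambda>\<omega>. restrict (\<lambda>i. N i \<omega>) {..<n}) -` P \<inter> space M = a"
  proof -
    have "(\<forall>r\<in>J. B r \<omega> \<in> A r) \<longleftrightarrow> (\<forall>i\<in>{i. i \<le> n \<and> ts i \<in> J}. x0 + (\<Sum>l<i. restrict (\<lambda>i. N i \<omega>) {..<n} l) \<in> A (ts i))"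
      if w: "\<omega> \<in> space M" for \<omega>
    proof -
      have "(\<forall>r\<in>J. B r \<omega> \<in> A r) \<longleftrightarrow> (\<forall>i\<in>{i. i \<le> n \<and> ts i \<in> J}. B (ts i) \<omega> \<in> A (ts i))"
        (is "?L \<longleftrightarrow> ?R")
      proof
        assume R: ?R
        show ?L
        proof
          fix r assume "r \<in> J"
          moreover from this rng obtain i where "i \<le> n" "r = ts i"
            by (metis atMost_iff imageE insertI2)
          ultimately show "B r \<omega> \<in> A r" using R by auto
        qed
      qed auto
      also have "\<dots> \<longleftrightarrow> (\<forall>i\<in>{i. i \<le> n \<and> ts i \<in> J}. x0 + (\<Sum>l<i. restrict (\<lambda>i. N i \<omega>) {..<n} l) \<in> A (ts i))"
        by (intro ball_cong refl) (simp add: Bts[OF w])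
      finally show ?thesis .
    qed
    then show ?thesis by (auto simp: P_def a space_PiM)
  qed
  define Q where "Q = (\<lambda>f. f n) -` C \<inter> space (PiM {n} (\<lambda>_. borel :: complex measure))"
  have Q: "Q \<in> sets (PiM {n} (\<lambda>_. borel :: complex measure))"
    unfolding Q_def using C by (intro measurable_sets measurable_component_singleton) auto
  have CQ: "(\<lambda>\<omega>. restrict (\<lambda>i. N i \<omega>) {n}) -` Q \<inter> space M = (\<lambda>\<omega>. B t \<omega> - B s \<omega>) -` C \<inter> space M"
    by (auto simp: Q_def space_PiM N_def tsn tsSuc)
  show "a \<in> events"
    unfolding aP[symmetric] using ind[THEN conjunct1, THEN conjunct1] P by (rule measurable_sets)
  show "prob (a \<inter> ((\<lambda>\<omega>. B t \<omega> - B s \<omega>) -` C \<inter> space M)) =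
    prob a * prob ((\<lambda>\<omega>. B t \<omega> - B s \<omega>) -` C \<inter> space M)"
    unfolding aP[symmetric] CQ[symmetric]
    by (rule indep_setD[OF ind[THEN conjunct2]]; rule sigma_sets.Basic) (use P Q in blast)+
qed

text \<open>Independence extends from two intersection-stable generators, the cylinders and the
  preimages under the increment, to the generated sigma-algebras, and the first of these contains
  every event of the past.\<close>

lemma past_increment_independent:
  assumes "0 \<le> s" "s < t" and W: "W \<in> borel_measurable (past s)"
  shows "indep_var borel W borel (\<lambda>\<omega>. B t \<omega> - B s \<omega>)"
proof -
  let ?N = "{(\<lambda>\<omega>. B t \<omega> - B s \<omega>) -` C \<inter> space M | C. C \<in> sets borel}"
  have ind: "indep_set (sigma_sets (space M) (cylinders s)) (sigma_sets (space M) ?N)"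
  proof (rule indep_set_sigma_sets)
    show "indep_set (cylinders s) ?N"
      unfolding indep_sets2_eq using cylinder_increment_independent[OF assms(1,2)] by auto
    show "Int_stable ?N"
    proof (rule Int_stableI, safe)
      fix C D :: "complex set" assume "C \<in> sets borel" "D \<in> sets borel"
      then show "\<exists>E. (\<lambda>\<omega>. B t \<omega> - B s \<omega>) -` C \<inter> space M \<inter> ((\<lambda>\<omega>. B t \<omega> - B s \<omega>) -` D \<inter> space M) =
        (\<lambda>\<omega>. B t \<omega> - B s \<omega>) -` E \<inter> space M \<and> E \<in> sets borel"
        by (intro exI[of _ "C \<inter> D"]) auto
    qed
  qed (rule cylinders_Int_stable)
  have "sigma_sets (space M) {W -` A \<inter> space M | A. A \<in> sets borel} \<subseteq> sets (past s)"
    using W by (subst space_past[of s, symmetric], intro sets.sigma_sets_subset) (use measurable_sets[OF W] in auto)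
  with sets_past_cylinders have sub: "sigma_sets (space M) {W -` A \<inter> space M | A. A \<in> sets borel} \<subseteq> sigma_sets (space M) (cylinders s)"
    by blast
  have "indep_set (sigma_sets (space M) {W -` A \<inter> space M | A. A \<in> sets borel}) (sigma_sets (space M) ?N)"
    using ind sub unfolding indep_sets2_eq by blast
  then show ?thesis
    unfolding indep_var_eq using past_measurable_M[OF W] by auto
qed

end

section \<open>Martingale property of powers\<close>

text \<open>Boundedness in L2 makes the sequence uniformly integrable. Concretely, the distance D is
  at most min D L + D^2 / L: the first part tends to 0 in mean by dominated convergence, the second
  is small uniformly in n once L is large.\<close>

lemma (in prob_space) integral_tendsto_of_square_bounded:
  fixes X :: "nat \<Rightarrow> 'a \<Rightarrow> 'b :: {banach, second_countable_topology}"
  assumes [measurable]: "\<And>n. X n \<in> borel_measurable M" "Y \<in> borel_measurable M"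
    and sq: "\<And>n. integrable M (\<lambda>\<omega>. (norm (X n \<omega>))\<^sup>2)" "\<And>n. (\<integral>\<omega>. (norm (X n \<omega>))\<^sup>2 \<partial>M) \<le> C"
    and lim: "\<And>\<omega>. \<omega> \<in> space M \<Longrightarrow> (\<lambda>n. X n \<omega>) \<longlonglongrightarrow> Y \<omega>"
    and K: "\<And>\<omega>. \<omega> \<in> space M \<Longrightarrow> norm (Y \<omega>) \<le> K"
  shows "(\<lambda>n. \<integral>\<omega>. X n \<omega> \<partial>M) \<longlonglongrightarrow> (\<integral>\<omega>. Y \<omega> \<partial>M)"
proof -
  define D where "D n \<omega> = norm (X n \<omega> - Y \<omega>)" for n \<omega>
  have [measurable]: "D n \<in> borel_measurable M" for n unfolding D_def by measurable
  have Dsq: "(D n \<omega>)\<^sup>2 \<le> 2 * (norm (X n \<omega>))\<^sup>2 + 2 * K\<^sup>2" if "\<omega> \<in> space M" for n \<omega>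
  proof -
    have "D n \<omega> \<le> norm (X n \<omega>) + K"
      unfolding D_def using norm_triangle_ineq4[of "X n \<omega>" "Y \<omega>"] K[OF that] by linarith
    then have "(D n \<omega>)\<^sup>2 \<le> (norm (X n \<omega>) + K)\<^sup>2"
      by (intro power_mono) (auto simp: D_def)
    also have "\<dots> \<le> 2 * (norm (X n \<omega>))\<^sup>2 + 2 * K\<^sup>2"
      using sum_squares_bound[of "norm (X n \<omega>)" K] by (simp add: power2_sum)
    finally show ?thesis .
  qed
  have intDsq: "integrable M (\<lambda>\<omega>. (D n \<omega>)\<^sup>2)" for n
    by (rule Bochner_Integration.integrable_bound[where f="\<lambda>\<omega>. 2 * (norm (X n \<omega>))\<^sup>2 + 2 * K\<^sup>2"])
      (use sq(1) Dsq in \<open>auto intro!: AE_I2\<close>)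
  have IDsq: "(\<integral>\<omega>. (D n \<omega>)\<^sup>2 \<partial>M) \<le> 2 * C + 2 * K\<^sup>2" for n
  proof -
    have "(\<integral>\<omega>. (D n \<omega>)\<^sup>2 \<partial>M) \<le> (\<integral>\<omega>. 2 * (norm (X n \<omega>))\<^sup>2 + 2 * K\<^sup>2 \<partial>M)"
      using sq(1) Dsq intDsq by (intro integral_mono) auto
    also have "\<dots> \<le> 2 * C + 2 * K\<^sup>2"
      using sq by (simp add: prob_space)
    finally show ?thesis .
  qed
  have intX: "integrable M (X n)" for n
  proof (rule Bochner_Integration.integrable_bound)
    show "integrable M (\<lambda>\<omega>. 1 + (norm (X n \<omega>))\<^sup>2)" using sq(1) by simp
    show "AE \<omega> in M. norm (X n \<omega>) \<le> norm (1 + (norm (X n \<omega>))\<^sup>2)"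
    proof (rule AE_I2)
      fix \<omega>
      have "norm (X n \<omega>) * 2 \<le> 1 + (norm (X n \<omega>))\<^sup>2"
        using sum_squares_bound[of "norm (X n \<omega>)" 1] by simp
      then have "norm (X n \<omega>) \<le> 1 + (norm (X n \<omega>))\<^sup>2"
        using norm_ge_zero[of "X n \<omega>"] by linarith
      then show "norm (X n \<omega>) \<le> norm (1 + (norm (X n \<omega>))\<^sup>2)" by simp
    qed
  qed simp
  have intY: "integrable M Y"
    by (rule integrable_const_bound[where B=K]) (use K in auto)
  have "(\<lambda>n. (\<integral>\<omega>. X n \<omega> \<partial>M) - (\<integral>\<omega>. Y \<omega> \<partial>M)) \<longlonglongrightarrow> 0"
  proof (rule tendstoI)
    fix e :: real assume e: "0 < e"
    \<comment> \<open>A exceeds every second moment of D; the added 1 makes it positive and the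
      final estimate strict. The choice L = 2 A / e turns the tail bound A / L into e / 2.\<close>
    define A where "A = 2 * C + 2 * K\<^sup>2 + 1"
    have A: "0 < A"
    proof -
      have "0 \<le> (\<integral>\<omega>. (D 0 \<omega>)\<^sup>2 \<partial>M)" by (intro integral_nonneg_AE) auto
      with IDsq[of 0] show ?thesis by (simp only: A_def)
    qed
    define L where "L = 2 * A / e"
    have L: "0 < L" using A e by (simp add: L_def)
    have "(\<lambda>n. \<integral>\<omega>. min (D n \<omega>) L \<partial>M) \<longlonglongrightarrow> (\<integral>\<omega>. 0 \<partial>M)"
    proof (rule integral_dominated_convergence[where w="\<lambda>_. L"])
      show "AE \<omega> in M. (\<lambda>n. min (D n \<omega>) L) \<longlonglongrightarrow> 0"
      proof (rule AE_I2)
        fix \<omega> assume "\<omega> \<in> space M"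
        have "(\<lambda>n. D n \<omega>) \<longlonglongrightarrow> 0"
          unfolding D_def using lim[OF \<open>\<omega> \<in> space M\<close>] by (rule tendsto_norm_zero[OF LIM_zero])
        then have "(\<lambda>n. min (D n \<omega>) L) \<longlonglongrightarrow> min 0 L" by (intro tendsto_min tendsto_const)
        then show "(\<lambda>n. min (D n \<omega>) L) \<longlonglongrightarrow> 0" using L by simp
      qed
    qed (use L in \<open>auto simp: D_def\<close>)
    then have "\<forall>\<^sub>F n in sequentially. (\<integral>\<omega>. min (D n \<omega>) L \<partial>M) < e / 2"
      using e by (intro order_tendstoD) auto
    then show "\<forall>\<^sub>F n in sequentially. dist ((\<integral>\<omega>. X n \<omega> \<partial>M) - (\<integral>\<omega>. Y \<omega> \<partial>M)) 0 < e"
    proof eventually_elim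
      fix n assume n: "(\<integral>\<omega>. min (D n \<omega>) L \<partial>M) < e / 2"
      have imin: "integrable M (\<lambda>\<omega>. min (D n \<omega>) L)"
        using L by (intro integrable_const_bound[where B=L]) (auto simp: D_def)
      have "dist ((\<integral>\<omega>. X n \<omega> \<partial>M) - (\<integral>\<omega>. Y \<omega> \<partial>M)) 0 = norm (\<integral>\<omega>. X n \<omega> - Y \<omega> \<partial>M)"
        using intX intY by simp
      also have "\<dots> \<le> (\<integral>\<omega>. D n \<omega> \<partial>M)"
        unfolding D_def by (rule integral_norm_bound)
      also have "\<dots> \<le> (\<integral>\<omega>. min (D n \<omega>) L + (D n \<omega>)\<^sup>2 / L \<partial>M)"
      proof (rule integral_mono)
        show "integrable M (D n)" unfolding D_def using intX intY by auto
        show "integrable M (\<lambda>\<omega>. min (D n \<omega>) L + (D n \<omega>)\<^sup>2 / L)"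
          using imin intDsq by simp
        fix \<omega>
        have "D n \<omega> \<le> (D n \<omega>)\<^sup>2 / L" if "L \<le> D n \<omega>"
          using L that by (simp add: field_simps power2_eq_square mult_mono)
        moreover have "0 \<le> D n \<omega>" by (simp add: D_def)
        ultimately show "D n \<omega> \<le> min (D n \<omega>) L + (D n \<omega>)\<^sup>2 / L"
          using L by (cases "L \<le> D n \<omega>") (auto simp: min_def)
      qed
      also have "\<dots> = (\<integral>\<omega>. min (D n \<omega>) L \<partial>M) + (\<integral>\<omega>. (D n \<omega>)\<^sup>2 \<partial>M) / L"
        using imin intDsq by simp
      also have "\<dots> < e / 2 + A / L"
        using n IDsq[of n] L by (intro add_strict_mono divide_strict_right_mono) (auto simp: A_def)
      also have "\<dots> = e" using A e by (simp add: L_def)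
      finally show "dist ((\<integral>\<omega>. X n \<omega> \<partial>M) - (\<integral>\<omega>. Y \<omega> \<partial>M)) 0 < e" .
    qed
  qed
  then show ?thesis by (rule LIM_zero_cancel)
qed

context planar_brownian_motion
begin

text \<open>Writing B t as B s plus an increment independent of the past, every binomial term with a
  positive power of the increment has mean zero. The weight W plays the part of the conditioning;
  its products with all powers of \<open>B s\<close> must be integrable because the expansion
  produces every lower power.\<close>

lemma power_martingale:
  assumes "0 \<le> s" "s \<le> t" and W: "W \<in> borel_measurable (past s)"
    and int: "\<And>k. integrable M (\<lambda>\<omega>. W \<omega> * B s \<omega> ^ k)"
  shows power_martingale_integrable: "integrable M (\<lambda>\<omega>. W \<omega> * B t \<omega> ^ m)"
    and power_martingale_integral: "(\<integral>\<omega>. W \<omega> * B t \<omega> ^ m \<partial>M) = (\<integral>\<omega>. W \<omega> * B s \<omega> ^ m \<partial>M)"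
proof -
  have "integrable M (\<lambda>\<omega>. W \<omega> * B t \<omega> ^ m) \<and>
      (\<integral>\<omega>. W \<omega> * B t \<omega> ^ m \<partial>M) = (\<integral>\<omega>. W \<omega> * B s \<omega> ^ m \<partial>M)"
  proof (cases "s = t")
    case True
    then show ?thesis using int by simp
  next
    case False
    with assms have st: "s < t" by simp
    define N where "N \<omega> = B t \<omega> - B s \<omega>" for \<omega>
    have expand: "W \<omega> * B t \<omega> ^ m = (\<Sum>j\<le>m. of_nat (m choose j) * ((W \<omega> * B s \<omega> ^ (m - j)) * N \<omega> ^ j))" for \<omega>
    proof -
      have "B t \<omega> ^ m = (N \<omega> + B s \<omega>) ^ m" by (simp add: N_def)
      then show ?thesis
        unfolding binomial_ring by (simp add: sum_distrib_left ac_simps)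
    qed
    have ind: "indep_var borel (\<lambda>\<omega>. W \<omega> * B s \<omega> ^ i) borel (\<lambda>\<omega>. N \<omega> ^ j)" for i j
    proof -
      have "(\<lambda>\<omega>. W \<omega> * B s \<omega> ^ i) \<in> borel_measurable (past s)"
        using W B_past_measurable[OF assms(1) order_refl] by measurable
      from past_increment_independent[OF assms(1) st this]
      have "indep_var borel ((\<lambda>x. x) \<circ> (\<lambda>\<omega>. W \<omega> * B s \<omega> ^ i)) borel ((\<lambda>z. z ^ j) \<circ> (\<lambda>\<omega>. B t \<omega> - B s \<omega>))"
        by (rule indep_var_compose) auto
      then show ?thesis by (simp add: comp_def N_def)
    qed
    have N: "integrable M (\<lambda>\<omega>. N \<omega> ^ j)" for j
      unfolding N_def by (rule increment_power_integrable[OF assms(1) st])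
    have term_int: "integrable M (\<lambda>\<omega>. (W \<omega> * B s \<omega> ^ i) * N \<omega> ^ j)" for i j
      by (rule indep_var_integrable[OF ind int N])
    have term_0: "(\<integral>\<omega>. (W \<omega> * B s \<omega> ^ i) * N \<omega> ^ j \<partial>M) = 0" if "0 < j" for i j
      using increment_power_integral[OF assms(1) st that] indep_var_lebesgue_integral[OF ind int N, of i j]
      by (simp add: N_def)
    have "(\<integral>\<omega>. W \<omega> * B t \<omega> ^ m \<partial>M) =
        (\<Sum>j\<le>m. of_nat (m choose j) * (\<integral>\<omega>. (W \<omega> * B s \<omega> ^ (m - j)) * N \<omega> ^ j \<partial>M))"
      unfolding expand using term_int by (subst Bochner_Integration.integral_sum) auto
    also have "\<dots> = (\<Sum>j\<le>m. if j = 0 then (\<integral>\<omega>. W \<omega> * B s \<omega> ^ m \<partial>M) else 0)"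
      by (intro sum.cong refl) (auto simp: term_0)
    also have "\<dots> = (\<integral>\<omega>. W \<omega> * B s \<omega> ^ m \<partial>M)" by simp
    finally have "(\<integral>\<omega>. W \<omega> * B t \<omega> ^ m \<partial>M) = (\<integral>\<omega>. W \<omega> * B s \<omega> ^ m \<partial>M)" .
    moreover have "integrable M (\<lambda>\<omega>. W \<omega> * B t \<omega> ^ m)"
      unfolding expand using term_int by (intro Bochner_Integration.integrable_sum integrable_mult_right) auto
    ultimately show ?thesis by simp
  qed
  then show "integrable M (\<lambda>\<omega>. W \<omega> * B t \<omega> ^ m)"
    and "(\<integral>\<omega>. W \<omega> * B t \<omega> ^ m \<partial>M) = (\<integral>\<omega>. W \<omega> * B s \<omega> ^ m \<partial>M)" by auto
qed

text \<open>The weight may grow like a power of \<open>B s\<close> so that a weight containing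
  \<open>cnj (B s ^ m)\<close> is covered as well as a bounded one.\<close>

lemma bounded_power_integrable:
  assumes "0 \<le> s" and [measurable]: "W \<in> borel_measurable M" and c: "\<And>\<omega>. \<omega> \<in> space M \<Longrightarrow> cmod (W \<omega>) \<le> c * cmod (B s \<omega>) ^ m"
  shows "integrable M (\<lambda>\<omega>. W \<omega> * B s \<omega> ^ k)"
proof (rule Bochner_Integration.integrable_bound)
  show "integrable M (\<lambda>\<omega>. of_real c * B s \<omega> ^ (m + k))"
    using power_integrable[OF assms(1)] by auto
  show "AE \<omega> in M. norm (W \<omega> * B s \<omega> ^ k) \<le> norm (of_real c * B s \<omega> ^ (m + k))"
  proof (rule AE_I2)
    fix \<omega> assume "\<omega> \<in> space M"
    from c[OF this] have "cmod (W \<omega>) \<le> \<bar>c\<bar> * cmod (B s \<omega>) ^ m"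
      by (meson abs_ge_self mult_right_mono norm_ge_zero order_trans zero_le_power)
    then show "norm (W \<omega> * B s \<omega> ^ k) \<le> norm (of_real c * B s \<omega> ^ (m + k))"
      by (simp add: norm_mult norm_power power_add mult_right_mono mult.assoc[symmetric])
  qed
qed measurable

text \<open>With z and w the m-th powers at times s and t, |w|^2 = |z|^2 + 2 Re (cnj z (w - z)) + |w
  - z|^2. The cross term has mean zero by the martingale property, and the last term is
  nonnegative.\<close>

lemma power_square_submartingale:
  fixes V :: "'w \<Rightarrow> real"
  assumes "0 \<le> s" "s \<le> t" and V: "V \<in> borel_measurable (past s)"
    and bd: "\<And>\<omega>. \<omega> \<in> space M \<Longrightarrow> 0 \<le> V \<omega> \<and> V \<omega> \<le> c"
  shows "integrable M (\<lambda>\<omega>. V \<omega> * (cmod (B s \<omega> ^ m))\<^sup>2)"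
    and "(\<integral>\<omega>. V \<omega> * (cmod (B s \<omega> ^ m))\<^sup>2 \<partial>M) \<le> (\<integral>\<omega>. V \<omega> * (cmod (B t \<omega> ^ m))\<^sup>2 \<partial>M)"
proof -
  have [measurable]: "V \<in> borel_measurable M" by (rule past_measurable_M[OF V])
  have sq: "integrable M (\<lambda>\<omega>. V \<omega> * (cmod (B r \<omega> ^ m))\<^sup>2)" if "0 \<le> r" for r
  proof -
    have "integrable M (\<lambda>\<omega>. of_real (V \<omega>) * B r \<omega> ^ (2 * m))"
      by (rule bounded_power_integrable[where c=c and m=0]) (use that bd in auto)
    then have "integrable M (\<lambda>\<omega>. norm (of_real (V \<omega>) * B r \<omega> ^ (2 * m)))" by (rule integrable_norm)
    then show ?thesis
      by (rule Bochner_Integration.integrable_cong[THEN iffD1, OF refl, rotated])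
         (use bd in \<open>auto simp: norm_mult norm_power power_mult power2_eq_square power_mult_distrib\<close>)
  qed
  show "integrable M (\<lambda>\<omega>. V \<omega> * (cmod (B s \<omega> ^ m))\<^sup>2)" by (rule sq[OF assms(1)])
  \<comment> \<open>The conjugate of the earlier power is known at time s, so it can serve as the
    weight in the martingale identity for the cross term.\<close>
  define W where "W \<omega> = of_real (V \<omega>) * cnj (B s \<omega> ^ m)" for \<omega>
  have W: "W \<in> borel_measurable (past s)"
  proof -
    have [measurable]: "cnj \<in> borel_measurable borel"
      by (intro borel_measurable_continuous_onI continuous_intros)
    then have "(\<lambda>\<omega>. cnj (B s \<omega> ^ m)) \<in> borel_measurable (past s)"
      using B_past_measurable[OF assms(1) order_refl] by measurable
    then show ?thesis
      unfolding W_def using V by measurable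
  qed
  have int: "integrable M (\<lambda>\<omega>. W \<omega> * B s \<omega> ^ k)" for k
  proof (rule bounded_power_integrable[where c=c and m=m])
    show "W \<in> borel_measurable M" by (rule past_measurable_M[OF W])
    show "cmod (W \<omega>) \<le> c * cmod (B s \<omega>) ^ m" if "\<omega> \<in> space M" for \<omega>
      using bd[OF that] by (simp add: W_def norm_mult norm_power mult_right_mono)
  qed (rule assms(1))
  note mart = power_martingale[OF assms(1,2) W int]
  define a where "a r \<omega> = V \<omega> * (cmod (B r \<omega> ^ m))\<^sup>2" for r \<omega>
  define b where "b r \<omega> = W \<omega> * B r \<omega> ^ m" for r \<omega>
  have a: "integrable M (a s)" "integrable M (a t)"
    unfolding a_def using sq assms(1,2) by auto
  have b: "integrable M (b s)" "integrable M (b t)" "(\<integral>\<omega>. b t \<omega> \<partial>M) = (\<integral>\<omega>. b s \<omega> \<partial>M)"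
    unfolding b_def using mart int by auto
  have eq: "a t \<omega> = a s \<omega> + 2 * Re (b t \<omega> - b s \<omega>) + V \<omega> * (cmod (B t \<omega> ^ m - B s \<omega> ^ m))\<^sup>2" for \<omega>
  proof -
    have "(cmod w)\<^sup>2 = (cmod z)\<^sup>2 + 2 * Re (cnj z * w - cnj z * z) + (cmod (w - z))\<^sup>2" for w z
      unfolding cmod_power2 by (simp add: power2_eq_square algebra_simps)
    from this[of "B t \<omega> ^ m" "B s \<omega> ^ m"] show ?thesis
      unfolding a_def b_def W_def by (simp add: distrib_left mult.assoc right_diff_distrib)
  qed
  have "(\<integral>\<omega>. a s \<omega> \<partial>M) = (\<integral>\<omega>. a s \<omega> \<partial>M) + 2 * Re ((\<integral>\<omega>. b t \<omega> \<partial>M) - (\<integral>\<omega>. b s \<omega> \<partial>M))"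
    using b by simp
  also have "\<dots> = (\<integral>\<omega>. a s \<omega> + 2 * Re (b t \<omega> - b s \<omega>) \<partial>M)"
    using a b(1,2) by simp
  also have "\<dots> \<le> (\<integral>\<omega>. a t \<omega> \<partial>M)"
  proof (rule integral_mono)
    show "integrable M (\<lambda>\<omega>. a s \<omega> + 2 * Re (b t \<omega> - b s \<omega>))"
      using a b(1,2) by (intro Bochner_Integration.integrable_add integrable_mult_right integrable_Re Bochner_Integration.integrable_diff)
    show "a s \<omega> + 2 * Re (b t \<omega> - b s \<omega>) \<le> a t \<omega>" if "\<omega> \<in> space M" for \<omega>
      using bd[OF that] by (simp add: eq)
  qed (rule a)
  finally show "(\<integral>\<omega>. V \<omega> * (cmod (B s \<omega> ^ m))\<^sup>2 \<partial>M) \<le> (\<integral>\<omega>. V \<omega> * (cmod (B t \<omega> ^ m))\<^sup>2 \<partial>M)"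
    unfolding a_def .
qed

end

section \<open>Hitting times of circles\<close>

text \<open>Two roundings of a hitting time are used. Rounding down stays before it, so positions
  remain measurable in the past; rounding up gives a grid time at which the hit is already known, as
  optional stopping requires.\<close>

lemma floor_grid_tendsto: "(\<lambda>n. real_of_int \<lfloor>real n * t\<rfloor> / real n) \<longlonglongrightarrow> t" if "0 \<le> t" for t :: real
proof (rule tendsto_sandwich)
  show "\<forall>\<^sub>F n in sequentially. t - 1 / real n \<le> real_of_int \<lfloor>real n * t\<rfloor> / real n"
    using eventually_gt_at_top[of 0]
  proof eventually_elim
    fix n :: nat assume n: "0 < n"
    have "t - 1 / real n = (real n * t - 1) / real n" using n by (simp add: field_simps)
    also have "\<dots> \<le> real_of_int \<lfloor>real n * t\<rfloor> / real n"
      by (intro divide_right_mono) linarith+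
    finally show "t - 1 / real n \<le> real_of_int \<lfloor>real n * t\<rfloor> / real n" .
  qed
  show "\<forall>\<^sub>F n in sequentially. real_of_int \<lfloor>real n * t\<rfloor> / real n \<le> t"
    using eventually_gt_at_top[of 0] by eventually_elim (simp add: field_simps)
  show "(\<lambda>n. t - 1 / real n) \<longlonglongrightarrow> t"
    using tendsto_diff[OF tendsto_const lim_1_over_n, of t] by simp
qed simp

lemma ceiling_grid_tendsto: "(\<lambda>n. real_of_int \<lceil>real n * t\<rceil> / real n) \<longlonglongrightarrow> t" if "0 \<le> t" for t :: real
proof (rule tendsto_sandwich)
  show "\<forall>\<^sub>F n in sequentially. real_of_int \<lceil>real n * t\<rceil> / real n \<le> t + 1 / real n"
    using eventually_gt_at_top[of 0]
  proof eventually_elim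
    fix n :: nat assume n: "0 < n"
    have "real_of_int \<lceil>real n * t\<rceil> / real n \<le> (real n * t + 1) / real n"
      by (intro divide_right_mono) linarith+
    also have "\<dots> = t + 1 / real n" using n by (simp add: field_simps)
    finally show "real_of_int \<lceil>real n * t\<rceil> / real n \<le> t + 1 / real n" .
  qed
  show "\<forall>\<^sub>F n in sequentially. t \<le> real_of_int \<lceil>real n * t\<rceil> / real n"
    using eventually_gt_at_top[of 0] by eventually_elim (simp add: field_simps)
  show "(\<lambda>n. t + 1 / real n) \<longlonglongrightarrow> t"
    using tendsto_add[OF tendsto_const lim_1_over_n, of t] by simp
qed simp

context planar_brownian_motion
begin

text \<open>The event that the hitting time is at most s, phrased through the path itself because
  \<open>hit_time\<close> is the default value \<open>Inf {}\<close> on paths that miss the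
  circle.\<close>

definition hits :: "real \<Rightarrow> real \<Rightarrow> 'w set" where
  "hits r s = {\<omega>\<in>space M. \<exists>t\<in>{0..s}. cmod (B t \<omega>) = r}"

lemma hits_subset: "hits r s \<subseteq> space M"
  by (auto simp: hits_def)

lemma hits_mono: "s \<le> t \<Longrightarrow> hits r s \<subseteq> hits r t"
  by (auto simp: hits_def)

lemma path_continuous_on: "\<omega> \<in> space M \<Longrightarrow> S \<subseteq> {0..} \<Longrightarrow> continuous_on S (\<lambda>t. cmod (B t \<omega>))"
  using B_continuous by (intro continuous_on_norm) (rule continuous_on_subset)

lemma hits_of_le:
  assumes "\<omega> \<in> space M" "cmod x0 \<le> r" "0 \<le> t" "t \<le> s" "r \<le> cmod (B t \<omega>)"
  shows "\<omega> \<in> hits r s"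
proof -
  have "\<exists>u. 0 \<le> u \<and> u \<le> t \<and> cmod (B u \<omega>) = r"
    by (rule IVT') (use assms path_continuous_on in auto)
  then show ?thesis using assms by (auto simp: hits_def)
qed

text \<open>A continuous path that starts inside must cross the smaller circle before the larger
  one; this carries the order of the two passages through the proof.\<close>

lemma hits_antimono: "cmod x0 \<le> r \<Longrightarrow> r \<le> r' \<Longrightarrow> hits r' s \<subseteq> hits r s"
  by (auto simp: hits_def[of r'] intro: hits_of_le)

lemma hit_time_props:
  assumes "\<omega> \<in> hits r s"
  shows "0 \<le> hit_time B r \<omega>" "hit_time B r \<omega> \<le> s" "cmod (B (hit_time B r \<omega>) \<omega>) = r"
proof -
  let ?H = "{t. 0 \<le> t \<and> cmod (B t \<omega>) = r}"
  from assms have w: "\<omega> \<in> space M" and ex: "\<exists>t\<in>?H. t \<le> s" by (auto simp: hits_def)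
  have bdd: "bdd_below ?H" by (rule bdd_belowI[of _ 0]) auto
  \<comment> \<open>Closedness of the set of hitting times makes the infimum a hitting time
    itself.\<close>
  have "closed ({0..} \<inter> (\<lambda>t. cmod (B t \<omega>)) -` {r})"
    by (rule continuous_closed_preimage) (use path_continuous_on[OF w] in auto)
  also have "{0..} \<inter> (\<lambda>t. cmod (B t \<omega>)) -` {r} = ?H" by auto
  finally have "Inf ?H \<in> ?H" using ex bdd by (intro closed_contains_Inf) auto
  then show "0 \<le> hit_time B r \<omega>" "cmod (B (hit_time B r \<omega>) \<omega>) = r"
    by (auto simp: hit_time_def)
  show "hit_time B r \<omega> \<le> s"
    unfolding hit_time_def using ex cInf_lower[OF _ bdd] by force
qed

lemma hits_iff_hit_time:
  assumes "\<omega> \<in> hits r t" "s \<le> t"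
  shows "\<omega> \<in> hits r s \<longleftrightarrow> hit_time B r \<omega> \<le> s"
  using hit_time_props[OF assms(1)] hit_time_props(2)[of \<omega> r s] assms by (auto simp: hits_def)

text \<open>A path that avoids the circle up to s attains its maximal modulus on {0..s}, and this
  maximum is strictly below r. Avoidance is therefore a countable union over gaps of countable
  intersections over a dense set of times.\<close>

lemma hits_past:
  assumes r: "cmod x0 < r" and s: "0 \<le> s"
  shows "hits r s \<in> sets (past s)"
proof -
  \<comment> \<open>The dense set is taken inside {0..s}, so that only positions belonging to the
    past of s are consulted.\<close>
  obtain D where D: "countable D" "D \<subseteq> {0..s}" "{0..s} \<subseteq> closure D"
    using separable[of "{0..s}"] by blast
  have cl: "closure D = {0..s}"
    using D closure_minimal[of D "{0..s}"] by auto
  \<comment> \<open>The uniform gap is essential: a strict inequality on D alone would not pass to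
    the closure, whereas a bound by r minus a fixed positive amount does.\<close>
  define below where "below k = {\<omega>\<in>space (past s). \<forall>q\<in>D. cmod (B q \<omega>) \<le> r - inverse (real (Suc k))}" for k
  have below: "below k \<in> sets (past s)" for k
  proof -
    have "{\<omega>\<in>space (past s). cmod (B q \<omega>) \<le> r - inverse (real (Suc k))} \<in> sets (past s)" if "q \<in> D" for q
    proof -
      have [measurable]: "B q \<in> borel_measurable (past s)"
        using that D(2) by (intro B_past_measurable) auto
      show ?thesis by measurable
    qed
    moreover have "D \<noteq> {}" using D(3) s by force
    moreover from this have "below k = (\<Inter>q\<in>D. {\<omega>\<in>space (past s). cmod (B q \<omega>) \<le> r - inverse (real (Suc k))})"
      unfolding below_def by blast
    ultimately show ?thesis
      using D(1) by (simp only:) (intro sets.countable_INT', auto)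
  qed
  have "space M - hits r s = (\<Union>k. below k)"
  proof (intro set_eqI iffI)
    fix \<omega> assume "\<omega> \<in> space M - hits r s"
    then have w: "\<omega> \<in> space M" and nh: "\<omega> \<notin> hits r s" by auto
    have "compact {0..s}" "{0..s} \<noteq> {}" using s by auto
    from continuous_attains_sup[OF this path_continuous_on[OF w]]
    obtain u where u: "u \<in> {0..s}" "\<And>t. t \<in> {0..s} \<Longrightarrow> cmod (B t \<omega>) \<le> cmod (B u \<omega>)" by auto
    have "cmod (B u \<omega>) < r"
      using hits_of_le[OF w, of r u s] nh r u by force
    then obtain k where "inverse (real (Suc k)) < r - cmod (B u \<omega>)"
      using reals_Archimedean[of "r - cmod (B u \<omega>)"] by auto
    then have "\<omega> \<in> below k"
      using w D(2) u(2) by (fastforce simp: below_def)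
    then show "\<omega> \<in> (\<Union>k. below k)" by blast
  next
    fix \<omega> assume "\<omega> \<in> (\<Union>k. below k)"
    then obtain k where k: "\<omega> \<in> below k" by blast
    then have w: "\<omega> \<in> space M" by (auto simp: below_def)
    have "cmod (B t \<omega>) \<noteq> r" if t: "t \<in> {0..s}" for t
    proof -
      have "cmod (B t \<omega>) \<le> r - inverse (real (Suc k))"
        by (rule continuous_le_on_closure[of D]) (use path_continuous_on[OF w] k t in \<open>auto simp: cl below_def\<close>)
      moreover have "0 < inverse (real (Suc k))" by simp
      ultimately show ?thesis by linarith
    qed
    then show "\<omega> \<in> space M - hits r s" using w by (auto simp: hits_def)
  qed
  then have "hits r s = space (past s) - (\<Union>k. below k)"
    using hits_subset[of r s] by auto
  then show ?thesis
    using below by (simp only:) (intro sets.Diff sets.top sets.countable_UN, auto)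
qed

lemma hits_events: "cmod x0 < r \<Longrightarrow> 0 \<le> s \<Longrightarrow> hits r s \<in> events"
  using hits_past past_subset by blast

lemma hit_time_past:
  assumes r: "cmod x0 < r" and s: "0 \<le> s"
  shows "(\<lambda>\<omega>. if \<omega> \<in> hits r s then hit_time B r \<omega> else 0) \<in> borel_measurable (past s)"
  unfolding borel_measurable_iff_le
proof
  fix a :: real
  let ?S = "{\<omega>\<in>space (past s). (if \<omega> \<in> hits r s then hit_time B r \<omega> else 0) \<le> a}"
  consider "a < 0" | "s \<le> a" | "0 \<le> a" "a < s" by linarith
  then show "?S \<in> sets (past s)"
  proof cases
    case 1
    then have "?S = {}" using hit_time_props(1)[of _ r s] by force
    then show ?thesis by (simp only: sets.empty_sets)
  next
    case 2
    then have "?S = space (past s)" using hit_time_props(2)[of _ r s] s by force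
    then show ?thesis by (simp only: sets.top)
  next
    case 3
    then have "?S = hits r a \<union> (space (past s) - hits r s)"
      using hits_iff_hit_time[of _ r s a] hits_mono[of a s r] hits_subset[of r a] by auto
    \<comment> \<open>For 0 \<le> a the default value 0 also lies below a, which is why the paths
      without a hit join the level set just computed.\<close>
    moreover have "hits r a \<in> sets (past s)"
      using hits_past[OF r 3(1)] past_mono[of a s] 3 by auto
    ultimately show ?thesis
      using hits_past[OF r s] by (simp only:) (intro sets.Un sets.Diff sets.top)
  qed
qed

lemma path_tendsto:
  assumes "\<omega> \<in> space M" "\<And>n. 0 \<le> g n" "g \<longlonglongrightarrow> t" "0 \<le> t"
  shows "(\<lambda>n. B (g n) \<omega>) \<longlonglongrightarrow> B t \<omega>"
  using continuous_on_tendsto_compose[OF B_continuous[OF assms(1)] assms(3)] assms(2,4) by simp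

text \<open>Rounded down to a grid, the hitting time takes countably many values, all at most s, so
  the position there is measurable in the past; path continuity then gives the position at the
  hitting time as a limit.\<close>

lemma hit_position_past:
  assumes r: "cmod x0 < r" and s: "0 \<le> s"
  shows "(\<lambda>\<omega>. if \<omega> \<in> hits r s then B (hit_time B r \<omega>) \<omega> else 0) \<in> borel_measurable (past s)"
proof -
  define \<tau> where "\<tau> \<omega> = (if \<omega> \<in> hits r s then hit_time B r \<omega> else 0)" for \<omega>
  have [measurable]: "\<tau> \<in> borel_measurable (past s)"
    unfolding \<tau>_def by (rule hit_time_past[OF r s])
  have \<tau>: "0 \<le> \<tau> \<omega>" "\<tau> \<omega> \<le> s" for \<omega>
    using hit_time_props[of \<omega> r s] s by (auto simp: \<tau>_def)
  have grid: "(\<lambda>\<omega>. B (real_of_int \<lfloor>real n * \<tau> \<omega>\<rfloor> / real n) \<omega>) \<in> borel_measurable (past s)" for n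
  proof -
    \<comment> \<open>Clamping to {0..s} makes the position measurable in the past for every integer
      index, and it does not change the values that actually occur.\<close>
    have "(\<lambda>\<omega>. B (max 0 (min s (real_of_int \<lfloor>real n * \<tau> \<omega>\<rfloor> / real n))) \<omega>) \<in> borel_measurable (past s)"
    proof (rule measurable_compose_countable[where f="\<lambda>i \<omega>. B (max 0 (min s (real_of_int i / real n))) \<omega>"])
      show "B (max 0 (min s (real_of_int i / real n))) \<in> borel_measurable (past s)" for i
        using s by (intro B_past_measurable) auto
    qed measurable
    moreover have "max 0 (min s (real_of_int \<lfloor>real n * \<tau> \<omega>\<rfloor> / real n)) = real_of_int \<lfloor>real n * \<tau> \<omega>\<rfloor> / real n" for \<omega>
    proof -
      have "real_of_int \<lfloor>real n * \<tau> \<omega>\<rfloor> \<le> real n * s"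
        using \<tau>(2)[of \<omega>] by (meson mult_left_mono of_int_floor_le of_nat_0_le_iff order_trans)
      moreover have "0 \<le> \<lfloor>real n * \<tau> \<omega>\<rfloor>" using \<tau>(1)[of \<omega>] by simp
      ultimately show ?thesis using s by (cases "n = 0") (auto simp: field_simps max_def min_def)
    qed
    ultimately show ?thesis by simp
  qed
  have "(\<lambda>\<omega>. B (\<tau> \<omega>) \<omega>) \<in> borel_measurable (past s)"
  proof (rule borel_measurable_LIMSEQ_metric[OF grid])
    fix \<omega> assume "\<omega> \<in> space (past s)"
    then show "(\<lambda>n. B (real_of_int \<lfloor>real n * \<tau> \<omega>\<rfloor> / real n) \<omega>) \<longlonglongrightarrow> B (\<tau> \<omega>) \<omega>"
      using \<tau>(1)[of \<omega>] by (intro path_tendsto floor_grid_tendsto) auto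
  qed
  then have "(\<lambda>\<omega>. if \<omega> \<in> hits r s then B (\<tau> \<omega>) \<omega> else 0) \<in> borel_measurable (past s)"
    using hits_past[OF r s] by measurable
  then show ?thesis by (simp add: \<tau>_def cong: if_cong)
qed

text \<open>On paths that never reach the circle, \<open>hit_time\<close> is the junk value \<open>Inf {}\<close>, so the position
  there is that of the path at one fixed time.\<close>
lemma hit_position_measurable:
  assumes r: "cmod x0 < r"
  shows "(\<lambda>\<omega>. B (hit_time B r \<omega>) \<omega>) \<in> borel_measurable M"
proof (rule borel_measurable_LIMSEQ_metric)
  fix n :: nat
  have [measurable]: "hits r (real n) \<in> events" by (rule hits_events[OF r]) simp
  have [measurable]: "(\<lambda>\<omega>. if \<omega> \<in> hits r (real n) then B (hit_time B r \<omega>) \<omega> else 0) \<in> borel_measurable M"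
    by (rule past_measurable_M[OF hit_position_past[OF r]]) simp
  have "(\<lambda>\<omega>. if \<omega> \<in> hits r (real n) then (if \<omega> \<in> hits r (real n) then B (hit_time B r \<omega>) \<omega> else 0) else B (Inf {}) \<omega>) \<in> borel_measurable M"
    by measurable
  then show "(\<lambda>\<omega>. if \<omega> \<in> hits r (real n) then B (hit_time B r \<omega>) \<omega> else B (Inf {}) \<omega>) \<in> borel_measurable M"
    by (simp cong: if_cong)
next
  fix \<omega> assume w: "\<omega> \<in> space M"
  show "(\<lambda>n. if \<omega> \<in> hits r (real n) then B (hit_time B r \<omega>) \<omega> else B (Inf {}) \<omega>) \<longlonglongrightarrow> B (hit_time B r \<omega>) \<omega>"
  proof (cases "\<exists>t\<ge>0. cmod (B t \<omega>) = r")
    case True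
    then obtain t where t: "0 \<le> t" "cmod (B t \<omega>) = r" by blast
    have "\<forall>\<^sub>F n in sequentially. t \<le> real n"
      using filterlim_real_sequentially by (auto simp: filterlim_at_top)
    then have "\<forall>\<^sub>F n in sequentially. (if \<omega> \<in> hits r (real n) then B (hit_time B r \<omega>) \<omega> else B (Inf {}) \<omega>) = B (hit_time B r \<omega>) \<omega>"
      by eventually_elim (use w t in \<open>auto simp: hits_def\<close>)
    then show ?thesis by (rule tendsto_eventually)
  next
    case False
    then have "\<omega> \<notin> hits r (real n)" for n by (auto simp: hits_def)
    moreover have "hit_time B r \<omega> = Inf {}"
      unfolding hit_time_def by (rule arg_cong[where f=Inf]) (use False in blast)
    ultimately show ?thesis by simp
  qed
qed

end

section \<open>Optional stopping\<close>

context planar_brownian_motion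
begin

text \<open>Discretising the hitting time upwards to the grid \<open>{k/n}\<close>: exactly one grid interval
  contains it.\<close>
lemma grid_sum:
  fixes f :: "real \<Rightarrow> 'b :: comm_monoid_add" and n T :: nat
  assumes "cmod x0 < r" "0 < n"
  shows "(\<Sum>k<n * T. if \<omega> \<in> hits r (real (Suc k) / real n) - hits r (real k / real n) then f (real (Suc k) / real n) else 0)
    = (if \<omega> \<in> hits r (real T) then f (real_of_int \<lceil>real n * hit_time B r \<omega>\<rceil> / real n) else 0)"
proof (cases "\<omega> \<in> hits r (real T)")
  case False
  have "\<omega> \<notin> hits r (real (Suc k) / real n)" if "k < n * T" for k
  proof -
    have "Suc k \<le> n * T" using that by simp
    then have "real (Suc k) \<le> real (n * T)" by (simp only: of_nat_le_iff)
    then have "real (Suc k) / real n \<le> real T" using assms(2) by (simp add: field_simps)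
    then show ?thesis using False hits_mono by blast
  qed
  then show ?thesis using False by (auto intro!: sum.neutral)
next
  case True
  define \<tau> where "\<tau> = hit_time B r \<omega>"
  note props = hit_time_props[OF True, folded \<tau>_def]
  have w: "\<omega> \<in> space M" using True hits_subset by blast
  \<comment> \<open>The grid intervals are open on the left, so a hit at time 0 would belong to none
    of them; the start strictly inside the circle excludes it.\<close>
  have "\<tau> \<noteq> 0" using props(3) assms(1) w by auto
  with props(1) have pos: "0 < \<tau>" by simp
  \<comment> \<open>The hitting time lies in the interval from k0/n, excluded, to (k0 + 1)/n,
    included; hence the shift by one from the ceiling.\<close>
  define k0 where "k0 = nat \<lceil>real n * \<tau>\<rceil> - 1"
  have "0 < real n * \<tau>" using pos assms(2) by simp
  then have c1: "1 \<le> \<lceil>real n * \<tau>\<rceil>" by linarith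
  then have k0: "real (Suc k0) = real_of_int \<lceil>real n * \<tau>\<rceil>" by (simp add: k0_def of_nat_diff nat_diff_distrib)
  have "real n * \<tau> \<le> real n * real T" using props(2) by (simp add: mult_left_mono)
  then have "\<lceil>real n * \<tau>\<rceil> \<le> int (n * T)" by (simp add: ceiling_le_iff)
  then have k0T: "k0 < n * T" using c1 unfolding k0_def by linarith
  have iff: "\<omega> \<in> hits r (real (Suc k) / real n) - hits r (real k / real n) \<longleftrightarrow> k = k0" if k: "k < n * T" for k
  proof -
    have le: "real i / real n \<le> real T" if "i \<le> n * T" for i
    proof -
      have "real i \<le> real (n * T)" using that by (simp only: of_nat_le_iff)
      then show ?thesis using assms(2) by (simp add: field_simps)
    qed
    have "\<omega> \<in> hits r (real i / real n) \<longleftrightarrow> real n * \<tau> \<le> real i" if "i \<le> n * T" for i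
      using hits_iff_hit_time[OF True le[OF that]] assms(2) by (simp add: \<tau>_def field_simps)
    from this[of "Suc k"] this[of k] k
    have "\<omega> \<in> hits r (real (Suc k) / real n) - hits r (real k / real n) \<longleftrightarrow> real n * \<tau> \<le> real (Suc k) \<and> real k < real n * \<tau>"
      by auto
    also have "\<dots> \<longleftrightarrow> \<lceil>real n * \<tau>\<rceil> = int (Suc k)"
      by (auto simp: ceiling_eq_iff)
    also have "\<dots> \<longleftrightarrow> k = k0" using k0 by linarith
    finally show ?thesis .
  qed
  have "(\<Sum>k<n * T. if \<omega> \<in> hits r (real (Suc k) / real n) - hits r (real k / real n) then f (real (Suc k) / real n) else 0)
      = (\<Sum>k<n * T. if k = k0 then f (real (Suc k) / real n) else 0)"
    by (intro sum.cong refl) (simp only: iff lessThan_iff)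
  also have "\<dots> = f (real (Suc k0) / real n)" using k0T by simp
  finally show ?thesis using True k0 by (simp add: \<tau>_def)
qed

text \<open>The stopped discretisations are bounded in \<open>L\<^sup>2\<close> by the submartingale property, which replaces
  a maximal inequality in passing to the limit.\<close>
lemma optional_stopping:
  fixes T :: nat
  assumes r: "cmod x0 < r" and c: "\<And>\<omega>. \<omega> \<in> space M \<Longrightarrow> cmod (Z \<omega>) \<le> c"
    and Z: "\<And>s. 0 \<le> s \<Longrightarrow> (\<lambda>\<omega>. if \<omega> \<in> hits r s then Z \<omega> else 0) \<in> borel_measurable (past s)"
  shows "(\<integral>\<omega>. (if \<omega> \<in> hits r (real T) then Z \<omega> else 0) * B (real T) \<omega> ^ m \<partial>M) =
    (\<integral>\<omega>. (if \<omega> \<in> hits r (real T) then Z \<omega> else 0) * B (hit_time B r \<omega>) \<omega> ^ m \<partial>M)"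
proof -
  define U where "U \<omega> = (if \<omega> \<in> hits r (real T) then Z \<omega> else 0)" for \<omega>
  define g where "g n \<omega> = real_of_int \<lceil>real n * hit_time B r \<omega>\<rceil> / real n" for n \<omega>
  \<comment> \<open>The weighted power at the rounded-up hitting time; the mesh 1/(n + 1) keeps n =
    0 harmless.\<close>
  define X where "X n \<omega> = U \<omega> * B (g (Suc n) \<omega>) \<omega> ^ m" for n \<omega>
  \<comment> \<open>Z restricted to the paths whose hit falls into the k-th grid interval. It is
    known at the right end of that interval, which allows the martingale identity from there to
    T.\<close>
  define W where "W n k \<omega> = (if \<omega> \<in> hits r (real (Suc k) / real n) - hits r (real k / real n) then Z \<omega> else 0)"
    for n k and \<omega>
  obtain \<omega>0 where "\<omega>0 \<in> space M" using not_empty by blast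
  then have c0: "0 \<le> c" using c[of \<omega>0] norm_ge_zero[of "Z \<omega>0"] by linarith
  have W: "W n k \<in> borel_measurable (past (real (Suc k) / real n))" for n k
  proof -
    let ?t = "real (Suc k) / real n" and ?s = "real k / real n"
    have le: "?s \<le> ?t" by (intro divide_right_mono) auto
    have "(\<lambda>\<omega>. (if \<omega> \<in> hits r ?t then Z \<omega> else 0) - (if \<omega> \<in> hits r ?s then Z \<omega> else 0)) \<in> borel_measurable (past ?t)"
      by (intro borel_measurable_diff Z past_measurable_mono[OF le]) auto
    also have "(\<lambda>\<omega>. (if \<omega> \<in> hits r ?t then Z \<omega> else 0) - (if \<omega> \<in> hits r ?s then Z \<omega> else 0)) = W n k"
      using hits_mono[OF le, of r] by (auto simp: W_def fun_eq_iff)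
    finally show ?thesis .
  qed
  have Wc: "cmod (W n k \<omega>) \<le> c" if "\<omega> \<in> space M" for n k \<omega>
    using c[OF that] c0 by (simp add: W_def)
  \<comment> \<open>T is an integer and so lies on every grid: rounding a hitting time up never
    passes T.\<close>
  have grid_le: "real (Suc k) / real (Suc n) \<le> real T" if "k < Suc n * T" for n k
  proof -
    have "real (Suc k) \<le> real (Suc n * T)" using that by (simp only: of_nat_le_iff Suc_le_eq)
    then show ?thesis by (simp add: field_simps)
  qed
  \<comment> \<open>The test function h is kept general because the decomposition is read twice:
    with the position at the grid time, and with the constant position at T.\<close>
  have sumW: "(\<Sum>k<Suc n * T. W (Suc n) k \<omega> * h (real (Suc k) / real (Suc n))) = U \<omega> * h (g (Suc n) \<omega>)" for n \<omega> and h :: "real \<Rightarrow> complex"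
  proof -
    have "(\<Sum>k<Suc n * T. W (Suc n) k \<omega> * h (real (Suc k) / real (Suc n))) = (\<Sum>k<Suc n * T. (if \<omega> \<in> hits r (real (Suc k) / real (Suc n)) - hits r (real k / real (Suc n)) then Z \<omega> * h (real (Suc k) / real (Suc n)) else 0))"
      unfolding W_def by (rule sum.cong) simp_all
    also have "\<dots> = (if \<omega> \<in> hits r (real T) then Z \<omega> * h (g (Suc n) \<omega>) else 0)"
      unfolding g_def by (rule grid_sum[OF r zero_less_Suc])
    also have "\<dots> = U \<omega> * h (g (Suc n) \<omega>)" by (simp add: U_def)
    finally show ?thesis .
  qed
  have sumW2: "(\<Sum>k<Suc n * T. (cmod (W (Suc n) k \<omega>))\<^sup>2 * h (real (Suc k) / real (Suc n))) = (cmod (U \<omega>))\<^sup>2 * h (g (Suc n) \<omega>)" for n \<omega> and h :: "real \<Rightarrow> real"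
  proof -
    have "(\<Sum>k<Suc n * T. (cmod (W (Suc n) k \<omega>))\<^sup>2 * h (real (Suc k) / real (Suc n))) = (\<Sum>k<Suc n * T. (if \<omega> \<in> hits r (real (Suc k) / real (Suc n)) - hits r (real k / real (Suc n)) then (cmod (Z \<omega>))\<^sup>2 * h (real (Suc k) / real (Suc n)) else 0))"
      unfolding W_def by (rule sum.cong) simp_all
    also have "\<dots> = (if \<omega> \<in> hits r (real T) then (cmod (Z \<omega>))\<^sup>2 * h (g (Suc n) \<omega>) else 0)"
      unfolding g_def by (rule grid_sum[OF r zero_less_Suc])
    also have "\<dots> = (cmod (U \<omega>))\<^sup>2 * h (g (Suc n) \<omega>)" by (simp add: U_def)
    finally show ?thesis .
  qed
  have Wint: "integrable M (\<lambda>\<omega>. W n k \<omega> * B (real (Suc k) / real n) \<omega> ^ j)" for n k j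
    by (rule bounded_power_integrable[where c=c and m=0]) (use Wc past_measurable_M[OF W] in auto)
  have Xint: "integrable M (X n)" and XI: "(\<integral>\<omega>. X n \<omega> \<partial>M) = (\<integral>\<omega>. U \<omega> * B (real T) \<omega> ^ m \<partial>M)" for n
  proof -
    have X: "X n = (\<lambda>\<omega>. \<Sum>k<Suc n * T. W (Suc n) k \<omega> * B (real (Suc k) / real (Suc n)) \<omega> ^ m)"
      unfolding X_def using sumW[of n _ "\<lambda>t. B t _ ^ m"] by (simp only:)
    have "integrable M (\<lambda>\<omega>. W (Suc n) k \<omega> * B (real T) \<omega> ^ m)"
      and WT: "(\<integral>\<omega>. W (Suc n) k \<omega> * B (real T) \<omega> ^ m \<partial>M) = (\<integral>\<omega>. W (Suc n) k \<omega> * B (real (Suc k) / real (Suc n)) \<omega> ^ m \<partial>M)"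
      if "k < Suc n * T" for k
      by (rule power_martingale[OF _ grid_le[OF that] W Wint]; simp)+
    note WT_int = this(1)
    show "integrable M (X n)" unfolding X by (intro Bochner_Integration.integrable_sum Wint)
    have "(\<integral>\<omega>. X n \<omega> \<partial>M) = (\<Sum>k<Suc n * T. \<integral>\<omega>. W (Suc n) k \<omega> * B (real (Suc k) / real (Suc n)) \<omega> ^ m \<partial>M)"
      unfolding X by (intro Bochner_Integration.integral_sum Wint)
    also have "\<dots> = (\<Sum>k<Suc n * T. \<integral>\<omega>. W (Suc n) k \<omega> * B (real T) \<omega> ^ m \<partial>M)"
      by (intro sum.cong refl) (simp only: WT lessThan_iff)
    also have "\<dots> = (\<integral>\<omega>. (\<Sum>k<Suc n * T. W (Suc n) k \<omega> * B (real T) \<omega> ^ m) \<partial>M)"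
      by (rule Bochner_Integration.integral_sum[symmetric]) (simp only: WT_int lessThan_iff)
    also have "(\<lambda>\<omega>. (\<Sum>k<Suc n * T. W (Suc n) k \<omega> * B (real T) \<omega> ^ m)) = (\<lambda>\<omega>. U \<omega> * B (real T) \<omega> ^ m)"
      using sumW[of n _ "\<lambda>t. B (real T) _ ^ m"] by (simp only:)
    finally show "(\<integral>\<omega>. X n \<omega> \<partial>M) = (\<integral>\<omega>. U \<omega> * B (real T) \<omega> ^ m \<partial>M)" .
  qed
  define C where "C = (\<integral>\<omega>. c\<^sup>2 * (cmod (B (real T) \<omega> ^ m))\<^sup>2 \<partial>M)"
  have sq_int: "integrable M (\<lambda>\<omega>. (norm (X n \<omega>))\<^sup>2)" and sq_le: "(\<integral>\<omega>. (norm (X n \<omega>))\<^sup>2 \<partial>M) \<le> C" for n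
  proof -
    define V where "V k \<omega> = (cmod (W (Suc n) k \<omega>))\<^sup>2" for k \<omega>
    have X: "(\<lambda>\<omega>. (norm (X n \<omega>))\<^sup>2) = (\<lambda>\<omega>. \<Sum>k<Suc n * T. V k \<omega> * (cmod (B (real (Suc k) / real (Suc n)) \<omega> ^ m))\<^sup>2)"
      unfolding X_def norm_mult power_mult_distrib V_def using sumW2[of n _ "\<lambda>t. (cmod (B t _ ^ m))\<^sup>2"] by (simp only:)
    have V: "V k \<in> borel_measurable (past (real (Suc k) / real (Suc n)))" for k
      unfolding V_def using W[of "Suc n" k] by measurable
    have Vc: "0 \<le> V k \<omega> \<and> V k \<omega> \<le> c\<^sup>2" if "\<omega> \<in> space M" for k \<omega>
      using Wc[OF that] by (simp add: V_def power_mono)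
    have pos: "0 \<le> real (Suc k) / real (Suc n)" for k by simp
    have VT: "integrable M (\<lambda>\<omega>. V k \<omega> * (cmod (B (real T) \<omega> ^ m))\<^sup>2)" if "k < Suc n * T" for k
      using power_square_submartingale(1)[OF _ order_refl past_measurable_mono[OF grid_le[OF that] V] Vc] by simp
    show "integrable M (\<lambda>\<omega>. (norm (X n \<omega>))\<^sup>2)"
      unfolding X by (intro Bochner_Integration.integrable_sum power_square_submartingale(1)[OF pos order_refl V Vc])
    have "(\<integral>\<omega>. (norm (X n \<omega>))\<^sup>2 \<partial>M) = (\<Sum>k<Suc n * T. \<integral>\<omega>. V k \<omega> * (cmod (B (real (Suc k) / real (Suc n)) \<omega> ^ m))\<^sup>2 \<partial>M)"
      unfolding X by (intro Bochner_Integration.integral_sum power_square_submartingale(1)[OF pos order_refl V Vc])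
    also have "\<dots> \<le> (\<Sum>k<Suc n * T. \<integral>\<omega>. V k \<omega> * (cmod (B (real T) \<omega> ^ m))\<^sup>2 \<partial>M)"
      by (rule sum_mono, rule power_square_submartingale(2)[OF pos grid_le V Vc]) simp_all
    also have "\<dots> = (\<integral>\<omega>. (\<Sum>k<Suc n * T. V k \<omega> * (cmod (B (real T) \<omega> ^ m))\<^sup>2) \<partial>M)"
      by (rule Bochner_Integration.integral_sum[symmetric]) (simp only: VT lessThan_iff)
    also have "\<dots> \<le> C"
      unfolding C_def
    proof (rule integral_mono)
      show "integrable M (\<lambda>\<omega>. \<Sum>k<Suc n * T. V k \<omega> * (cmod (B (real T) \<omega> ^ m))\<^sup>2)"
        by (rule Bochner_Integration.integrable_sum) (simp only: VT lessThan_iff)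
      show "integrable M (\<lambda>\<omega>. c\<^sup>2 * (cmod (B (real T) \<omega> ^ m))\<^sup>2)"
        by (rule power_square_submartingale(1)[of "real T" "real T" "\<lambda>_. c\<^sup>2" "c\<^sup>2"]) auto
      fix \<omega> assume w: "\<omega> \<in> space M"
      have "(\<Sum>k<Suc n * T. V k \<omega> * (cmod (B (real T) \<omega> ^ m))\<^sup>2) = (cmod (U \<omega>))\<^sup>2 * (cmod (B (real T) \<omega> ^ m))\<^sup>2"
        unfolding V_def using sumW2[of n \<omega> "\<lambda>t. (cmod (B (real T) \<omega> ^ m))\<^sup>2"] by (simp only:)
      also have "\<dots> \<le> c\<^sup>2 * (cmod (B (real T) \<omega> ^ m))\<^sup>2"
        using c[OF w] c0 by (intro mult_right_mono power_mono) (auto simp: U_def)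
      finally show "(\<Sum>k<Suc n * T. V k \<omega> * (cmod (B (real T) \<omega> ^ m))\<^sup>2) \<le> c\<^sup>2 * (cmod (B (real T) \<omega> ^ m))\<^sup>2" .
    qed
    finally show "(\<integral>\<omega>. (norm (X n \<omega>))\<^sup>2 \<partial>M) \<le> C" .
  qed
  have "(\<lambda>n. \<integral>\<omega>. X n \<omega> \<partial>M) \<longlonglongrightarrow> (\<integral>\<omega>. U \<omega> * B (hit_time B r \<omega>) \<omega> ^ m \<partial>M)"
  proof (rule integral_tendsto_of_square_bounded[where C=C and K="c * r ^ m"])
    show "X n \<in> borel_measurable M" for n using Xint by auto
    have [measurable]: "U \<in> borel_measurable M"
      unfolding U_def by (rule past_measurable_M[OF Z]) simp
    show "(\<lambda>\<omega>. U \<omega> * B (hit_time B r \<omega>) \<omega> ^ m) \<in> borel_measurable M"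
      using hit_position_measurable[OF r] by measurable
    fix \<omega> assume w: "\<omega> \<in> space M"
    show "(\<lambda>n. X n \<omega>) \<longlonglongrightarrow> U \<omega> * B (hit_time B r \<omega>) \<omega> ^ m"
    proof (cases "\<omega> \<in> hits r (real T)")
      case True
      note props = hit_time_props[OF True]
      have "(\<lambda>n. B (g (Suc n) \<omega>) \<omega>) \<longlonglongrightarrow> B (hit_time B r \<omega>) \<omega>"
      proof (rule path_tendsto[OF w])
        show "0 \<le> g (Suc n) \<omega>" for n
        proof -
          have "0 \<le> real (Suc n) * hit_time B r \<omega>" using props(1) by simp
          then have "0 \<le> \<lceil>real (Suc n) * hit_time B r \<omega>\<rceil>" by linarith
          then show ?thesis unfolding g_def by simp
        qed
        show "(\<lambda>n. g (Suc n) \<omega>) \<longlonglongrightarrow> hit_time B r \<omega>"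
          unfolding g_def using ceiling_grid_tendsto[OF props(1)] by (rule LIMSEQ_Suc)
      qed (rule props(1))
      then show ?thesis unfolding X_def by (intro tendsto_intros)
    qed (simp add: X_def U_def)
    have r0: "0 \<le> r" using r norm_ge_zero[of x0] by linarith
    have "cmod (U \<omega>) * cmod (B (hit_time B r \<omega>) \<omega>) ^ m \<le> c * r ^ m"
    proof (cases "\<omega> \<in> hits r (real T)")
      case True
      then show ?thesis
        using hit_time_props(3)[OF True] c[OF w] r0 by (auto simp: U_def intro!: mult_right_mono)
    next
      case False
      then show ?thesis using c0 r0 by (simp add: U_def)
    qed
    then show "norm (U \<omega> * B (hit_time B r \<omega>) \<omega> ^ m) \<le> c * r ^ m"
      by (simp add: norm_mult norm_power)
  qed (fact sq_int sq_le)+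
  \<comment> \<open>By \<open>XI\<close> the approximating integrals do not depend on n, so their
    limit is their common value.\<close>
  then have "(\<integral>\<omega>. U \<omega> * B (real T) \<omega> ^ m \<partial>M) = (\<integral>\<omega>. U \<omega> * B (hit_time B r \<omega>) \<omega> ^ m \<partial>M)"
    unfolding XI by (simp add: LIMSEQ_const_iff)
  then show ?thesis by (simp add: U_def)
qed

text \<open>The planar Gaussian density with variance t per coordinate is at most 1 / (2 pi t), so a
  fixed disc has probability of order 1/t. This decay is what forces the path out of every
  disc.\<close>

lemma increment_small_prob:
  assumes "0 < t"
  shows "prob {\<omega>\<in>space M. cmod (B t \<omega> - B 0 \<omega>) \<le> R} \<le> measure lborel (cball (0::complex) R) / (2 * pi * t)"
proof -
  have le1: "normal_density 0 (sqrt t) x \<le> 1 / sqrt (2 * pi * t)" for x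
    using assms by (simp add: normal_density_def divide_right_mono)
  have le: "gaussian_density (sqrt t) z \<le> 1 / (2 * pi * t)" for z
  proof -
    have "gaussian_density (sqrt t) z \<le> 1 / sqrt (2 * pi * t) * (1 / sqrt (2 * pi * t))"
      unfolding gaussian_density_def using assms by (intro mult_mono le1) auto
    then show ?thesis using assms by simp
  qed
  let ?I = "indicator (cball (0::complex) R) :: complex \<Rightarrow> real"
  have I: "integrable lborel ?I"
    using emeasure_bounded_finite[OF bounded_cball, of "0::complex" R] by (intro integrable_real_indicator) auto
  have I_meas: "?I \<in> borel_measurable borel"
    by (rule borel_measurable_indicator, rule borel_closed, rule closed_cball)
  have "prob {\<omega>\<in>space M. cmod (B t \<omega> - B 0 \<omega>) \<le> R} = (\<integral>\<omega>. indicator {\<omega>\<in>space M. cmod (B t \<omega> - B 0 \<omega>) \<le> R} \<omega> \<partial>M)"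
    by simp
  also have "\<dots> = (\<integral>\<omega>. ?I (B t \<omega> - B 0 \<omega>) \<partial>M)"
    by (rule Bochner_Integration.integral_cong) (auto simp: indicator_def)
  also have "\<dots> = (\<integral>z. gaussian_density (sqrt t) z *\<^sub>R ?I z \<partial>lborel)"
    using increment_integral[OF order_refl assms I_meas] by simp
  also have "\<dots> \<le> (\<integral>z. 1 / (2 * pi * t) * ?I z \<partial>lborel)"
  proof (rule integral_mono)
    show "integrable lborel (\<lambda>z. 1 / (2 * pi * t) * ?I z)" using I by simp
    show "integrable lborel (\<lambda>z. gaussian_density (sqrt t) z *\<^sub>R ?I z)"
      by (rule Bochner_Integration.integrable_bound[OF \<open>integrable lborel (\<lambda>z. 1 / (2 * pi * t) * ?I z)\<close>])
        (use le assms in \<open>auto simp: abs_mult indicator_def\<close>)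
    show "gaussian_density (sqrt t) z *\<^sub>R ?I z \<le> 1 / (2 * pi * t) * ?I z" for z
      using le[of z] by (simp add: indicator_def)
  qed
  also have "\<dots> = measure lborel (cball (0::complex) R) / (2 * pi * t)" by simp
  finally show ?thesis .
qed

lemma not_hits_bound:
  assumes "cmod x0 < r" "0 \<le> s" "\<omega> \<in> space M - hits r s"
  shows "cmod (B s \<omega>) \<le> r"
  using hits_of_le[of \<omega> r s s] assms by force

lemma not_hits_prob_tendsto:
  assumes r: "cmod x0 < r"
  shows "(\<lambda>T::nat. prob (space M - hits r (real T))) \<longlonglongrightarrow> 0"
proof (rule tendsto_sandwich[where f="\<lambda>_. 0"])
  let ?c = "measure lborel (cball (0::complex) (2 * r)) / (2 * pi)"
  show "(\<lambda>T::nat. ?c / real T) \<longlonglongrightarrow> 0" by (rule lim_const_over_n)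
  show "\<forall>\<^sub>F T in sequentially. prob (space M - hits r (real T)) \<le> ?c / real T"
    using eventually_gt_at_top[of 0]
  proof eventually_elim
    fix T :: nat assume T: "0 < T"
    \<comment> \<open>A path that has not met the circle is still inside at time T, as was the
      start, so the increment is at most twice the radius.\<close>
    have "prob (space M - hits r (real T)) \<le> prob {\<omega>\<in>space M. cmod (B (real T) \<omega> - B 0 \<omega>) \<le> 2 * r}"
    proof (rule finite_measure_mono)
      show "space M - hits r (real T) \<subseteq> {\<omega>\<in>space M. cmod (B (real T) \<omega> - B 0 \<omega>) \<le> 2 * r}"
      proof
        fix \<omega> assume w: "\<omega> \<in> space M - hits r (real T)"
        from not_hits_bound[OF r _ this] have "cmod (B (real T) \<omega>) \<le> r" by simp
        moreover have "cmod (B (real T) \<omega> - x0) \<le> cmod (B (real T) \<omega>) + cmod x0" by (rule norm_triangle_ineq4)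
        ultimately show "\<omega> \<in> {\<omega>\<in>space M. cmod (B (real T) \<omega> - B 0 \<omega>) \<le> 2 * r}" using w r by auto
      qed
    qed measurable
    also have "\<dots> \<le> ?c / real T" using increment_small_prob[of "real T" "2 * r"] T by simp
    finally show "prob (space M - hits r (real T)) \<le> ?c / real T" .
  qed
qed simp_all

lemma AE_hits:
  assumes r: "cmod x0 < r"
  shows "AE \<omega> in M. \<exists>T::nat. \<omega> \<in> hits r (real T)"
proof -
  let ?N = "space M - (\<Union>T::nat. hits r (real T))"
  have ev [measurable]: "hits r (real T) \<in> events" for T :: nat by (rule hits_events[OF r]) simp
  have "prob ?N \<le> prob (space M - hits r (real T))" for T :: nat
    by (intro finite_measure_mono) auto
  then have "prob ?N \<le> 0"
    by (intro LIMSEQ_le_const[OF not_hits_prob_tendsto[OF r]]) auto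
  then have "prob ?N = 0" by (simp add: measure_le_0_iff)
  then have "?N \<in> null_sets M" by (auto simp: null_sets_def emeasure_eq_measure)
  then have "AE \<omega> in M. \<omega> \<notin> ?N" by (rule AE_not_in)
  from this AE_space show ?thesis by eventually_elim auto
qed

lemma AE_hit_position: "cmod x0 < r \<Longrightarrow> AE \<omega> in M. cmod (B (hit_time B r \<omega>) \<omega>) = r"
  using AE_hits[of r] by (auto elim!: AE_mp simp: hit_time_props)

text \<open>Disposes of the error terms, all of which live on paths that have not yet met the
  circle: there the integrand is bounded, and the probability of such paths vanishes.\<close>

lemma integral_tendsto_0:
  fixes F :: "nat \<Rightarrow> 'w \<Rightarrow> complex"
  assumes r: "cmod x0 < r" and F_int: "\<And>T. integrable M (F T)"
    and F: "\<And>T \<omega>. \<omega> \<in> space M \<Longrightarrow> cmod (F T \<omega>) \<le> K * indicator (space M - hits r (real T)) \<omega>"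
  shows "(\<lambda>T. \<integral>\<omega>. F T \<omega> \<partial>M) \<longlonglongrightarrow> 0"
proof (rule Lim_null_comparison)
  show "(\<lambda>T. K * prob (space M - hits r (real T))) \<longlonglongrightarrow> 0"
    using tendsto_mult_left[OF not_hits_prob_tendsto[OF r], of K] by simp
  show "\<forall>\<^sub>F T in sequentially. norm (\<integral>\<omega>. F T \<omega> \<partial>M) \<le> K * prob (space M - hits r (real T))"
  proof (rule always_eventually, rule allI)
    fix T
    have [measurable]: "hits r (real T) \<in> events" by (rule hits_events[OF r]) simp
    have int: "integrable M (\<lambda>\<omega>. K * indicator (space M - hits r (real T)) \<omega>)"
      by (intro integrable_mult_right integrable_real_indicator) (auto simp: emeasure_eq_measure)
    have "norm (\<integral>\<omega>. F T \<omega> \<partial>M) \<le> (\<integral>\<omega>. norm (F T \<omega>) \<partial>M)"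
      by (rule integral_norm_bound)
    also have "\<dots> \<le> (\<integral>\<omega>. K * indicator (space M - hits r (real T)) \<omega> \<partial>M)"
      by (intro integral_mono integrable_norm F_int int) (rule F)
    also have "\<dots> = K * prob (space M - hits r (real T))" by simp
    finally show "norm (\<integral>\<omega>. F T \<omega> \<partial>M) \<le> K * prob (space M - hits r (real T))" .
  qed
qed

text \<open>At the fixed time T the integrand has no bound uniform in T. Optional stopping replaces
  it by the position on the circle, which is dominated by c r^m and becomes eventually constant in T
  along almost every path.\<close>

lemma stopped_integral_tendsto:
  assumes r: "cmod x0 < r" and c: "\<And>\<omega>. \<omega> \<in> space M \<Longrightarrow> cmod (Z \<omega>) \<le> c"
    and [measurable]: "Z \<in> borel_measurable M"
    and Z: "\<And>s. 0 \<le> s \<Longrightarrow> (\<lambda>\<omega>. if \<omega> \<in> hits r s then Z \<omega> else 0) \<in> borel_measurable (past s)"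
  shows "(\<lambda>T::nat. \<integral>\<omega>. (if \<omega> \<in> hits r (real T) then Z \<omega> else 0) * B (real T) \<omega> ^ m \<partial>M)
    \<longlonglongrightarrow> (\<integral>\<omega>. Z \<omega> * B (hit_time B r \<omega>) \<omega> ^ m \<partial>M)"
proof -
  have eq: "(\<integral>\<omega>. (if \<omega> \<in> hits r (real T) then Z \<omega> else 0) * B (real T) \<omega> ^ m \<partial>M) =
    (\<integral>\<omega>. (if \<omega> \<in> hits r (real T) then Z \<omega> else 0) * B (hit_time B r \<omega>) \<omega> ^ m \<partial>M)" for T :: nat
    by (rule optional_stopping[OF r c Z])
  show ?thesis
    unfolding eq
  proof (rule integral_dominated_convergence[where w="\<lambda>_. c * r ^ m"])
    have [measurable]: "(\<lambda>\<omega>. B (hit_time B r \<omega>) \<omega>) \<in> borel_measurable M" by (rule hit_position_measurable[OF r])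
    show "(\<lambda>\<omega>. Z \<omega> * B (hit_time B r \<omega>) \<omega> ^ m) \<in> borel_measurable M" by measurable
    show "(\<lambda>\<omega>. (if \<omega> \<in> hits r (real T) then Z \<omega> else 0) * B (hit_time B r \<omega>) \<omega> ^ m) \<in> borel_measurable M" for T :: nat
    proof -
      have [measurable]: "hits r (real T) \<in> events" by (rule hits_events[OF r]) simp
      show ?thesis by measurable
    qed
    show "AE \<omega> in M. (\<lambda>T. (if \<omega> \<in> hits r (real T) then Z \<omega> else 0) * B (hit_time B r \<omega>) \<omega> ^ m)
        \<longlonglongrightarrow> Z \<omega> * B (hit_time B r \<omega>) \<omega> ^ m"
      using AE_hits[OF r]
    proof eventually_elim
      fix \<omega> assume "\<exists>T::nat. \<omega> \<in> hits r (real T)"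
      then obtain T0 :: nat where T0: "\<omega> \<in> hits r (real T0)" by blast
      have "\<forall>\<^sub>F T in sequentially. (if \<omega> \<in> hits r (real T) then Z \<omega> else 0) * B (hit_time B r \<omega>) \<omega> ^ m = Z \<omega> * B (hit_time B r \<omega>) \<omega> ^ m"
        using eventually_ge_at_top[of T0]
      proof eventually_elim
        fix T assume "T0 \<le> T"
        then have "\<omega> \<in> hits r (real T)" using T0 hits_mono[of "real T0" "real T" r] by auto
        then show "(if \<omega> \<in> hits r (real T) then Z \<omega> else 0) * B (hit_time B r \<omega>) \<omega> ^ m = Z \<omega> * B (hit_time B r \<omega>) \<omega> ^ m" by simp
      qed
      then show "(\<lambda>T. (if \<omega> \<in> hits r (real T) then Z \<omega> else 0) * B (hit_time B r \<omega>) \<omega> ^ m)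
        \<longlonglongrightarrow> Z \<omega> * B (hit_time B r \<omega>) \<omega> ^ m" by (rule tendsto_eventually)
    qed
    show "AE \<omega> in M. norm ((if \<omega> \<in> hits r (real T) then Z \<omega> else 0) * B (hit_time B r \<omega>) \<omega> ^ m) \<le> c * r ^ m" for T :: nat
      using AE_hit_position[OF r] AE_space
    proof eventually_elim
      fix \<omega> assume w: "cmod (B (hit_time B r \<omega>) \<omega>) = r" "\<omega> \<in> space M"
      have "0 \<le> c" using c[OF w(2)] norm_ge_zero[of "Z \<omega>"] by linarith
      moreover have "0 \<le> r" using r norm_ge_zero[of x0] by linarith
      ultimately show "norm ((if \<omega> \<in> hits r (real T) then Z \<omega> else 0) * B (hit_time B r \<omega>) \<omega> ^ m) \<le> c * r ^ m"
        using c[OF w(2)] w(1) by (auto simp: norm_mult norm_power intro!: mult_right_mono)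
    qed
  qed simp
qed

text \<open>At time T the full mean is x0^m. It differs from the mean over paths that have met the
  circle only by the paths still inside, whose m-th powers are bounded by r^m.\<close>

lemma hit_position_moment:
  assumes r: "cmod x0 < r"
  shows "(\<integral>\<omega>. B (hit_time B r \<omega>) \<omega> ^ m \<partial>M) = x0 ^ m"
proof -
  have r0: "0 \<le> r" using r norm_ge_zero[of x0] by linarith
  have BT: "integrable M (\<lambda>\<omega>. B (real T) \<omega> ^ m)" "(\<integral>\<omega>. B (real T) \<omega> ^ m \<partial>M) = x0 ^ m" for T :: nat
  proof -
    have c: "(\<integral>\<omega>. B 0 \<omega> ^ m \<partial>M) = x0 ^ m"
      by (simp cong: Bochner_Integration.integral_cong add: prob_space)
    show "integrable M (\<lambda>\<omega>. B (real T) \<omega> ^ m)" by (rule power_integrable) simp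
    show "(\<integral>\<omega>. B (real T) \<omega> ^ m \<partial>M) = x0 ^ m"
      using power_martingale_integral[of 0 "real T" "\<lambda>_. 1" m] power_integrable[of 0] c by simp
  qed
  let ?S = "\<lambda>T::nat. \<integral>\<omega>. (if \<omega> \<in> hits r (real T) then 1 else 0) * B (real T) \<omega> ^ m \<partial>M"
  have lim: "?S \<longlonglongrightarrow> (\<integral>\<omega>. 1 * B (hit_time B r \<omega>) \<omega> ^ m \<partial>M)"
    by (rule stopped_integral_tendsto[OF r, where c=1]) (use hits_past[OF r] in auto)
  have S_int: "integrable M (\<lambda>\<omega>. (if \<omega> \<in> hits r (real T) then 1 else 0) * B (real T) \<omega> ^ m)" for T :: nat
  proof -
    have [measurable]: "hits r (real T) \<in> events" by (rule hits_events[OF r]) simp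
    show ?thesis by (rule bounded_power_integrable[where c=1 and m=0]) auto
  qed
  have "(\<lambda>T::nat. \<integral>\<omega>. B (real T) \<omega> ^ m - (if \<omega> \<in> hits r (real T) then 1 else 0) * B (real T) \<omega> ^ m \<partial>M) \<longlonglongrightarrow> 0"
  proof (rule integral_tendsto_0[OF r, where K="r ^ m"])
    show "integrable M (\<lambda>\<omega>. B (real T) \<omega> ^ m - (if \<omega> \<in> hits r (real T) then 1 else 0) * B (real T) \<omega> ^ m)" for T :: nat
      using BT(1) S_int by (rule Bochner_Integration.integrable_diff)
    fix T :: nat and \<omega> assume "\<omega> \<in> space M"
    then show "cmod (B (real T) \<omega> ^ m - (if \<omega> \<in> hits r (real T) then 1 else 0) * B (real T) \<omega> ^ m) \<le> r ^ m * indicator (space M - hits r (real T)) \<omega>"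
      using not_hits_bound[OF r, of "real T" \<omega>] by (auto simp: indicator_def norm_power power_mono)
  qed
  moreover have "(\<integral>\<omega>. B (real T) \<omega> ^ m - (if \<omega> \<in> hits r (real T) then 1 else 0) * B (real T) \<omega> ^ m \<partial>M) = x0 ^ m - ?S T" for T :: nat
    using BT[of T] S_int[of T] by simp
  ultimately have "(\<lambda>T. x0 ^ m - ?S T) \<longlonglongrightarrow> 0" by simp
  from tendsto_diff[OF tendsto_const this, of "x0 ^ m"] have "?S \<longlonglongrightarrow> x0 ^ m" by simp
  with lim show ?thesis using LIMSEQ_unique by fastforce
qed

text \<open>The same weight Z is stopped at both circles and compared at a common time T. The two
  integrands agree once R has been reached; otherwise the path is still within radius R, so their
  difference is bounded by R^m and vanishes in the limit.\<close>

lemma hit_positions_moment: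
  assumes r: "cmod x0 < r" "r < R" and f: "f \<in> borel_measurable borel" "\<And>z. cmod (f z) \<le> 1"
  shows "(\<integral>\<omega>. f (B (hit_time B r \<omega>) \<omega>) * B (hit_time B R \<omega>) \<omega> ^ m \<partial>M) =
    (\<integral>\<omega>. f (B (hit_time B r \<omega>) \<omega>) * B (hit_time B r \<omega>) \<omega> ^ m \<partial>M)"
proof -
  have R: "cmod x0 < R" using r by simp
  define Z where "Z \<omega> = f (B (hit_time B r \<omega>) \<omega>)" for \<omega>
  have ZM [measurable]: "Z \<in> borel_measurable M"
    unfolding Z_def using hit_position_measurable[OF r(1)] f(1) by measurable
  have Zc: "cmod (Z \<omega>) \<le> 1" for \<omega> by (simp add: Z_def f)
  have sub: "hits R s \<subseteq> hits r s" for s using hits_antimono[of r R s] r by simp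
  \<comment> \<open>Z is fixed at the first circle; it is also known when the second is reached,
    because that event lies inside the first.\<close>
  have Zpast: "(\<lambda>\<omega>. if \<omega> \<in> hits q s then Z \<omega> else 0) \<in> borel_measurable (past s)"
    if "0 \<le> s" "q = r \<or> q = R" for s q
  proof -
    have q: "cmod x0 < q" "hits q s \<subseteq> hits r s" using that r sub[of s] by auto
    have "(\<lambda>\<omega>. if \<omega> \<in> hits q s then f (if \<omega> \<in> hits r s then B (hit_time B r \<omega>) \<omega> else 0) else 0) \<in> borel_measurable (past s)"
      using hits_past[OF q(1) that(1)] measurable_compose[OF hit_position_past[OF r(1) that(1)] f(1)] by measurable
    also have "(\<lambda>\<omega>. if \<omega> \<in> hits q s then f (if \<omega> \<in> hits r s then B (hit_time B r \<omega>) \<omega> else 0) else 0) =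
        (\<lambda>\<omega>. if \<omega> \<in> hits q s then Z \<omega> else 0)"
      using q(2) by (auto simp: Z_def fun_eq_iff)
    finally show ?thesis .
  qed
  let ?S = "\<lambda>q (T::nat) \<omega>. (if \<omega> \<in> hits q (real T) then Z \<omega> else 0) * B (real T) \<omega> ^ m"
  have lim_r: "(\<lambda>T. \<integral>\<omega>. ?S r T \<omega> \<partial>M) \<longlonglongrightarrow> (\<integral>\<omega>. Z \<omega> * B (hit_time B r \<omega>) \<omega> ^ m \<partial>M)"
    by (rule stopped_integral_tendsto[OF r(1) Zc ZM]) (simp add: Zpast)
  have lim_R: "(\<lambda>T. \<integral>\<omega>. ?S R T \<omega> \<partial>M) \<longlonglongrightarrow> (\<integral>\<omega>. Z \<omega> * B (hit_time B R \<omega>) \<omega> ^ m \<partial>M)"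
    by (rule stopped_integral_tendsto[OF R Zc ZM]) (simp add: Zpast)
  have int: "integrable M (?S q T)" if "q = r \<or> q = R" for q T
  proof -
    have [measurable]: "hits q (real T) \<in> events" using hits_events[of q "real T"] that r by auto
    show ?thesis by (rule bounded_power_integrable[where c=1 and m=0]) (use Zc in auto)
  qed
  have "(\<lambda>T. \<integral>\<omega>. ?S r T \<omega> - ?S R T \<omega> \<partial>M) \<longlonglongrightarrow> 0"
  proof (rule integral_tendsto_0[OF R, where K="R ^ m"])
    show "integrable M (\<lambda>\<omega>. ?S r T \<omega> - ?S R T \<omega>)" for T
      by (rule Bochner_Integration.integrable_diff) (use int in auto)
    fix T :: nat and \<omega> assume w: "\<omega> \<in> space M"
    show "cmod (?S r T \<omega> - ?S R T \<omega>) \<le> R ^ m * indicator (space M - hits R (real T)) \<omega>"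
    proof (cases "\<omega> \<in> hits R (real T)")
      case True
      then show ?thesis using sub[of "real T"] by auto
    next
      case False
      then have "cmod (B (real T) \<omega>) ^ m \<le> R ^ m"
        using not_hits_bound[OF R, of "real T" \<omega>] w by (intro power_mono) auto
      then have "cmod (Z \<omega>) * cmod (B (real T) \<omega>) ^ m \<le> 1 * R ^ m"
        using Zc[of \<omega>] by (intro mult_mono) auto
      then show ?thesis
        using False w R norm_ge_zero[of x0] by (auto simp: norm_mult norm_power simp del: norm_ge_zero)
    qed
  qed
  then have "(\<lambda>T. (\<integral>\<omega>. ?S r T \<omega> \<partial>M) - (\<integral>\<omega>. ?S R T \<omega> \<partial>M)) \<longlonglongrightarrow> 0"
    by (subst (asm) Bochner_Integration.integral_diff) (use int in auto)
  from tendsto_diff[OF lim_r this] have "(\<lambda>T. \<integral>\<omega>. ?S R T \<omega> \<partial>M) \<longlonglongrightarrow> (\<integral>\<omega>. Z \<omega> * B (hit_time B r \<omega>) \<omega> ^ m \<partial>M)"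
    by simp
  with lim_R show ?thesis unfolding Z_def using LIMSEQ_unique by fastforce
qed

end

section \<open>Fourier coefficients of the hitting angles\<close>

text \<open>\<open>Arg\<close> jumps only across the closed half-line of nonpositive reals, and
  there it takes just the values 0 and pi.\<close>

lemma Arg_measurable [measurable]: "Arg \<in> borel_measurable borel"
proof -
  have c: "closed (\<real>\<^sub>\<le>\<^sub>0 :: complex set)" by simp
  then have [measurable]: "(\<real>\<^sub>\<le>\<^sub>0 :: complex set) \<in> sets borel" by (rule borel_closed)
  have "(\<lambda>z. if z \<in> \<real>\<^sub>\<le>\<^sub>0 then if z = 0 then 0 else pi else Arg z) \<in> borel_measurable borel"
  proof (subst measurable_If_restrict_space_iff, safe)
    show "(\<lambda>z::complex. if z = 0 then 0 else pi) \<in> borel_measurable (restrict_space borel {z. z \<in> \<real>\<^sub>\<le>\<^sub>0})"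
      by (rule measurable_restrict_space1) measurable
    have "continuous_on {z. z \<notin> \<real>\<^sub>\<le>\<^sub>0} Arg"
      using continuous_on_Arg by (simp add: Compl_eq)
    then show "Arg \<in> borel_measurable (restrict_space borel {z. z \<notin> \<real>\<^sub>\<le>\<^sub>0})"
      by (rule borel_measurable_continuous_on_restrict)
  qed auto
  also have "(\<lambda>z. if z \<in> \<real>\<^sub>\<le>\<^sub>0 then if z = 0 then 0 else pi else Arg z) = Arg"
    by (auto simp: fun_eq_iff Arg_zero elim!: nonpos_Reals_cases)
  finally show ?thesis .
qed

lemma ang_measurable [measurable]: "ang \<in> borel_measurable borel"
  unfolding ang_def by measurable

lemma ang_range: "- pi \<le> ang z" "ang z < pi"
  using mpi_less_Arg[of z] Arg_le_pi[of z] by (auto simp: ang_def)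

lemma cis_ang: "z \<noteq> 0 \<Longrightarrow> cis (ang z) = sgn z"
  using cis_Arg[of z] by (auto simp: ang_def complex_eq_iff)

lemma ang_cis: "- pi \<le> x \<Longrightarrow> x < pi \<Longrightarrow> ang (cis x) = x"
proof (cases "x = - pi")
  case True
  \<comment> \<open>\<open>Arg\<close> takes the value pi on the negative axis, and
    \<open>ang\<close> moves it to - pi.\<close>
  have "cis x = cis pi" using True by (simp add: complex_eq_iff)
  then show ?thesis using True Arg_cis[of pi] by (simp add: ang_def)
qed (auto simp: ang_def Arg_cis)

lemma cis_power_cmod: "cmod z = r \<Longrightarrow> 0 < r \<Longrightarrow> of_real (r ^ m) * cis (real m * ang z) = z ^ m"
proof -
  assume r: "cmod z = r" "0 < r"
  then have "of_real r * cis (ang z) = z"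
    by (subst cis_ang) (auto simp: sgn_eq)
  then have "z ^ m = (of_real r * cis (ang z)) ^ m" by simp
  then show ?thesis by (simp add: power_mult_distrib Complex.DeMoivre)
qed

lemma cis_measurable: "f \<in> borel_measurable M \<Longrightarrow> (\<lambda>x. cis (f x)) \<in> borel_measurable M"
  unfolding cis_conv_exp by measurable

context planar_brownian_motion
begin

lemma hit_angle_measurable [measurable]:
  "cmod x0 < r \<Longrightarrow> (\<lambda>\<omega>. ang (B (hit_time B r \<omega>) \<omega>)) \<in> borel_measurable M"
  by (rule measurable_compose[OF hit_position_measurable ang_measurable])

text \<open>On the unit circle the exponential with a nonnegative frequency is a power of the
  position, whose mean is a power of the start; conjugation supplies the negative
  frequencies.\<close>

lemma hit_angle_fourier:
  assumes x0: "x0 = of_real \<rho> * cis \<mu>" "0 \<le> \<rho>" "\<rho> < 1"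
  shows "(\<integral>\<omega>. cis (real_of_int k * ang (B (hit_time B 1 \<omega>) \<omega>)) \<partial>M) = of_real (\<rho> ^ nat \<bar>k\<bar>) * cis (real_of_int k * \<mu>)"
proof -
  have r: "cmod x0 < 1" using x0 by (simp add: norm_mult)
  have nonneg: "(\<integral>\<omega>. cis (real m * ang (B (hit_time B 1 \<omega>) \<omega>)) \<partial>M) = of_real (\<rho> ^ m) * cis (real m * \<mu>)" for m
  proof -
    have "(\<integral>\<omega>. cis (real m * ang (B (hit_time B 1 \<omega>) \<omega>)) \<partial>M) = (\<integral>\<omega>. B (hit_time B 1 \<omega>) \<omega> ^ m \<partial>M)"
    proof (rule integral_cong_AE)
      show "AE \<omega> in M. cis (real m * ang (B (hit_time B 1 \<omega>) \<omega>)) = B (hit_time B 1 \<omega>) \<omega> ^ m"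
        using AE_hit_position[OF r] by eventually_elim (use cis_power_cmod[where r=1] in simp)
    qed (use hit_position_measurable[OF r] hit_angle_measurable[OF r] in \<open>auto intro!: cis_measurable\<close>)
    also have "\<dots> = x0 ^ m" by (rule hit_position_moment[OF r])
    finally show ?thesis by (simp add: x0(1) power_mult_distrib Complex.DeMoivre)
  qed
  show ?thesis
  proof (cases "0 \<le> k")
    case True
    then show ?thesis using nonneg[of "nat k"] by simp
  next
    case False
    have "(\<integral>\<omega>. cis (real_of_int k * ang (B (hit_time B 1 \<omega>) \<omega>)) \<partial>M) =
        (\<integral>\<omega>. cnj (cis (real (nat (- k)) * ang (B (hit_time B 1 \<omega>) \<omega>))) \<partial>M)"
      using False by (intro Bochner_Integration.integral_cong refl) (simp add: cis_cnj)
    also have "\<dots> = cnj (of_real (\<rho> ^ nat (- k)) * cis (real (nat (- k)) * \<mu>))"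
      unfolding Bochner_Integration.integral_cnj nonneg ..
    finally show ?thesis using False by (simp add: cis_cnj)
  qed
qed

text \<open>For m \<ge> 0 the second exponential is \<open>\<rho>2 ^ m\<close> times a power of the
  outer position, which may be replaced by the inner one under the weight f. Both frequencies then
  fall on the first angle and add up to n + m.\<close>

lemma hit_angles_fourier:
  assumes x0: "x0 = of_real \<rho>1 * cis \<mu>" "0 \<le> \<rho>1" "\<rho>1 < 1" and \<rho>2: "0 < \<rho>2" "\<rho>2 < 1"
  shows "(\<integral>\<omega>. cis (real_of_int n * ang (B (hit_time B 1 \<omega>) \<omega>) + real_of_int m * ang (B (hit_time B (1 / \<rho>2) \<omega>) \<omega>)) \<partial>M)
    = of_real (\<rho>2 ^ nat \<bar>m\<bar> * \<rho>1 ^ nat \<bar>n + m\<bar>) * cis (real_of_int (n + m) * \<mu>)"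
proof -
  define \<Theta> where "\<Theta> \<omega> = ang (B (hit_time B 1 \<omega>) \<omega>)" for \<omega>
  define \<Phi> where "\<Phi> \<omega> = ang (B (hit_time B (1 / \<rho>2) \<omega>) \<omega>)" for \<omega>
  have r: "cmod x0 < 1" using x0 by (simp add: norm_mult)
  have R: "1 < 1 / \<rho>2" using \<rho>2 by simp
  then have R': "cmod x0 < 1 / \<rho>2" using r by linarith
  have [measurable]: "\<Theta> \<in> borel_measurable M" "\<Phi> \<in> borel_measurable M"
    unfolding \<Theta>_def \<Phi>_def using hit_angle_measurable r R' by auto
  have nonneg: "(\<integral>\<omega>. cis (real_of_int n * \<Theta> \<omega> + real m * \<Phi> \<omega>) \<partial>M)
      = of_real (\<rho>2 ^ m * \<rho>1 ^ nat \<bar>n + int m\<bar>) * cis (real_of_int (n + int m) * \<mu>)" for n and m :: nat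
  proof -
    \<comment> \<open>As a bounded Borel weight, f may carry a frequency n of either sign; only m
      has to be nonnegative here.\<close>
    define f where "f z = cis (real_of_int n * ang z)" for z
    have f: "f \<in> borel_measurable borel" "\<And>z. cmod (f z) \<le> 1"
      unfolding f_def by (simp_all add: cis_conv_exp)
    have pos: "(\<lambda>\<omega>. B (hit_time B 1 \<omega>) \<omega>) \<in> borel_measurable M" "(\<lambda>\<omega>. B (hit_time B (1 / \<rho>2) \<omega>) \<omega>) \<in> borel_measurable M"
      using hit_position_measurable r R' by auto
    have "(\<integral>\<omega>. cis (real_of_int n * \<Theta> \<omega> + real m * \<Phi> \<omega>) \<partial>M) =
        (\<integral>\<omega>. of_real (\<rho>2 ^ m) * (f (B (hit_time B 1 \<omega>) \<omega>) * B (hit_time B (1 / \<rho>2) \<omega>) \<omega> ^ m) \<partial>M)"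
    proof (rule integral_cong_AE)
      show "AE \<omega> in M. cis (real_of_int n * \<Theta> \<omega> + real m * \<Phi> \<omega>) =
          of_real (\<rho>2 ^ m) * (f (B (hit_time B 1 \<omega>) \<omega>) * B (hit_time B (1 / \<rho>2) \<omega>) \<omega> ^ m)"
        using AE_hit_position[OF R']
      proof eventually_elim
        fix \<omega> assume "cmod (B (hit_time B (1 / \<rho>2) \<omega>) \<omega>) = 1 / \<rho>2"
        from cis_power_cmod[OF this, of m] \<rho>2(1)
        have "of_real ((1 / \<rho>2) ^ m) * cis (real m * \<Phi> \<omega>) = B (hit_time B (1 / \<rho>2) \<omega>) \<omega> ^ m"
          by (simp add: \<Phi>_def)
        then have "of_real (\<rho>2 ^ m) * (of_real ((1 / \<rho>2) ^ m) * cis (real m * \<Phi> \<omega>)) = of_real (\<rho>2 ^ m) * B (hit_time B (1 / \<rho>2) \<omega>) \<omega> ^ m"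
          by simp
        then have "cis (real m * \<Phi> \<omega>) = of_real (\<rho>2 ^ m) * B (hit_time B (1 / \<rho>2) \<omega>) \<omega> ^ m"
          using \<rho>2(1) by (simp add: power_divide)
        then show "cis (real_of_int n * \<Theta> \<omega> + real m * \<Phi> \<omega>) =
          of_real (\<rho>2 ^ m) * (f (B (hit_time B 1 \<omega>) \<omega>) * B (hit_time B (1 / \<rho>2) \<omega>) \<omega> ^ m)"
          by (simp add: f_def \<Theta>_def cis_mult[symmetric])
      qed
    qed (use f(1) pos in \<open>auto intro!: cis_measurable\<close>)
    also have "\<dots> = of_real (\<rho>2 ^ m) * (\<integral>\<omega>. f (B (hit_time B 1 \<omega>) \<omega>) * B (hit_time B 1 \<omega>) \<omega> ^ m \<partial>M)"
      by (simp add: hit_positions_moment[OF r R f])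
    also have "(\<integral>\<omega>. f (B (hit_time B 1 \<omega>) \<omega>) * B (hit_time B 1 \<omega>) \<omega> ^ m \<partial>M)
        = (\<integral>\<omega>. cis (real_of_int (n + int m) * ang (B (hit_time B 1 \<omega>) \<omega>)) \<partial>M)"
    proof (rule integral_cong_AE)
      show "AE \<omega> in M. f (B (hit_time B 1 \<omega>) \<omega>) * B (hit_time B 1 \<omega>) \<omega> ^ m = cis (real_of_int (n + int m) * ang (B (hit_time B 1 \<omega>) \<omega>))"
        using AE_hit_position[OF r]
      proof eventually_elim
        fix \<omega> assume "cmod (B (hit_time B 1 \<omega>) \<omega>) = 1"
        from cis_power_cmod[OF this, of m]
        have eq: "B (hit_time B 1 \<omega>) \<omega> ^ m = cis (real m * ang (B (hit_time B 1 \<omega>) \<omega>))" by simp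
        show "f (B (hit_time B 1 \<omega>) \<omega>) * B (hit_time B 1 \<omega>) \<omega> ^ m = cis (real_of_int (n + int m) * ang (B (hit_time B 1 \<omega>) \<omega>))"
          by (simp add: f_def cis_mult distrib_right eq)
      qed
    qed (use f(1) pos hit_angle_measurable[OF r] in \<open>auto intro!: cis_measurable\<close>)
    also have "\<dots> = of_real (\<rho>1 ^ nat \<bar>n + int m\<bar>) * cis (real_of_int (n + int m) * \<mu>)"
      by (rule hit_angle_fourier[OF x0])
    finally show ?thesis by simp
  qed
  show ?thesis
    unfolding \<Theta>_def[symmetric] \<Phi>_def[symmetric]
  proof (cases "0 \<le> m")
    case True
    then show "(\<integral>\<omega>. cis (real_of_int n * \<Theta> \<omega> + real_of_int m * \<Phi> \<omega>) \<partial>M)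
      = of_real (\<rho>2 ^ nat \<bar>m\<bar> * \<rho>1 ^ nat \<bar>n + m\<bar>) * cis (real_of_int (n + m) * \<mu>)"
      using nonneg[of n "nat m"] by simp
  next
    case False
    have "(\<integral>\<omega>. cis (real_of_int n * \<Theta> \<omega> + real_of_int m * \<Phi> \<omega>) \<partial>M) =
        (\<integral>\<omega>. cnj (cis (real_of_int (- n) * \<Theta> \<omega> + real (nat (- m)) * \<Phi> \<omega>)) \<partial>M)"
      using False by (intro Bochner_Integration.integral_cong refl) (simp add: cis_cnj add.commute)
    also have "\<dots> = cnj (of_real (\<rho>2 ^ nat (- m) * \<rho>1 ^ nat \<bar>- n + int (nat (- m))\<bar>) * cis (real_of_int (- n + int (nat (- m))) * \<mu>))"
      unfolding Bochner_Integration.integral_cnj nonneg ..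
    also have "- n + int (nat (- m)) = - (n + m)" using False by simp
    finally show "(\<integral>\<omega>. cis (real_of_int n * \<Theta> \<omega> + real_of_int m * \<Phi> \<omega>) \<partial>M)
      = of_real (\<rho>2 ^ nat \<bar>m\<bar> * \<rho>1 ^ nat \<bar>n + m\<bar>) * cis (real_of_int (n + m) * \<mu>)"
      using False by (simp add: cis_cnj abs_minus_commute[of n] del: of_int_add minus_add_distrib)
  qed
qed

end

section \<open>Uniqueness of Fourier coefficients on the torus\<close>

text \<open>Urysohn functions of the distance to a closed set decrease to its indicator.\<close>
lemma measure_eqI_continuous_integrals:
  fixes \<mu> \<nu> :: "'a :: metric_space measure"
  assumes "prob_space \<mu>" "prob_space \<nu>" and sets: "sets \<mu> = sets borel" "sets \<nu> = sets borel"
    and eq: "\<And>f :: 'a \<Rightarrow> real. continuous_on UNIV f \<Longrightarrow> (\<And>x. 0 \<le> f x \<and> f x \<le> 1) \<Longrightarrow> (\<integral>x. f x \<partial>\<mu>) = (\<integral>x. f x \<partial>\<nu>)"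
  shows "\<mu> = \<nu>"
proof -
  interpret \<mu>: prob_space \<mu> by fact
  interpret \<nu>: prob_space \<nu> by fact
  have closed_eq: "measure \<mu> C = measure \<nu> C" if C: "closed C" for C
  proof (cases "C = {}")
    case False
    define f where "f n x = max 0 (1 - real n * infdist x C)" for n x
    have cont: "continuous_on UNIV (f n)" for n
      unfolding f_def by (intro continuous_intros)
    have rng: "0 \<le> f n x \<and> f n x \<le> 1" for n x
      using infdist_nonneg[of x C] by (auto simp: f_def)
    have lim: "(\<lambda>n. f n x) \<longlonglongrightarrow> indicator C x" for x
    proof (cases "x \<in> C")
      case True
      then show ?thesis by (simp add: f_def)
    next
      case x: False
      then have pos: "0 < infdist x C"
        using C False infdist_pos_not_in_closed by blast
      have "\<forall>\<^sub>F n in sequentially. 1 / infdist x C \<le> real n"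
        using filterlim_real_sequentially by (auto simp: filterlim_at_top)
      then have "\<forall>\<^sub>F n in sequentially. f n x = indicator C x"
        by eventually_elim (use pos x in \<open>auto simp: f_def field_simps\<close>)
      then show ?thesis by (rule tendsto_eventually)
    qed
    have "(\<lambda>n. \<integral>x. f n x \<partial>M) \<longlonglongrightarrow> measure M C" if "prob_space M" "sets M = sets borel" for M
    proof -
      interpret prob_space M by fact
      have fM: "f n \<in> borel_measurable M" for n
        using borel_measurable_continuous_onI[OF cont] that(2) by (simp cong: measurable_cong_sets)
      have CM: "C \<in> sets M" using C that(2) by auto
      have "(\<lambda>n. \<integral>x. f n x \<partial>M) \<longlonglongrightarrow> (\<integral>x. indicator C x \<partial>M)"
        by (rule integral_dominated_convergence[where w="\<lambda>_. 1"])
           (use fM CM lim rng in \<open>auto intro: AE_I2\<close>)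
      then show ?thesis using CM sets.sets_into_space[OF CM] by (simp add: Int_absorb2)
    qed
    from this[OF \<open>prob_space \<mu>\<close> sets(1)] this[OF \<open>prob_space \<nu>\<close> sets(2)] show ?thesis
      unfolding eq[OF cont rng] by (rule LIMSEQ_unique)
  qed simp
  show ?thesis
  proof (rule measure_eqI_generator_eq[where E="Collect closed" and \<Omega>=UNIV and A="\<lambda>_. UNIV"])
    show "Int_stable (Collect closed)" by (auto simp: Int_stable_def)
    show "emeasure \<mu> X = emeasure \<nu> X" if "X \<in> Collect closed" for X
      using closed_eq that by (simp add: \<mu>.emeasure_eq_measure \<nu>.emeasure_eq_measure)
    show "sets \<mu> = sigma_sets UNIV (Collect closed)" "sets \<nu> = sigma_sets UNIV (Collect closed)"
      by (auto simp: sets borel_eq_closed)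
  qed auto
qed

text \<open>The functions whose integrals are determined by Fourier coefficients. Generation by
  modes and sums turns that fact into a short induction.\<close>

inductive trig_poly :: "(real \<times> real \<Rightarrow> complex) \<Rightarrow> bool" where
  mode: "trig_poly (\<lambda>p. c * cis (real_of_int n * fst p + real_of_int m * snd p))"
| add: "trig_poly f \<Longrightarrow> trig_poly g \<Longrightarrow> trig_poly (\<lambda>p. f p + g p)"

lemma trig_poly_mult_mode:
  assumes "trig_poly h"
  shows "trig_poly (\<lambda>p. (c * cis (real_of_int n * fst p + real_of_int m * snd p)) * h p)"
  using assms
proof induction
  case (mode c' n' m')
  have "(\<lambda>p. c * cis (real_of_int n * fst p + real_of_int m * snd p) * (c' * cis (real_of_int n' * fst p + real_of_int m' * snd p)))
    = (\<lambda>p. (c * c') * cis (real_of_int (n + n') * fst p + real_of_int (m + m') * snd p))"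
    by (simp add: fun_eq_iff algebra_simps flip: cis_mult)
  then show ?case by (simp only: trig_poly.mode)
next
  case (add f g)
  show ?case unfolding distrib_left by (rule trig_poly.add[OF add.IH])
qed

abbreviation torus_point :: "real \<times> real \<Rightarrow> complex \<times> complex" where
  "torus_point p \<equiv> (cis (fst p), cis (snd p))"

text \<open>The additional factor h strengthens the induction: a product of two polynomials is
  handled by applying the two hypotheses in succession.\<close>

lemma trig_poly_mult_real_polynomial:
  fixes f :: "complex \<times> complex \<Rightarrow> real"
  assumes "real_polynomial_function f" "trig_poly h"
  shows "trig_poly (\<lambda>p. of_real (f (torus_point p)) * h p)"
  using assms
proof (induction arbitrary: h)
  case (linear f)
  interpret f: bounded_linear f by fact
  \<comment> \<open>A real-linear functional on pairs of complex numbers is determined by its values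
    on the four real basis vectors.\<close>
  define a b c d where "a = complex_of_real (f (1, 0))" and "b = complex_of_real (f (\<i>, 0))"
    and "c = complex_of_real (f (0, 1))" and "d = complex_of_real (f (0, \<i>))"
  have f: "f (z, w) = Re z * f (1, 0) + Im z * f (\<i>, 0) + Re w * f (0, 1) + Im w * f (0, \<i>)" for z w
  proof -
    have "(z, w) = Re z *\<^sub>R (1, 0) + Im z *\<^sub>R (\<i>, 0) + Re w *\<^sub>R (0, 1) + Im w *\<^sub>R (0, \<i>)"
      by (simp add: complex_eq_iff)
    then have "f (z, w) = f (Re z *\<^sub>R (1, 0) + Im z *\<^sub>R (\<i>, 0) + Re w *\<^sub>R (0, 1) + Im w *\<^sub>R (0, \<i>))" by simp
    then show ?thesis by (simp only: f.add f.scaleR real_scaleR_def)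
  qed
  \<comment> \<open>The factors 1/2 and 1/(2i) of Euler's formulas for cosine and sine.\<close>
  define t u where "t = (1 / 2 :: complex)" and "u = - \<i> / 2"
  have cos: "complex_of_real (cos x) = (cis x + cis (- x)) * t"
    and sin: "complex_of_real (sin x) = (cis x - cis (- x)) * u" for x
    by (auto simp: complex_eq_iff t_def u_def)
  have "(\<lambda>p. of_real (f (torus_point p)) * h p) = (\<lambda>p.
      (((a * t + b * u) * cis (real_of_int 1 * fst p + real_of_int 0 * snd p)) * h p
      + ((a * t - b * u) * cis (real_of_int (- 1) * fst p + real_of_int 0 * snd p)) * h p)
      + (((c * t + d * u) * cis (real_of_int 0 * fst p + real_of_int 1 * snd p)) * h p
      + ((c * t - d * u) * cis (real_of_int 0 * fst p + real_of_int (- 1) * snd p)) * h p))"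
  proof
    fix p
    have eq: "complex_of_real (f (torus_point p)) =
        (cis (fst p) + cis (- fst p)) * t * a + (cis (fst p) - cis (- fst p)) * u * b
        + (cis (snd p) + cis (- snd p)) * t * c + (cis (snd p) - cis (- snd p)) * u * d"
      unfolding cos[symmetric] sin[symmetric] a_def b_def c_def d_def
      by (subst f) simp
    show "of_real (f (torus_point p)) * h p =
      (((a * t + b * u) * cis (real_of_int 1 * fst p + real_of_int 0 * snd p)) * h p
      + ((a * t - b * u) * cis (real_of_int (- 1) * fst p + real_of_int 0 * snd p)) * h p)
      + (((c * t + d * u) * cis (real_of_int 0 * fst p + real_of_int 1 * snd p)) * h p
      + ((c * t - d * u) * cis (real_of_int 0 * fst p + real_of_int (- 1) * snd p)) * h p)"
      unfolding eq by (simp add: algebra_simps)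
  qed
  then show ?case
    using linear.prems by (simp only:) (intro trig_poly.add trig_poly_mult_mode)
next
  case (const c)
  then show ?case using trig_poly_mult_mode[of h "of_real c" 0 0] by simp
next
  case (add f g)
  then show ?case using trig_poly.add[OF add.IH] by (simp add: distrib_right)
next
  case (mult f g)
  then show ?case using mult.IH(1)[OF mult.IH(2)[OF mult.prems]] by (simp add: mult.assoc)
qed

lemma torus_point_measurable [measurable]: "torus_point \<in> borel_measurable borel"
  by (intro borel_measurable_continuous_onI continuous_intros)

text \<open>Trigonometric polynomials are dense on the torus by Stone--Weierstrass.\<close>
lemma torus_measure_eqI:
  fixes \<mu> \<nu> :: "(real \<times> real) measure"
  assumes "prob_space \<mu>" "prob_space \<nu>" and sets: "sets \<mu> = sets borel" "sets \<nu> = sets borel"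
    and fourier: "\<And>n m. (\<integral>p. cis (real_of_int n * fst p + real_of_int m * snd p) \<partial>\<mu>)
      = (\<integral>p. cis (real_of_int n * fst p + real_of_int m * snd p) \<partial>\<nu>)"
  shows "distr \<mu> borel torus_point = distr \<nu> borel torus_point"
proof -
  interpret \<mu>: prob_space \<mu> by fact
  interpret \<nu>: prob_space \<nu> by fact
  have meas: "f \<in> borel_measurable \<mu>" "f \<in> borel_measurable \<nu>"
    if "f \<in> borel_measurable borel" for f :: "real \<times> real \<Rightarrow> 'b :: topological_space"
    using that sets by (simp_all cong: measurable_cong_sets)
  have trig: "integrable \<mu> h \<and> integrable \<nu> h \<and> (\<integral>p. h p \<partial>\<mu>) = (\<integral>p. h p \<partial>\<nu>)" if "trig_poly h" for h
    using that
  proof induction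
    case (mode c n m)
    have "(\<lambda>p::real \<times> real. cis (real_of_int n * fst p + real_of_int m * snd p)) \<in> borel_measurable borel"
      by (intro borel_measurable_continuous_onI continuous_intros)
    from meas[OF this] show ?case
      using fourier by (auto intro!: integrable_mult_right \<mu>.integrable_const_bound[where B=1] \<nu>.integrable_const_bound[where B=1])
  qed auto
  have poly: "integrable \<mu> (\<lambda>p. g (torus_point p)) \<and> integrable \<nu> (\<lambda>p. g (torus_point p))
      \<and> (\<integral>p. g (torus_point p) \<partial>\<mu>) = (\<integral>p. g (torus_point p) \<partial>\<nu>)"
    if "real_polynomial_function g" for g
  proof -
    have "trig_poly (\<lambda>p. of_real (g (torus_point p)) * 1)"
      using trig_poly_mult_real_polynomial[OF that trig_poly.mode[of 1 0 0]] by simp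
    from trig[OF this, unfolded mult_1_right complex_of_real_integrable_eq Bochner_Integration.integral_complex_of_real of_real_eq_iff]
    show ?thesis .
  qed
  have torus: "torus_point p \<in> sphere 0 1 \<times> sphere 0 1" for p by simp
  have cpt: "compact (sphere (0::complex) 1 \<times> sphere (0::complex) 1)"
    by (intro compact_Times compact_sphere)
  show ?thesis
  proof (rule measure_eqI_continuous_integrals)
    show "prob_space (distr \<mu> borel torus_point)" "prob_space (distr \<nu> borel torus_point)"
      by (intro \<mu>.prob_space_distr \<nu>.prob_space_distr meas torus_point_measurable)+
    fix f :: "complex \<times> complex \<Rightarrow> real"
    assume f: "continuous_on UNIV f" and f01: "\<And>x. 0 \<le> f x \<and> f x \<le> 1"
    have fb: "f \<in> borel_measurable borel" by (rule borel_measurable_continuous_onI[OF f])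
    have ft: "(\<lambda>p. f (torus_point p)) \<in> borel_measurable borel"
      by (rule measurable_compose[OF torus_point_measurable fb])
    have fint: "integrable \<mu> (\<lambda>p. f (torus_point p))" "integrable \<nu> (\<lambda>p. f (torus_point p))"
      using meas[OF ft] f01
      by (auto intro!: \<mu>.integrable_const_bound[where B=1] \<nu>.integrable_const_bound[where B=1])
    have "\<bar>(\<integral>p. f (torus_point p) \<partial>\<mu>) - (\<integral>p. f (torus_point p) \<partial>\<nu>)\<bar> \<le> 0 + e" if "0 < e" for e
    proof -
      have half: "0 < e / 2" using that by simp
      have "continuous_on (sphere 0 1 \<times> sphere 0 1) f" by (rule continuous_on_subset[OF f]) simp
      then obtain g where g: "real_polynomial_function g" "\<And>x. x \<in> sphere 0 1 \<times> sphere 0 1 \<Longrightarrow> \<bar>f x - g x\<bar> < e / 2"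
        using Stone_Weierstrass_real_polynomial_function[OF cpt _ half] by blast
      note gp = poly[OF g(1)]
      have near: "\<bar>(\<integral>p. f (torus_point p) \<partial>M) - (\<integral>p. g (torus_point p) \<partial>M)\<bar> \<le> e / 2"
        if "prob_space M" "integrable M (\<lambda>p. f (torus_point p))" "integrable M (\<lambda>p. g (torus_point p))" for M
      proof -
        interpret prob_space M by fact
        have "\<bar>(\<integral>p. f (torus_point p) \<partial>M) - (\<integral>p. g (torus_point p) \<partial>M)\<bar> = \<bar>\<integral>p. f (torus_point p) - g (torus_point p) \<partial>M\<bar>"
          using that by simp
        also have "\<dots> \<le> (\<integral>p. \<bar>f (torus_point p) - g (torus_point p)\<bar> \<partial>M)" by (rule integral_abs_bound)
        also have "\<dots> \<le> (\<integral>p. e / 2 \<partial>M)"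
        proof (rule integral_mono)
          show "\<bar>f (torus_point p) - g (torus_point p)\<bar> \<le> e / 2" for p
            using g(2)[OF torus, of p] by simp
        qed (use that in auto)
        finally show ?thesis by (simp add: prob_space)
      qed
      show ?thesis
        using near[OF \<open>prob_space \<mu>\<close> fint(1)] near[OF \<open>prob_space \<nu>\<close> fint(2)] gp by linarith
    qed
    then have "\<bar>(\<integral>p. f (torus_point p) \<partial>\<mu>) - (\<integral>p. f (torus_point p) \<partial>\<nu>)\<bar> \<le> 0"
      by (rule field_le_epsilon)
    then show "(\<integral>x. f x \<partial>distr \<mu> borel torus_point) = (\<integral>x. f x \<partial>distr \<nu> borel torus_point)"
      using meas[OF torus_point_measurable] fb by (simp add: integral_distr)
  qed auto
qed

section \<open>The Poisson kernel\<close>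

text \<open>The exit angle from the unit disc of planar Brownian motion started at \<open>r * cis \<mu>\<close> has density
  \<open>\<lambda>x. poisson_kernel r (x - \<mu>)\<close>; by scaling, \<open>r\<close> is in general the ratio of the starting
  modulus to the radius.\<close>
definition poisson_kernel :: "real \<Rightarrow> real \<Rightarrow> real" where
  "poisson_kernel r x = (1 - r\<^sup>2) / (2 * pi * (1 + r\<^sup>2 - 2 * r * cos x))"

lemma poisson_denominator_pos:
  fixes r x :: real
  assumes "0 \<le> r" "r < 1"
  shows "0 < 1 + r\<^sup>2 - 2 * r * cos x"
proof -
  have "0 < (1 - r)\<^sup>2" using assms by (intro zero_less_power) simp
  also have "\<dots> = 1 + r\<^sup>2 - 2 * r * 1" by (simp add: power2_diff)
  also have "\<dots> \<le> 1 + r\<^sup>2 - 2 * r * cos x"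
    using assms by (intro diff_left_mono mult_left_mono) auto
  finally show ?thesis .
qed

lemma poisson_kernel_pos: "0 \<le> r \<Longrightarrow> r < 1 \<Longrightarrow> 0 < poisson_kernel r x"
  using poisson_denominator_pos[of r x] power_strict_mono[of r 1 2]
  by (auto simp: poisson_kernel_def intro!: divide_pos_pos mult_pos_pos)

lemma poisson_kernel_continuous:
  fixes f :: "'a :: t2_space \<Rightarrow> real"
  assumes "0 \<le> r" "r < 1" "continuous_on A f"
  shows "continuous_on A (\<lambda>x. poisson_kernel r (f x))"
  unfolding poisson_kernel_def
proof (intro continuous_intros ballI assms(3))
  show "2 * pi * (1 + r\<^sup>2 - 2 * r * cos (f x)) \<noteq> 0" for x
    using poisson_denominator_pos[OF assms(1,2), of "f x"] by simp
qed

lemma cis_integral_period: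
  fixes k :: int
  shows "set_lebesgue_integral lborel {-pi..pi} (\<lambda>x. cis (real_of_int k * (x - \<mu>))) = (if k = 0 then 2 * of_real pi else 0)"
proof (cases "k = 0")
  case False
  define F where "F x = cis (real_of_int k * (x - \<mu>)) * (1 / (\<i> * of_int k))" for x
  have "(F has_vector_derivative cis (real_of_int k * (x - \<mu>))) (at x within {-pi..pi})" for x
  proof -
    have "((\<lambda>x. real_of_int k * (x - \<mu>)) has_derivative (\<lambda>t. real_of_int k * t)) (at x within {-pi..pi})"
      by (auto intro!: derivative_eq_intros)
    from has_derivative_cis[OF this]
    have "((\<lambda>x. cis (real_of_int k * (x - \<mu>))) has_vector_derivative (real_of_int k *\<^sub>R (\<i> * cis (real_of_int k * (x - \<mu>))))) (at x within {-pi..pi})"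
      by (simp add: has_vector_derivative_def mult.commute)
    from bounded_linear.has_vector_derivative[OF bounded_linear_mult_left this, of "1 / (\<i> * of_int k)"]
    show ?thesis unfolding F_def using False by (simp add: scaleR_conv_of_real)
  qed
  then have "integral\<^sup>L lborel (\<lambda>x. indicator {-pi..pi} x *\<^sub>R cis (real_of_int k * (x - \<mu>))) = F pi - F (- pi)"
    by (intro integral_FTC_atLeastAtMost continuous_intros) auto
  moreover have "F pi = F (- pi)"
  proof -
    have "cis (real_of_int k * (pi - \<mu>)) = cis (real_of_int k * (- pi - \<mu>)) * cis (2 * pi * real_of_int k)"
      by (simp add: cis_mult algebra_simps)
    then show ?thesis by (simp add: F_def cis_multiple_2pi)
  qed
  ultimately show ?thesis using False by (simp add: set_lebesgue_integral_def)
qed (simp add: set_lebesgue_integral_def scaleR_conv_of_real)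

text \<open>With the denominator cleared, the Fourier coefficients \<open>I\<^sub>k\<close> of the kernel satisfy
  \<open>r I\<^sub>k\<^sub>+\<^sub>1 - (1 + r\<^sup>2) I\<^sub>k + r I\<^sub>k\<^sub>-\<^sub>1 = 0\<close> for \<open>k \<noteq> 0\<close>; the differences \<open>I\<^sub>k\<^sub>+\<^sub>1 - r I\<^sub>k\<close>
  therefore grow like \<open>r\<^sup>-\<^sup>k\<close> unless they vanish, and \<open>I\<close> is bounded.\<close>
lemma poisson_kernel_fourier:
  fixes k :: int
  assumes r: "0 \<le> r" "r < 1"
  shows "set_lebesgue_integral lborel {-pi..pi} (\<lambda>x. poisson_kernel r (x - \<mu>) *\<^sub>R cis (real_of_int k * (x - \<mu>)))
    = of_real (r ^ nat \<bar>k\<bar>)"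
proof -
  define w where "w x = poisson_kernel r (x - \<mu>)" for x
  define I where "I k = set_lebesgue_integral lborel {-pi..pi} (\<lambda>x. w x *\<^sub>R cis (real_of_int k * (x - \<mu>)))" for k :: int
  have wc: "continuous_on A w" for A
    unfolding w_def by (intro poisson_kernel_continuous r continuous_intros)
  have int: "set_integrable lborel {-pi..pi} (\<lambda>x. w x *\<^sub>R cis (real_of_int k * (x - \<mu>)))" for k
    by (rule borel_integrable_atLeastAtMost') (intro continuous_intros wc)
  have w_eq: "w x * (1 + r\<^sup>2 - 2 * r * cos (x - \<mu>)) = (1 - r\<^sup>2) / (2 * pi)" for x
    using poisson_denominator_pos[OF r, of "x - \<mu>"] by (simp add: w_def poisson_kernel_def)
  have rec: "of_real (1 + r\<^sup>2) * I k - of_real r * I (k + 1) - of_real r * I (k - 1) = (if k = 0 then of_real (1 - r\<^sup>2) else 0)" for k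
  proof -
    have "of_real (1 + r\<^sup>2) * I k - of_real r * I (k + 1) - of_real r * I (k - 1) =
      set_lebesgue_integral lborel {-pi..pi} (\<lambda>x. of_real (1 + r\<^sup>2) * (w x *\<^sub>R cis (real_of_int k * (x - \<mu>)))
        - of_real r * (w x *\<^sub>R cis (real_of_int (k + 1) * (x - \<mu>))) - of_real r * (w x *\<^sub>R cis (real_of_int (k - 1) * (x - \<mu>))))"
      unfolding I_def
      by (subst set_integral_diff(2) set_integral_mult_right; (intro set_integral_diff(1) set_integrable_mult_right int)?)+ simp
    also have "\<dots> = set_lebesgue_integral lborel {-pi..pi} (\<lambda>x. of_real ((1 - r\<^sup>2) / (2 * pi)) * cis (real_of_int k * (x - \<mu>)))"
    proof (rule set_lebesgue_integral_cong)
      show "\<forall>x. x \<in> {-pi..pi} \<longrightarrow> of_real (1 + r\<^sup>2) * (w x *\<^sub>R cis (real_of_int k * (x - \<mu>)))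
        - of_real r * (w x *\<^sub>R cis (real_of_int (k + 1) * (x - \<mu>))) - of_real r * (w x *\<^sub>R cis (real_of_int (k - 1) * (x - \<mu>)))
        = of_real ((1 - r\<^sup>2) / (2 * pi)) * cis (real_of_int k * (x - \<mu>))"
      proof (intro allI impI)
        fix x
        define C where "C = cis (real_of_int k * (x - \<mu>))"
        have e: "cis (real_of_int (k + 1) * (x - \<mu>)) = C * cis (x - \<mu>)" "cis (real_of_int (k - 1) * (x - \<mu>)) = C * cis (- (x - \<mu>))"
          by (simp_all add: C_def cis_mult algebra_simps)
        have "cis y + cis (- y) = of_real (2 * cos y)" for y
          by (simp add: complex_eq_iff)
        note c = this[of "x - \<mu>"]
        have "of_real (1 + r\<^sup>2) * (w x *\<^sub>R C) - of_real r * (w x *\<^sub>R (C * cis (x - \<mu>))) - of_real r * (w x *\<^sub>R (C * cis (- (x - \<mu>))))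
          = of_real (w x) * C * (of_real (1 + r\<^sup>2) - of_real r * (cis (x - \<mu>) + cis (- (x - \<mu>))))"
          unfolding scaleR_conv_of_real by algebra
        also have "\<dots> = of_real (w x * (1 + r\<^sup>2 - 2 * r * cos (x - \<mu>))) * C"
          unfolding c by (simp add: algebra_simps)
        finally show "of_real (1 + r\<^sup>2) * (w x *\<^sub>R cis (real_of_int k * (x - \<mu>)))
          - of_real r * (w x *\<^sub>R cis (real_of_int (k + 1) * (x - \<mu>))) - of_real r * (w x *\<^sub>R cis (real_of_int (k - 1) * (x - \<mu>)))
          = of_real ((1 - r\<^sup>2) / (2 * pi)) * cis (real_of_int k * (x - \<mu>))"
          unfolding e w_eq C_def[symmetric] .
      qed
    qed simp
    also have "\<dots> = of_real ((1 - r\<^sup>2) / (2 * pi)) * (if k = 0 then 2 * of_real pi else 0)"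
      by (simp add: cis_integral_period)
    also have "\<dots> = (if k = 0 then of_real (1 - r\<^sup>2) else 0)" by simp
    finally show ?thesis .
  qed
  have cnjI: "I (- k) = cnj (I k)" for k
  proof -
    have "I (- k) = set_lebesgue_integral lborel {-pi..pi} (\<lambda>x. cnj (w x *\<^sub>R cis (real_of_int k * (x - \<mu>))))"
      unfolding I_def by (intro set_lebesgue_integral_cong) (auto simp: cis_cnj scaleR_conv_of_real)
    also have "\<dots> = cnj (I k)"
      unfolding I_def set_lebesgue_integral_def
      by (subst Bochner_Integration.integral_cnj[symmetric]) (simp add: scaleR_conv_of_real)
    finally show ?thesis .
  qed
  \<comment> \<open>Since the kernel is positive, its total mass bounds all coefficients at
    once.\<close>
  define K where "K = (\<integral>x. indicator {-pi..pi} x * w x \<partial>lborel)"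
  have bounded: "cmod (I k) \<le> K" for k
  proof -
    have "cmod (I k) \<le> (\<integral>x. cmod (indicator {-pi..pi} x *\<^sub>R (w x *\<^sub>R cis (real_of_int k * (x - \<mu>)))) \<partial>lborel)"
      unfolding I_def set_lebesgue_integral_def by (rule integral_norm_bound)
    also have "\<dots> = K"
      unfolding K_def using poisson_kernel_pos[OF r]
      by (intro Bochner_Integration.integral_cong refl) (auto simp: w_def indicator_def less_imp_le)
    finally show ?thesis .
  qed
  have step: "I (int n + 1) = of_real r * I (int n)" for n
  proof -
    define J where "J n = I (int n + 1) - of_real r * I (int n)" for n :: nat
    have Jrec: "of_real r * J (Suc n) = J n" for n
    proof -
      have "of_real (1 + r\<^sup>2) * I (int n + 1) - of_real r * I (int n + 2) - of_real r * I (int n) = 0"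
        using rec[of "int n + 1"] by (simp add: add.commute)
      then show ?thesis
        by (simp add: J_def algebra_simps power2_eq_square)
    qed
    have Jpow: "J n = of_real (r ^ m) * J (n + m)" for m
    proof (induction m)
      case (Suc m)
      have "of_real (r ^ Suc m) * J (n + Suc m) = of_real (r ^ m) * (of_real r * J (Suc (n + m)))" by simp
      then show ?case using Suc Jrec[of "n + m"] by simp
    qed simp
    have Jb: "cmod (J n) \<le> K + r * K" for n
    proof -
      have "cmod (J n) \<le> cmod (I (int n + 1)) + cmod (of_real r * I (int n))"
        unfolding J_def by (rule norm_triangle_ineq4)
      also have "\<dots> \<le> K + r * K"
        using bounded r by (auto simp: norm_mult intro!: add_mono mult_left_mono)
      finally show ?thesis .
    qed
    have lim: "(\<lambda>m. r ^ m * (K + r * K)) \<longlonglongrightarrow> 0 * (K + r * K)"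
      using r by (intro tendsto_mult LIMSEQ_realpow_zero tendsto_const) auto
    have bd: "cmod (J n) \<le> r ^ m * (K + r * K)" for m
    proof -
      have "cmod (J n) = r ^ m * cmod (J (n + m))"
        using r by (subst Jpow[of m]) (simp add: norm_mult norm_power)
      then show ?thesis using Jb r by (simp add: mult_left_mono)
    qed
    have "cmod (J n) \<le> 0 * (K + r * K)"
      by (rule LIMSEQ_le_const[OF lim]) (use bd in blast)
    then show ?thesis by (simp add: J_def)
  qed
  \<comment> \<open>I 0 is real, so both neighbours of I 0 equal r I 0, and the recursion at k = 0
    becomes (1 - r^2) I 0 = 1 - r^2, which normalises the kernel.\<close>
  have I0_real: "cnj (I 0) = I 0" using cnjI[of 0] by simp
  have I1: "I 1 = of_real r * I 0" using step[of 0] by simp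
  then have Im1: "I (- 1) = of_real r * I 0" using cnjI[of 1] I0_real by simp
  have "of_real (1 - r\<^sup>2) * I 0 = of_real (1 - r\<^sup>2)"
    using rec[of 0] by (simp add: I1 Im1 algebra_simps power2_eq_square)
  moreover have "1 - r\<^sup>2 \<noteq> 0" using r power_strict_mono[of r 1 2] by auto
  ultimately have I0: "I 0 = 1" by (metis mult_cancel_left mult_1_right of_real_eq_0_iff)
  have nonneg: "I (int n) = of_real (r ^ n)" for n
    by (induction n) (use I0 step in \<open>auto simp: add.commute\<close>)
  have "I k = of_real (r ^ nat \<bar>k\<bar>)"
  proof (cases "0 \<le> k")
    case True
    then show ?thesis using nonneg[of "nat k"] by simp
  next
    case False
    then have "I k = cnj (I (int (nat (- k))))" using cnjI[of "- k"] by simp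
    also have "\<dots> = of_real (r ^ nat \<bar>k\<bar>)" unfolding nonneg using False by simp
    finally show ?thesis .
  qed
  then show ?thesis by (simp add: I_def w_def)
qed

section \<open>Uniqueness for laws of pairs of angles\<close>

lemma borel_measurable_fst: "fst \<in> borel_measurable (borel :: ('a :: topological_space \<times> 'b :: topological_space) measure)"
  and borel_measurable_snd: "snd \<in> borel_measurable (borel :: ('a :: topological_space \<times> 'b :: topological_space) measure)"
  by (intro borel_measurable_continuous_onI continuous_intros)+

text \<open>On the half-open square \<open>ang\<close> inverts the map to the torus in each
  coordinate, so a law carried by the square is recovered from its image, where Fourier coefficients
  determine it.\<close>

lemma angle_measure_eqI:
  fixes \<mu> \<nu> :: "(real \<times> real) measure"
  assumes "prob_space \<mu>" "prob_space \<nu>" and sets: "sets \<mu> = sets borel" "sets \<nu> = sets borel"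
    and fourier: "\<And>n m. (\<integral>p. cis (real_of_int n * fst p + real_of_int m * snd p) \<partial>\<mu>)
      = (\<integral>p. cis (real_of_int n * fst p + real_of_int m * snd p) \<partial>\<nu>)"
    and range: "AE p in \<mu>. p \<in> {-pi..<pi} \<times> {-pi..<pi}" "AE p in \<nu>. p \<in> {-pi..<pi} \<times> {-pi..<pi}"
  shows "\<mu> = \<nu>"
proof -
  let ?g = "\<lambda>z. (ang (fst z), ang (snd z))"
  have g: "?g \<in> borel_measurable borel"
    by (intro borel_measurable_Pair measurable_compose[OF borel_measurable_fst ang_measurable]
        measurable_compose[OF borel_measurable_snd ang_measurable])
  have recover: "distr (distr M borel torus_point) borel ?g = M"
    if "sets M = sets borel" "AE p in M. p \<in> {-pi..<pi} \<times> {-pi..<pi}" for M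
  proof -
    have t: "torus_point \<in> borel_measurable M"
      using torus_point_measurable that(1) by (simp cong: measurable_cong_sets)
    have "distr (distr M borel torus_point) borel ?g = distr M borel (?g \<circ> torus_point)"
      by (rule distr_distr[OF g t])
    also have "\<dots> = distr M borel (\<lambda>p. p)"
    proof (rule distr_cong_AE)
      show "AE p in M. (?g \<circ> torus_point) p = p"
        using that(2) by eventually_elim (auto simp: ang_cis)
      show "?g \<circ> torus_point \<in> borel_measurable M" by (rule measurable_comp[OF t g])
      show "(\<lambda>p. p) \<in> borel_measurable M" using that(1) by (simp add: measurable_ident_sets)
    qed auto
    also have "\<dots> = M" using that(1) by (intro distr_id2) simp
    finally show ?thesis .
  qed
  have eq: "distr \<mu> borel torus_point = distr \<nu> borel torus_point"
    by (rule torus_measure_eqI[OF assms(1-4) fourier])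
  have "\<mu> = distr (distr \<mu> borel torus_point) borel ?g" by (rule recover[OF sets(1) range(1), symmetric])
  also have "\<dots> = distr (distr \<nu> borel torus_point) borel ?g" unfolding eq ..
  also have "\<dots> = \<nu>" by (rule recover[OF sets(2) range(2)])
  finally show ?thesis .
qed

lemma poisson_kernel_even: "poisson_kernel r (x - y) = poisson_kernel r (y - x)"
  using cos_minus[of "x - y"] by (simp add: poisson_kernel_def)

text \<open>The endpoint pi is a null set, and replacing the centred exponential by the plain one
  pulls out the factor \<open>cis (k * \<mu>)\<close>.\<close>

lemma poisson_kernel_fourier':
  fixes k :: int
  assumes r: "0 \<le> r" "r < 1"
  shows "(\<integral>x. (indicator {-pi..<pi} x * poisson_kernel r (x - \<mu>)) *\<^sub>R cis (real_of_int k * x) \<partial>lborel)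
    = of_real (r ^ nat \<bar>k\<bar>) * cis (real_of_int k * \<mu>)"
proof -
  have P [measurable]: "(\<lambda>x. poisson_kernel r (x - \<mu>)) \<in> borel_measurable borel"
    by (intro borel_measurable_continuous_onI poisson_kernel_continuous r continuous_intros)
  have C [measurable]: "(\<lambda>x. cis (real_of_int k * (x - \<mu>))) \<in> borel_measurable borel" "(\<lambda>x. cis (real_of_int k * x)) \<in> borel_measurable borel"
    by (intro borel_measurable_continuous_onI continuous_intros)+
  have "(\<integral>x. (indicator {-pi..<pi} x * poisson_kernel r (x - \<mu>)) *\<^sub>R cis (real_of_int k * x) \<partial>lborel)
    = (\<integral>x. (indicator {-pi..pi} x *\<^sub>R (poisson_kernel r (x - \<mu>) *\<^sub>R cis (real_of_int k * (x - \<mu>)))) * cis (real_of_int k * \<mu>) \<partial>lborel)"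
  proof (rule integral_cong_AE)
    show "AE x in lborel. (indicator {-pi..<pi} x * poisson_kernel r (x - \<mu>)) *\<^sub>R cis (real_of_int k * x)
      = (indicator {-pi..pi} x *\<^sub>R (poisson_kernel r (x - \<mu>) *\<^sub>R cis (real_of_int k * (x - \<mu>)))) * cis (real_of_int k * \<mu>)"
      using AE_lborel_singleton[of pi]
    proof eventually_elim
      fix x assume "x \<noteq> pi"
      then have "indicator {-pi..<pi} x = (indicator {-pi..pi} x :: real)" by (auto simp: indicator_def)
      moreover have "cis (real_of_int k * x) = cis (real_of_int k * (x - \<mu>)) * cis (real_of_int k * \<mu>)"
        by (simp add: cis_mult algebra_simps)
      ultimately show "(indicator {-pi..<pi} x * poisson_kernel r (x - \<mu>)) *\<^sub>R cis (real_of_int k * x)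
        = (indicator {-pi..pi} x *\<^sub>R (poisson_kernel r (x - \<mu>) *\<^sub>R cis (real_of_int k * (x - \<mu>)))) * cis (real_of_int k * \<mu>)"
        by (simp only: scaleR_conv_of_real of_real_mult mult.assoc)
    qed
  qed measurable
  also have "\<dots> = set_lebesgue_integral lborel {-pi..pi} (\<lambda>x. poisson_kernel r (x - \<mu>) *\<^sub>R cis (real_of_int k * (x - \<mu>))) * cis (real_of_int k * \<mu>)"
    unfolding set_lebesgue_integral_def by (rule integral_mult_left_zero)
  finally show ?thesis unfolding poisson_kernel_fourier[OF r] .
qed

section \<open>Candidate densities of the two angles\<close>

context
  fixes \<rho>1 \<rho>2 \<mu> :: real
  assumes rho: "0 \<le> \<rho>1" "\<rho>1 < 1" "0 < \<rho>2" "\<rho>2 < 1"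
begin

text \<open>By the strong Markov property, the second exit angle is governed by the Poisson kernel of the
  large disc at the first exit point \<open>cis (fst p)\<close>.\<close>
definition joint_density :: "real \<times> real \<Rightarrow> real" where
  "joint_density p = (indicator {-pi..<pi} (fst p) * poisson_kernel \<rho>1 (fst p - \<mu>)) *
     (indicator {-pi..<pi} (snd p) * poisson_kernel \<rho>2 (snd p - fst p))"

text \<open>The exit law from the large disc seen directly from the start: the parameter is the
  starting modulus \<open>\<rho>1\<close> divided by the radius \<open>1 / \<rho>2\<close>.\<close>

definition exit_density :: "real \<Rightarrow> real" where
  "exit_density x = indicator {-pi..<pi} x * poisson_kernel (\<rho>1 * \<rho>2) (x - \<mu>)"

lemma rho_prod: "0 \<le> \<rho>1 * \<rho>2" "\<rho>1 * \<rho>2 < 1"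
proof -
  show "0 \<le> \<rho>1 * \<rho>2" using rho by simp
  have "\<rho>1 * \<rho>2 \<le> 1 * \<rho>2" using rho by (intro mult_right_mono) auto
  then show "\<rho>1 * \<rho>2 < 1" using rho by linarith
qed

lemma joint_density_nonneg: "0 \<le> joint_density p"
  using poisson_kernel_pos[OF rho(1,2)] poisson_kernel_pos[of \<rho>2] rho
  by (simp add: joint_density_def less_imp_le)

lemma exit_density_nonneg: "0 \<le> exit_density x"
  using poisson_kernel_pos[OF rho_prod] by (simp add: exit_density_def less_imp_le)

lemma joint_density_measurable [measurable]: "joint_density \<in> borel_measurable borel"
proof -
  have "(\<lambda>p::real \<times> real. poisson_kernel \<rho>1 (fst p - \<mu>)) \<in> borel_measurable borel"
    "(\<lambda>p::real \<times> real. poisson_kernel \<rho>2 (snd p - fst p)) \<in> borel_measurable borel"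
    using rho by (intro borel_measurable_continuous_onI poisson_kernel_continuous continuous_intros; simp)+
  moreover have ind: "indicator {-pi..<pi} \<in> borel_measurable (borel :: real measure)" by simp
  ultimately show ?thesis
    unfolding joint_density_def
    by (intro borel_measurable_times measurable_compose[OF borel_measurable_fst ind] measurable_compose[OF borel_measurable_snd ind])
qed

lemma exit_density_measurable [measurable]: "exit_density \<in> borel_measurable borel"
proof -
  have [measurable]: "(\<lambda>x. poisson_kernel (\<rho>1 * \<rho>2) (x - \<mu>)) \<in> borel_measurable borel"
    by (intro borel_measurable_continuous_onI poisson_kernel_continuous rho_prod continuous_intros)
  show ?thesis unfolding exit_density_def by measurable
qed

lemma joint_density_integrable: "integrable lborel joint_density"
proof -
  let ?K = "{-pi..pi} \<times> {-pi..pi}"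
  have "continuous_on ?K (\<lambda>p. poisson_kernel \<rho>1 (fst p - \<mu>) * poisson_kernel \<rho>2 (snd p - fst p))"
    using rho by (intro continuous_on_mult poisson_kernel_continuous continuous_intros; simp)
  then have "integrable lborel (\<lambda>p. indicator ?K p *\<^sub>R (poisson_kernel \<rho>1 (fst p - \<mu>) * poisson_kernel \<rho>2 (snd p - fst p)))"
    by (intro borel_integrable_compact compact_Times compact_Icc)
  then show ?thesis
  proof (rule Bochner_Integration.integrable_bound)
    show "AE p in lborel. norm (joint_density p) \<le> norm (indicator ?K p *\<^sub>R (poisson_kernel \<rho>1 (fst p - \<mu>) * poisson_kernel \<rho>2 (snd p - fst p)))"
    proof (rule AE_I2)
      fix p :: "real \<times> real"
      show "norm (joint_density p) \<le> norm (indicator ?K p *\<^sub>R (poisson_kernel \<rho>1 (fst p - \<mu>) * poisson_kernel \<rho>2 (snd p - fst p)))"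
      proof (cases "fst p \<in> {-pi..<pi} \<and> snd p \<in> {-pi..<pi}")
        case True
        then have "p \<in> ?K" by (auto simp: mem_Times_iff)
        then show ?thesis using True by (simp add: joint_density_def)
      next
        case False
        then have "joint_density p = 0" by (auto simp: joint_density_def)
        then show ?thesis by simp
      qed
    qed
  qed (simp add: joint_density_measurable)
qed

text \<open>Integrating over the second angle first, the kernel centred at the first angle x yields
  \<open>\<rho>2 ^ nat \<bar>m\<bar>\<close> and the exponential with frequency m at x. The first
  kernel is then evaluated at frequency n + m.\<close>

lemma joint_density_fourier:
  "(\<integral>p. joint_density p *\<^sub>R cis (real_of_int n * fst p + real_of_int m * snd p) \<partial>lborel)
    = of_real (\<rho>2 ^ nat \<bar>m\<bar> * \<rho>1 ^ nat \<bar>n + m\<bar>) * cis (real_of_int (n + m) * \<mu>)"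
proof -
  have C [measurable]: "(\<lambda>p::real \<times> real. cis (real_of_int n * fst p + real_of_int m * snd p)) \<in> borel_measurable borel"
    by (intro borel_measurable_continuous_onI continuous_intros)
  have int: "integrable (lborel \<Otimes>\<^sub>M lborel) (\<lambda>p. joint_density p *\<^sub>R cis (real_of_int n * fst p + real_of_int m * snd p))"
    unfolding lborel_prod
    by (rule Bochner_Integration.integrable_bound[OF joint_density_integrable]) simp_all
  have "(\<integral>p. joint_density p *\<^sub>R cis (real_of_int n * fst p + real_of_int m * snd p) \<partial>lborel)
    = (\<integral>x. (\<integral>y. joint_density (x, y) *\<^sub>R cis (real_of_int n * x + real_of_int m * y) \<partial>lborel) \<partial>lborel)"
    unfolding lborel_prod[symmetric] by (subst lborel_pair.integral_fst'[OF int, symmetric]) simp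
  also have "\<dots> = (\<integral>x. (of_real (\<rho>2 ^ nat \<bar>m\<bar>)) * ((indicator {-pi..<pi} x * poisson_kernel \<rho>1 (x - \<mu>)) *\<^sub>R cis (real_of_int (n + m) * x)) \<partial>lborel)"
  proof (rule Bochner_Integration.integral_cong[OF refl])
    fix x
    define w where "w = indicator {-pi..<pi} x * poisson_kernel \<rho>1 (x - \<mu>)"
    have "(\<integral>y. joint_density (x, y) *\<^sub>R cis (real_of_int n * x + real_of_int m * y) \<partial>lborel)
      = (\<integral>y. (of_real w * cis (real_of_int n * x)) * ((indicator {-pi..<pi} y * poisson_kernel \<rho>2 (y - x)) *\<^sub>R cis (real_of_int m * y)) \<partial>lborel)"
      by (rule Bochner_Integration.integral_cong[OF refl])
         (simp add: joint_density_def w_def scaleR_conv_of_real cis_mult[symmetric])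
    also have "\<dots> = (of_real w * cis (real_of_int n * x)) * (of_real (\<rho>2 ^ nat \<bar>m\<bar>) * cis (real_of_int m * x))"
      using rho by (simp only: integral_mult_right_zero poisson_kernel_fourier' less_imp_le)
    also have "\<dots> = of_real (\<rho>2 ^ nat \<bar>m\<bar>) * (w *\<^sub>R (cis (real_of_int n * x) * cis (real_of_int m * x)))"
      by (simp add: scaleR_conv_of_real)
    finally show "(\<integral>y. joint_density (x, y) *\<^sub>R cis (real_of_int n * x + real_of_int m * y) \<partial>lborel)
      = (of_real (\<rho>2 ^ nat \<bar>m\<bar>)) * ((indicator {-pi..<pi} x * poisson_kernel \<rho>1 (x - \<mu>)) *\<^sub>R cis (real_of_int (n + m) * x))"
      by (simp add: cis_mult distrib_right w_def)
  qed
  also have "\<dots> = of_real (\<rho>2 ^ nat \<bar>m\<bar>) * (of_real (\<rho>1 ^ nat \<bar>n + m\<bar>) * cis (real_of_int (n + m) * \<mu>))"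
    using rho by (simp only: integral_mult_right_zero poisson_kernel_fourier')
  finally show ?thesis by simp
qed

lemma exit_density_integrable: "integrable lborel exit_density"
proof -
  have "continuous_on {-pi..pi} (\<lambda>x. poisson_kernel (\<rho>1 * \<rho>2) (x - \<mu>))"
    by (intro poisson_kernel_continuous rho_prod continuous_intros)
  then have "integrable lborel (\<lambda>x. indicator {-pi..pi} x *\<^sub>R poisson_kernel (\<rho>1 * \<rho>2) (x - \<mu>))"
    by (intro borel_integrable_compact compact_Icc)
  then show ?thesis
  proof (rule Bochner_Integration.integrable_bound)
    show "AE x in lborel. norm (exit_density x) \<le> norm (indicator {-pi..pi} x *\<^sub>R poisson_kernel (\<rho>1 * \<rho>2) (x - \<mu>))"
      by (rule AE_I2) (simp add: exit_density_def indicator_def)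
  qed simp
qed

lemma exit_density_fourier:
  "(\<integral>x. exit_density x *\<^sub>R cis (real_of_int m * x) \<partial>lborel) = of_real ((\<rho>1 * \<rho>2) ^ nat \<bar>m\<bar>) * cis (real_of_int m * \<mu>)"
  unfolding exit_density_def by (rule poisson_kernel_fourier'[OF rho_prod])

text \<open>Bayes' rule.\<close>
lemma exit_density_times_cond_dens:
  "exit_density y * (indicator {-pi..<pi} x * cond_dens \<rho>1 \<mu> \<rho>2 y x) = joint_density (x, y)"
proof -
  define a where "a = 1 + \<rho>1\<^sup>2 - 2 * \<rho>1 * cos (x - \<mu>)"
  define b where "b = 1 + \<rho>2\<^sup>2 - 2 * \<rho>2 * cos (x - y)"
  \<comment> \<open>c and e are the variable parts of the denominator and the numerator of the exit
    kernel; dividing by that kernel puts c into the numerator and e into the denominator of the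
    constant in \<open>cond_dens\<close>.\<close>
  define c where "c = 1 + (\<rho>1 * \<rho>2)\<^sup>2 - 2 * (\<rho>1 * \<rho>2) * cos (y - \<mu>)"
  define e where "e = 1 - (\<rho>1 * \<rho>2)\<^sup>2"
  have pos: "0 < a" "0 < b" "0 < c"
    unfolding a_def b_def c_def by (intro poisson_denominator_pos; use rho rho_prod in simp)+
  have e: "e \<noteq> 0" using rho_prod power_strict_mono[of "\<rho>1 * \<rho>2" 1 2] by (auto simp: e_def)
  have c': "cos (\<mu> - y) = cos (y - \<mu>)" using cos_minus[of "y - \<mu>"] by simp
  have "poisson_kernel (\<rho>1 * \<rho>2) (y - \<mu>) * cond_dens \<rho>1 \<mu> \<rho>2 y x =
      (e / (2 * pi * c)) * ((1 - \<rho>1\<^sup>2) * (1 - \<rho>2\<^sup>2) * c / (2 * pi * e) / (a * b))"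
    by (simp only: poisson_kernel_def cond_dens_def a_def b_def c_def e_def c' power_mult_distrib mult.assoc)
  also have "\<dots> = ((1 - \<rho>1\<^sup>2) / (2 * pi * a)) * ((1 - \<rho>2\<^sup>2) / (2 * pi * b))"
  proof -
    have "e / (2 * pi * c) * (u * v * c / (2 * pi * e) / (a * b)) = (u / (2 * pi * a)) * (v / (2 * pi * b))" for u v
      using pos e by (simp add: field_simps)
    then show ?thesis .
  qed
  also have "\<dots> = poisson_kernel \<rho>1 (x - \<mu>) * poisson_kernel \<rho>2 (y - x)"
    unfolding poisson_kernel_even[of \<rho>2 y x] by (simp only: poisson_kernel_def a_def b_def)
  finally show ?thesis by (simp add: exit_density_def joint_density_def indicator_def)
qed

end

section \<open>The conditional density\<close>

text \<open>The conditional density is expressed by its defining property: for all Borel sets A and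
  S, the conditional probabilities of A integrated over S against the law of the second angle give
  the joint probability. Conditioning on the angle amounts to conditioning on the position, since
  the radius is almost surely fixed.\<close>

theorem theorem1:
  fixes M :: "'w measure" and B :: "real \<Rightarrow> 'w \<Rightarrow> complex"
    and \<rho>1 \<mu>1 \<rho>2 :: real
  assumes "0 \<le> \<rho>1" "\<rho>1 < 1" "-pi \<le> \<mu>1" "\<mu>1 < pi"
    and "0 < \<rho>2" "\<rho>2 < 1"
    and "brownian_motion_C M B (complex_of_real \<rho>1 * cis \<mu>1)"
    and "A \<in> sets borel" "S \<in> sets borel"
  shows "measure M {\<omega> \<in> space M.
            ang (B (hit_time B 1 \<omega>) \<omega>) \<in> A \<and>
            ang (B (hit_time B (1 / \<rho>2) \<omega>) \<omega>) \<in> S}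
       = integral\<^sup>L (distr M borel (\<lambda>\<omega>. ang (B (hit_time B (1 / \<rho>2) \<omega>) \<omega>)))
           (\<lambda>\<mu>2. indicator S \<mu>2 *
              set_lebesgue_integral lborel (A \<inter> {-pi..<pi}) (cond_dens \<rho>1 \<mu>1 \<rho>2 \<mu>2))"
proof -
  interpret prob_space M
    using assms(7) by (simp add: brownian_motion_C_def)
  interpret planar_brownian_motion M B "complex_of_real \<rho>1 * cis \<mu>1"
    by unfold_locales (rule assms(7))
  note rho = assms(1,2,5,6)
  define \<Theta> where "\<Theta> \<omega> = ang (B (hit_time B 1 \<omega>) \<omega>)" for \<omega>
  define \<Phi> where "\<Phi> \<omega> = ang (B (hit_time B (1 / \<rho>2) \<omega>) \<omega>)" for \<omega>
  define q where "q = joint_density \<rho>1 \<rho>2 \<mu>1"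
  define q2 where "q2 = exit_density \<rho>1 \<rho>2 \<mu>1"
  have x0: "cmod (complex_of_real \<rho>1 * cis \<mu>1) < 1" using rho by (simp add: norm_mult)
  moreover have "1 < 1 / \<rho>2" using rho by simp
  ultimately have x0': "cmod (complex_of_real \<rho>1 * cis \<mu>1) < 1 / \<rho>2" by linarith
  have \<Theta>: "\<Theta> \<in> borel_measurable M" and \<Phi>: "\<Phi> \<in> borel_measurable M"
    unfolding \<Theta>_def \<Phi>_def using hit_angle_measurable x0 x0' by blast+
  have rng: "\<Theta> \<omega> \<in> {-pi..<pi}" "\<Phi> \<omega> \<in> {-pi..<pi}" for \<omega>
    using ang_range by (auto simp: \<Theta>_def \<Phi>_def)
  have fourier: "(\<integral>\<omega>. cis (real_of_int n * \<Theta> \<omega> + real_of_int m * \<Phi> \<omega>) \<partial>M)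
      = of_real (\<rho>2 ^ nat \<bar>m\<bar> * \<rho>1 ^ nat \<bar>n + m\<bar>) * cis (real_of_int (n + m) * \<mu>1)" for n m
    unfolding \<Theta>_def \<Phi>_def by (rule hit_angles_fourier[OF refl rho])
  have q_meas: "q \<in> borel_measurable borel" and q_nonneg: "\<And>p. 0 \<le> q p" and q_int: "integrable lborel q"
    unfolding q_def using joint_density_measurable joint_density_nonneg joint_density_integrable rho by blast+
  have q2_meas: "q2 \<in> borel_measurable borel" and q2_nonneg: "\<And>p. 0 \<le> q2 p" and q2_int: "integrable lborel q2"
    unfolding q2_def using exit_density_measurable exit_density_nonneg exit_density_integrable rho by blast+
  have mode_meas: "(\<lambda>p::real \<times> real. cis (real_of_int n * fst p + real_of_int m * snd p)) \<in> borel_measurable borel" for n m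
    by (intro borel_measurable_continuous_onI continuous_intros)
  have prob_density: "prob_space (density lborel (\<lambda>x. ennreal (f x)))"
    if "integrable lborel f" "\<And>x. 0 \<le> f x" "(\<integral>x. f x \<partial>lborel) = 1" for f :: "'c :: euclidean_space \<Rightarrow> real"
    using that by (intro prob_spaceI) (auto simp: emeasure_density nn_integral_eq_integral)

  have joint_law: "distr M borel (\<lambda>\<omega>. (\<Theta> \<omega>, \<Phi> \<omega>)) = density lborel (\<lambda>p. ennreal (q p))"
  proof (rule angle_measure_eqI)
    have pair: "(\<lambda>\<omega>. (\<Theta> \<omega>, \<Phi> \<omega>)) \<in> borel_measurable M" by (intro borel_measurable_Pair \<Theta> \<Phi>)
    show "prob_space (distr M borel (\<lambda>\<omega>. (\<Theta> \<omega>, \<Phi> \<omega>)))" by (rule prob_space_distr[OF pair])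
    \<comment> \<open>The Fourier coefficient at frequency (0, 0) is the total mass.\<close>
    have "complex_of_real (\<integral>p. q p \<partial>lborel) = 1"
      using joint_density_fourier[OF rho, of \<mu>1 0 0]
      by (simp add: q_def scaleR_conv_of_real)
    then show "prob_space (density lborel (\<lambda>p. ennreal (q p)))"
      by (intro prob_density q_int q_nonneg) simp
    show "(\<integral>p. cis (real_of_int n * fst p + real_of_int m * snd p) \<partial>distr M borel (\<lambda>\<omega>. (\<Theta> \<omega>, \<Phi> \<omega>))) =
        (\<integral>p. cis (real_of_int n * fst p + real_of_int m * snd p) \<partial>density lborel (\<lambda>p. ennreal (q p)))" for n m
    proof -
      have "(\<integral>p. cis (real_of_int n * fst p + real_of_int m * snd p) \<partial>distr M borel (\<lambda>\<omega>. (\<Theta> \<omega>, \<Phi> \<omega>)))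
          = (\<integral>\<omega>. cis (real_of_int n * \<Theta> \<omega> + real_of_int m * \<Phi> \<omega>) \<partial>M)"
        by (subst integral_distr[OF pair mode_meas]) simp
      also have "\<dots> = (\<integral>p. q p *\<^sub>R cis (real_of_int n * fst p + real_of_int m * snd p) \<partial>lborel)"
        unfolding fourier q_def by (rule joint_density_fourier[OF rho, symmetric])
      also have "\<dots> = (\<integral>p. cis (real_of_int n * fst p + real_of_int m * snd p) \<partial>density lborel (\<lambda>p. ennreal (q p)))"
        by (rule integral_density[symmetric]) (use mode_meas q_meas q_nonneg in auto)
      finally show ?thesis .
    qed
    have sq: "{-pi..<pi} \<times> {-pi..<pi} \<in> sets (borel :: (real \<times> real) measure)" by (intro borel_Times) auto
    show "AE p in distr M borel (\<lambda>\<omega>. (\<Theta> \<omega>, \<Phi> \<omega>)). p \<in> {-pi..<pi} \<times> {-pi..<pi}"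
      by (subst AE_distr_iff[OF pair]) (use sq rng in auto)
    have "p \<in> {-pi..<pi} \<times> {-pi..<pi}" if "0 < q p" for p
      using that by (cases "fst p \<in> {-pi..<pi} \<and> snd p \<in> {-pi..<pi}")
        (auto simp: q_def joint_density_def[OF rho] mem_Times_iff)
    then show "AE p in density lborel (\<lambda>p. ennreal (q p)). p \<in> {-pi..<pi} \<times> {-pi..<pi}"
      using q_meas by (subst AE_density) auto
  qed auto

  have exit_law: "distr M borel \<Phi> = density lborel (\<lambda>x. ennreal (q2 x))"
  proof -
    interpret Q: prob_space "density lborel (\<lambda>x. ennreal (q2 x))"
    proof -
      have "complex_of_real (\<integral>x. q2 x \<partial>lborel) = 1"
        using exit_density_fourier[OF rho, of \<mu>1 0] by (simp add: q2_def scaleR_conv_of_real)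
      then show "prob_space (density lborel (\<lambda>x. ennreal (q2 x)))"
        by (intro prob_density q2_int q2_nonneg) simp
    qed
    \<comment> \<open>A single angle is embedded as the second coordinate of a pair with first
      coordinate 0, so that uniqueness for pairs also applies to the marginal.\<close>
    define j where "j x = (0 :: real, x :: real)" for x
    have j: "j \<in> borel_measurable borel"
      unfolding j_def by (intro borel_measurable_continuous_onI continuous_intros)
    have jM: "(\<lambda>\<omega>. j (\<Phi> \<omega>)) \<in> borel_measurable M" by (rule measurable_compose[OF \<Phi> j])
    have jQ: "j \<in> borel_measurable (density lborel (\<lambda>x. ennreal (q2 x)))"
      using j by (simp cong: measurable_cong_sets)
    have "distr M borel (\<lambda>\<omega>. j (\<Phi> \<omega>)) = distr (density lborel (\<lambda>x. ennreal (q2 x))) borel j"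
    proof (rule angle_measure_eqI)
      show "prob_space (distr M borel (\<lambda>\<omega>. j (\<Phi> \<omega>)))" by (rule prob_space_distr[OF jM])
      show "prob_space (distr (density lborel (\<lambda>x. ennreal (q2 x))) borel j)" by (rule Q.prob_space_distr[OF jQ])
      show "(\<integral>p. cis (real_of_int n * fst p + real_of_int m * snd p) \<partial>distr M borel (\<lambda>\<omega>. j (\<Phi> \<omega>))) =
        (\<integral>p. cis (real_of_int n * fst p + real_of_int m * snd p) \<partial>distr (density lborel (\<lambda>x. ennreal (q2 x))) borel j)" for n m
      proof -
        have cm: "(\<lambda>x. cis (real_of_int m * x)) \<in> borel_measurable borel"
          by (intro borel_measurable_continuous_onI continuous_intros)
        \<comment> \<open>The first coordinate is constantly 0, so n may be replaced by 0 and the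
          coefficient becomes a joint one.\<close>
        have "(\<integral>p. cis (real_of_int n * fst p + real_of_int m * snd p) \<partial>distr M borel (\<lambda>\<omega>. j (\<Phi> \<omega>)))
          = (\<integral>\<omega>. cis (real_of_int 0 * \<Theta> \<omega> + real_of_int m * \<Phi> \<omega>) \<partial>M)"
          by (subst integral_distr[OF jM mode_meas]) (simp add: j_def)
        also have "\<dots> = of_real ((\<rho>1 * \<rho>2) ^ nat \<bar>m\<bar>) * cis (real_of_int m * \<mu>1)"
          unfolding fourier by (simp add: power_mult_distrib mult.commute)
        also have "\<dots> = (\<integral>x. q2 x *\<^sub>R cis (real_of_int m * x) \<partial>lborel)"
          unfolding q2_def by (rule exit_density_fourier[OF rho, symmetric])
        also have "\<dots> = (\<integral>x. cis (real_of_int m * x) \<partial>density lborel (\<lambda>x. ennreal (q2 x)))"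
          by (rule integral_density[symmetric]) (use cm q2_meas q2_nonneg in auto)
        also have "\<dots> = (\<integral>p. cis (real_of_int n * fst p + real_of_int m * snd p) \<partial>distr (density lborel (\<lambda>x. ennreal (q2 x))) borel j)"
          by (subst integral_distr[OF jQ mode_meas]) (simp add: j_def)
        finally show ?thesis .
      qed
      have sq: "{-pi..<pi} \<times> {-pi..<pi} \<in> sets (borel :: (real \<times> real) measure)" by (intro borel_Times) auto
      show "AE p in distr M borel (\<lambda>\<omega>. j (\<Phi> \<omega>)). p \<in> {-pi..<pi} \<times> {-pi..<pi}"
        by (subst AE_distr_iff[OF jM]) (use sq rng in \<open>auto simp: j_def\<close>)
      have "j x \<in> {-pi..<pi} \<times> {-pi..<pi}" if "0 < q2 x" for x
        using that by (cases "x \<in> {-pi..<pi}") (auto simp: q2_def exit_density_def[OF rho] j_def)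
      then have "AE x in density lborel (\<lambda>x. ennreal (q2 x)). j x \<in> {-pi..<pi} \<times> {-pi..<pi}"
        using q2_meas by (subst AE_density) auto
      then show "AE p in distr (density lborel (\<lambda>x. ennreal (q2 x))) borel j. p \<in> {-pi..<pi} \<times> {-pi..<pi}"
        by (subst AE_distr_iff[OF jQ]) (use sq in auto)
    qed auto
    then have "distr (distr M borel (\<lambda>\<omega>. j (\<Phi> \<omega>))) borel snd = distr (distr (density lborel (\<lambda>x. ennreal (q2 x))) borel j) borel snd"
      by simp
    then have "distr M borel (snd \<circ> (\<lambda>\<omega>. j (\<Phi> \<omega>))) = distr (density lborel (\<lambda>x. ennreal (q2 x))) borel (snd \<circ> j)"
      by (simp only: distr_distr[OF borel_measurable_snd jM] distr_distr[OF borel_measurable_snd jQ])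
    moreover have "snd \<circ> (\<lambda>\<omega>. j (\<Phi> \<omega>)) = \<Phi>" "snd \<circ> j = (\<lambda>x. x)" by (auto simp: j_def)
    ultimately show ?thesis by (simp add: distr_id2)
  qed

  define F where "F p = q p * (indicator A (fst p) * indicator S (snd p))" for p
  have AS: "A \<times> S \<in> sets (borel :: (real \<times> real) measure)" using assms(8,9) by (rule borel_Times)
  have F_eq: "F p = indicator (A \<times> S) p * q p" for p
    by (simp add: F_def indicator_def mem_Times_iff)
  have F_int: "integrable (lborel \<Otimes>\<^sub>M lborel) F"
    unfolding lborel_prod F_eq[abs_def]
    using integrable_real_mult_indicator[OF _ q_int, of "A \<times> S"] AS by (simp add: mult.commute)
  have "measure M {\<omega> \<in> space M. \<Theta> \<omega> \<in> A \<and> \<Phi> \<omega> \<in> S} = measure (distr M borel (\<lambda>\<omega>. (\<Theta> \<omega>, \<Phi> \<omega>))) (A \<times> S)"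
    by (subst measure_distr[OF borel_measurable_Pair[OF \<Theta> \<Phi>] AS]) (auto intro!: arg_cong[where f="measure M"])
  also have "\<dots> = (\<integral>p. indicator (A \<times> S) p \<partial>density lborel (\<lambda>p. ennreal (q p)))"
    unfolding joint_law using AS by simp
  also have "\<dots> = (\<integral>p. F p \<partial>(lborel \<Otimes>\<^sub>M lborel))"
    unfolding lborel_prod F_eq[abs_def]
    by (subst integral_density) (use AS q_meas q_nonneg in \<open>auto simp: mult.commute\<close>)
  \<comment> \<open>The angle conditioned upon is integrated last, so that its density
    \<open>q2\<close> can be factored out of the inner integral.\<close>
  also have "\<dots> = (\<integral>y. (\<integral>x. F (x, y) \<partial>lborel) \<partial>lborel)"
    using lborel_pair.integral_snd[of "\<lambda>x y. F (x, y)"] F_int by simp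
  also have "\<dots> = (\<integral>y. q2 y *\<^sub>R (indicator S y * set_lebesgue_integral lborel (A \<inter> {-pi..<pi}) (cond_dens \<rho>1 \<mu>1 \<rho>2 y)) \<partial>lborel)"
  proof (rule Bochner_Integration.integral_cong[OF refl])
    fix y
    have "F (x, y) = (q2 y * indicator S y) * (indicator (A \<inter> {-pi..<pi}) x *\<^sub>R cond_dens \<rho>1 \<mu>1 \<rho>2 y x)" for x
      using exit_density_times_cond_dens[OF rho, of \<mu>1 y x]
      by (simp add: F_def q_def q2_def indicator_inter_arith mult_ac flip: exit_density_times_cond_dens[OF rho, of \<mu>1 y x])
    then have "(\<integral>x. F (x, y) \<partial>lborel) = (q2 y * indicator S y) * set_lebesgue_integral lborel (A \<inter> {-pi..<pi}) (cond_dens \<rho>1 \<mu>1 \<rho>2 y)"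
      unfolding set_lebesgue_integral_def by (simp only: integral_mult_right_zero)
    then show "(\<integral>x. F (x, y) \<partial>lborel) = q2 y *\<^sub>R (indicator S y * set_lebesgue_integral lborel (A \<inter> {-pi..<pi}) (cond_dens \<rho>1 \<mu>1 \<rho>2 y))"
      by simp
  qed
  also have "\<dots> = (\<integral>y. indicator S y * set_lebesgue_integral lborel (A \<inter> {-pi..<pi}) (cond_dens \<rho>1 \<mu>1 \<rho>2 y) \<partial>density lborel (\<lambda>x. ennreal (q2 x)))"
  proof (rule integral_density[symmetric])
    have "(\<lambda>(y, x). cond_dens \<rho>1 \<mu>1 \<rho>2 y x) \<in> borel_measurable (borel \<Otimes>\<^sub>M borel)"
      unfolding cond_dens_def by measurable
    then have "(\<lambda>(y, x). indicator (A \<inter> {-pi..<pi}) x *\<^sub>R cond_dens \<rho>1 \<mu>1 \<rho>2 y x) \<in> borel_measurable (borel \<Otimes>\<^sub>M lborel)"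
      using assms(8) by measurable
    then have "(\<lambda>y. set_lebesgue_integral lborel (A \<inter> {-pi..<pi}) (cond_dens \<rho>1 \<mu>1 \<rho>2 y)) \<in> borel_measurable borel"
      unfolding set_lebesgue_integral_def by (rule lborel.borel_measurable_lebesgue_integral)
    then show "(\<lambda>y. indicator S y * set_lebesgue_integral lborel (A \<inter> {-pi..<pi}) (cond_dens \<rho>1 \<mu>1 \<rho>2 y)) \<in> borel_measurable lborel"
      using assms(9) by simp
  qed (use q2_meas q2_nonneg in auto)
  finally show ?thesis
    unfolding exit_law[symmetric] \<Theta>_def \<Phi>_def .
qed

end
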